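(* Up to equivalence there are exactly two distinct $\mathbb{G}_a^2$-structures on $\mathbb{P}^2$. They are given by the following representations of $\mathbb{G}_a^2$: $$\tau_2(a_1,a_2)=\begin{pmatrix}1&0&a_2\\0&1&a_1\\0&0&1\end{pmatrix},\qquad \rho(a_1,a_2)=\begin{pmatrix}1&a_1&a_2+\tfrac12a_1^2\\0&1&a_1\\0&0&1\end{pmatrix}.$$ They correspond, respectively, to the quotients of $F[S_1,S_2]$ by the ideals $I_1=(S_1S_2,\,S_2^2,\,S_1^2)$ and $I_2=(S_1S_2,\,S_2-S_1^2)$.
   Context: The base field is $F=\overline{\mathbb{Q}}$. For a connected linear algebraic group $\mathbb{G}$, a $\mathbb{G}$-variety is a variety $X$ with a fixed left $\mathbb{G}$-action such that the stabilizer of a generic point is trivial and the orbit of a generic point is dense. A $\mathbb{G}$-structure on a variety $Y$ is a $\mathbb{G}$-action making $Y$ a $\mathbb{G}$-variety. Two $\mathbb{G}$-varieties $X_1,X_2$ are equivalent if there are $\alpha\in\mathrm{Aut}(\mathbb{G})$ and an isomorphism of varieties $j:X_1\to X_2$ with $j(g\cdot x)=\alpha(g)\cdot j(x)$. Correspondence with algebras: if $R=F[S_1,\dots,S_n]/I$ is an Artinian local algebra of length $n+1$ in which the images of $S_1,\dots,S_n$ form a basis of the maximal ideal, the corresponding $\mathbb{G}_a^n$-structure on $\mathbb{P}(R)\cong\mathbb{P}^n$ (lines in $R$) is the one in which $(a_1,\dots,a_n)$ acts by multiplication by $\exp(a_1S_1+\dots+a_nS_n)$. *)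

theory Defs
  imports
    "HOL-Analysis.Analysis"
    "HOL-Algebra.Algebraic_Closure_Type"
    "HOL-Algebra.QuotRing"
    "HOL-Library.Poly_Mapping"
    "HOL-Library.Extended_Nat"
begin

section \<open>Base field and polynomials\<close>

type_synonym qbar = "rat alg_closure"

text \<open>The polynomial ring over \<open>qbar\<close> in the variables indexed by the finite type \<open>'i\<close>;
  a monomial is an exponent vector \<open>'i \<Rightarrow>\<^sub>0 nat\<close>.\<close>

type_synonym 'i mpoly = "('i \<Rightarrow>\<^sub>0 nat) \<Rightarrow>\<^sub>0 qbar"

definition mconst :: "qbar \<Rightarrow> 'i mpoly" where
  "mconst c = Poly_Mapping.single 0 c"

definition mvar :: "'i \<Rightarrow> 'i mpoly" where
  "mvar i = Poly_Mapping.single (Poly_Mapping.single i 1) 1"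

definition mpoly_eval :: "('i::finite) mpoly \<Rightarrow> qbar ^ 'i \<Rightarrow> qbar" where
  "mpoly_eval p x =
     (\<Sum>m\<in>Poly_Mapping.keys p.
        Poly_Mapping.lookup p m * (\<Prod>i\<in>UNIV. x $ i ^ Poly_Mapping.lookup m i))"

definition weight_homogeneous :: "('i::finite \<Rightarrow> nat) \<Rightarrow> nat \<Rightarrow> 'i mpoly \<Rightarrow> bool" where
  "weight_homogeneous w d p \<longleftrightarrow>
     (\<forall>m\<in>Poly_Mapping.keys p. (\<Sum>i\<in>UNIV. w i * Poly_Mapping.lookup m i) = d)"

section \<open>Varieties given by homogeneous coordinates\<close>

text \<open>
  A variety (identified with its set of closed points) is presented by the set \<open>coords\<close> of
  admissible coordinate vectors, the map \<open>pt\<close> from coordinate vectors to points, and a weight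
  for each coordinate. The weights are 0 for affine and 1 for homogeneous coordinates, so that one
  definition of the Zariski topology and of the sheaf of regular functions covers affine space,
  projective space, and the product of an affine and a projective space.
\<close>

record ('i, 'p) presented_variety =
  coords :: "(qbar ^ 'i) set"
  pt :: "qbar ^ 'i \<Rightarrow> 'p"
  weight :: "'i \<Rightarrow> nat"

definition zariski :: "('i::finite, 'p) presented_variety \<Rightarrow> 'p topology" where
  "zariski Z = topology_generated_by
     {pt Z ` {x \<in> coords Z. mpoly_eval f x \<noteq> 0} | f d. weight_homogeneous (weight Z) d f}"

lemma topspace_zariski: "topspace (zariski Z) = pt Z ` coords Z"
proof -
  have "pt Z ` coords Z \<subseteq> pt Z ` {x \<in> coords Z. mpoly_eval (mconst 1) x \<noteq> 0}"
    by (auto simp: mpoly_eval_def mconst_def)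
  moreover have "weight_homogeneous (weight Z) 0 (mconst 1)"
    by (auto simp: weight_homogeneous_def mconst_def)
  ultimately show ?thesis
    unfolding zariski_def topology_generated_by_topspace by blast
qed

text \<open>The regular functions on an open set \<open>U\<close> are the functions that are locally quotients of
  two polynomials of the same degree. Only the values on \<open>U\<close> matter.\<close>

definition regular_functions ::
    "('i::finite, 'p) presented_variety \<Rightarrow> 'p set \<Rightarrow> ('p \<Rightarrow> qbar) set" where
  "regular_functions Z U = {h. \<forall>p\<in>U. \<exists>V f g d.
     openin (zariski Z) V \<and> p \<in> V \<and> V \<subseteq> U \<and>
     weight_homogeneous (weight Z) d f \<and> weight_homogeneous (weight Z) d g \<and>
     (\<forall>x\<in>coords Z. pt Z x \<in> V \<longrightarrow>
        mpoly_eval g x \<noteq> 0 \<and> h (pt Z x) = mpoly_eval f x / mpoly_eval g x)}"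

definition morphism ::
    "('i::finite, 'p) presented_variety \<Rightarrow> ('j::finite, 'q) presented_variety \<Rightarrow> ('p \<Rightarrow> 'q) \<Rightarrow> bool"
  where
  "morphism Z W f \<longleftrightarrow>
     continuous_map (zariski Z) (zariski W) f \<and>
     (\<forall>V. openin (zariski W) V \<longrightarrow> (\<forall>h\<in>regular_functions W V.
        h \<circ> f \<in> regular_functions Z {p \<in> topspace (zariski Z). f p \<in> V}))"

definition isomorphism ::
    "('i::finite, 'p) presented_variety \<Rightarrow> ('j::finite, 'q) presented_variety \<Rightarrow> ('p \<Rightarrow> 'q) \<Rightarrow> bool"
  where
  "isomorphism Z W f \<longleftrightarrow>
     morphism Z W f \<and>
     (\<exists>g. morphism W Z g \<and>
        (\<forall>p\<in>topspace (zariski Z). g (f p) = p) \<and> (\<forall>q\<in>topspace (zariski W). f (g q) = q))"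

lemma morphism_id: "morphism Z Z (\<lambda>p. p)"
  unfolding morphism_def regular_functions_def
proof (intro conjI allI impI ballI, goal_cases)
  case 1
  then show ?case by simp
next
  case (2 V h)
  then have "V \<subseteq> topspace (zariski Z)" by (simp add: openin_subset)
  then have "{p \<in> topspace (zariski Z). p \<in> V} = V" by auto
  with 2 show ?case by (simp add: comp_def)
qed

lemma morphism_comp:
  assumes f: "morphism Z W f" and g: "morphism W X' g"
  shows "morphism Z X' (\<lambda>p. g (f p))"
  unfolding morphism_def
proof (intro conjI allI impI ballI)
  show "continuous_map (zariski Z) (zariski X') (\<lambda>p. g (f p))"
    using f g continuous_map_compose[of "zariski Z" "zariski W" f "zariski X'" g]
    by (simp add: morphism_def comp_def)
  fix V h assume V: "openin (zariski X') V" and h: "h \<in> regular_functions X' V"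
  let ?V = "{q \<in> topspace (zariski W). g q \<in> V}"
  have "openin (zariski W) ?V"
    using g V by (auto simp: morphism_def intro: openin_continuous_map_preimage)
  moreover have "h \<circ> g \<in> regular_functions W ?V"
    using g V h by (auto simp: morphism_def)
  ultimately have "(h \<circ> g) \<circ> f \<in> regular_functions Z {p \<in> topspace (zariski Z). f p \<in> ?V}"
    using f by (auto simp: morphism_def)
  moreover have "{p \<in> topspace (zariski Z). f p \<in> ?V} =
      {p \<in> topspace (zariski Z). g (f p) \<in> V}"
    using f by (auto simp: morphism_def dest: continuous_map_funspace)
  ultimately show "h \<circ> (\<lambda>p. g (f p)) \<in>
      regular_functions Z {p \<in> topspace (zariski Z). g (f p) \<in> V}"
    by (simp add: comp_def)
qed

lemma morphism_in: "morphism Z W f \<Longrightarrow> p \<in> topspace (zariski Z) \<Longrightarrow> f p \<in> topspace (zariski W)"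
  by (auto simp: morphism_def dest: continuous_map_funspace)

lemma isomorphism_id: "isomorphism Z Z (\<lambda>p. p)"
  unfolding isomorphism_def using morphism_id by blast

lemma isomorphism_comp:
  assumes f: "isomorphism Z W f" and g: "isomorphism W X' g"
  shows "isomorphism Z X' (\<lambda>p. g (f p))"
proof -
  obtain f' where f': "morphism W Z f'" "\<forall>p\<in>topspace (zariski Z). f' (f p) = p"
    "\<forall>q\<in>topspace (zariski W). f (f' q) = q" using f by (auto simp: isomorphism_def)
  obtain g' where g': "morphism X' W g'" "\<forall>p\<in>topspace (zariski W). g' (g p) = p"
    "\<forall>q\<in>topspace (zariski X'). g (g' q) = q" using g by (auto simp: isomorphism_def)
  have m: "morphism Z W f" "morphism W X' g" using f g by (auto simp: isomorphism_def)
  show ?thesis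
    unfolding isomorphism_def
    using morphism_comp[OF m] morphism_comp[OF g'(1) f'(1)] f' g'
      morphism_in[OF m(1)] morphism_in[OF g'(1)]
    by (intro conjI exI[of _ "\<lambda>q. f' (g' q)"]) auto
qed

definition affine_space :: "('n::finite, qbar ^ 'n) presented_variety" where
  "affine_space = \<lparr>coords = UNIV, pt = (\<lambda>x. x), weight = (\<lambda>_. 0)\<rparr>"

text \<open>Points of the projective space of \<open>qbar ^ 'k\<close> are the lines through the origin, so its
  dimension is \<open>CARD('k) - 1\<close>.\<close>

definition projective_space :: "('k::finite, (qbar ^ 'k) set) presented_variety" where
  "projective_space = \<lparr>coords = {x. x \<noteq> 0}, pt = (\<lambda>x. vec.span {x}), weight = (\<lambda>_. 1)\<rparr>"

definition affine_times_projective ::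
    "('n::finite + 'k::finite, (qbar ^ 'n) \<times> (qbar ^ 'k) set) presented_variety" where
  "affine_times_projective =
     \<lparr>coords = {x. (\<chi> j. x $ Inr j) \<noteq> (0 :: qbar ^ 'k)},
      pt = (\<lambda>x. (\<chi> i. x $ Inl i, vec.span {\<chi> j. x $ Inr j})),
      weight = case_sum (\<lambda>_. 0) (\<lambda>_. 1)\<rparr>"

abbreviation proj_points :: "((qbar ^ 'k::finite) set) set" where
  "proj_points \<equiv> topspace (zariski projective_space)"

lemma topspace_affine_space: "topspace (zariski affine_space) = UNIV"
  by (simp add: topspace_zariski affine_space_def)

lemma proj_points_eq: "proj_points = {vec.span {v} | v. v \<noteq> 0}"
  by (auto simp: topspace_zariski projective_space_def)

lemma topspace_affine_times_projective:
  "topspace (zariski (affine_times_projective ::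
     ('n::finite + 'k::finite, (qbar ^ 'n) \<times> (qbar ^ 'k) set) presented_variety)) =
   UNIV \<times> proj_points"
proof -
  have "(a, vec.span {v}) \<in> pt affine_times_projective ` coords affine_times_projective"
    if "v \<noteq> 0" for a :: "qbar ^ 'n" and v :: "qbar ^ 'k"
    using that
    by (intro image_eqI[of _ _ "\<chi> i. case_sum (($) a) (($) v) i"])
      (auto simp: affine_times_projective_def vec_lambda_eta)
  moreover have "pt affine_times_projective ` coords affine_times_projective \<subseteq>
      (UNIV :: (qbar ^ 'n) set) \<times> {vec.span {v} | v :: qbar ^ 'k. v \<noteq> 0}"
    by (auto simp: affine_times_projective_def)
  ultimately show ?thesis
    unfolding topspace_zariski[of affine_times_projective] proj_points_eq by blast
qed

section \<open>Structures for the vector group on projective space\<close>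

text \<open>The vector group of dimension \<open>CARD('n)\<close> is \<open>qbar ^ 'n\<close> under addition. Projective space
  is irreducible, so a property of a generic point is one that holds on a nonempty open set.\<close>

definition generically :: "('i::finite, 'p) presented_variety \<Rightarrow> ('p \<Rightarrow> bool) \<Rightarrow> bool" where
  "generically Z P \<longleftrightarrow> (\<exists>U. openin (zariski Z) U \<and> U \<noteq> {} \<and> (\<forall>p\<in>U. P p))"

definition ga_structure ::
    "(qbar ^ 'n::finite \<Rightarrow> (qbar ^ 'k::finite) set \<Rightarrow> (qbar ^ 'k) set) \<Rightarrow> bool" where
  "ga_structure \<phi> \<longleftrightarrow>
     morphism affine_times_projective projective_space (\<lambda>(a, p). \<phi> a p) \<and>
     (\<forall>p\<in>proj_points. \<phi> 0 p = p) \<and>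
     (\<forall>a b. \<forall>p\<in>proj_points. \<phi> (a + b) p = \<phi> a (\<phi> b p)) \<and>
     generically projective_space (\<lambda>p. {a. \<phi> a p = p} = {0}) \<and>
     generically projective_space
       (\<lambda>p. Abstract_Topology.closure_of (zariski projective_space) (range (\<lambda>a. \<phi> a p)) = proj_points)"

definition ga_automorphism :: "(qbar ^ 'n::finite \<Rightarrow> qbar ^ 'n) \<Rightarrow> bool" where
  "ga_automorphism \<alpha> \<longleftrightarrow>
     isomorphism affine_space affine_space \<alpha> \<and> (\<forall>a b. \<alpha> (a + b) = \<alpha> a + \<alpha> b)"

definition ga_equivalent ::
    "(qbar ^ 'n::finite \<Rightarrow> (qbar ^ 'k::finite) set \<Rightarrow> (qbar ^ 'k) set) \<Rightarrow>
     (qbar ^ 'n \<Rightarrow> (qbar ^ 'k) set \<Rightarrow> (qbar ^ 'k) set) \<Rightarrow> bool" where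
  "ga_equivalent \<phi> \<psi> \<longleftrightarrow>
     (\<exists>\<alpha> j. ga_automorphism \<alpha> \<and> isomorphism projective_space projective_space j \<and>
        (\<forall>a. \<forall>p\<in>proj_points. j (\<phi> a p) = \<psi> (\<alpha> a) (j p)))"

lemma ga_equivalent_equiv:
  "equiv {\<phi> :: qbar ^ 'n::finite \<Rightarrow> (qbar ^ 'k::finite) set \<Rightarrow> (qbar ^ 'k) set. ga_structure \<phi>}
     {(\<phi>, \<psi>). ga_structure \<phi> \<and> ga_structure \<psi> \<and> ga_equivalent \<phi> \<psi>}"
proof (rule equivI)
  show "refl_on {\<phi> :: qbar ^ 'n \<Rightarrow> (qbar ^ 'k) set \<Rightarrow> (qbar ^ 'k) set. ga_structure \<phi>}
      {(\<phi>, \<psi>). ga_structure \<phi> \<and> ga_structure \<psi> \<and> ga_equivalent \<phi> \<psi>}"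
    unfolding ga_equivalent_def ga_automorphism_def
    by (auto intro!: refl_onI exI[of _ "\<lambda>x. x"] isomorphism_id)
  show "sym {(\<phi> :: qbar ^ 'n \<Rightarrow> (qbar ^ 'k) set \<Rightarrow> (qbar ^ 'k) set, \<psi>).
      ga_structure \<phi> \<and> ga_structure \<psi> \<and> ga_equivalent \<phi> \<psi>}"
  proof (rule symI, clarify)
    fix \<phi> \<psi> :: "qbar ^ 'n \<Rightarrow> (qbar ^ 'k) set \<Rightarrow> (qbar ^ 'k) set"
    assume \<phi>: "ga_structure \<phi>" and "ga_equivalent \<phi> \<psi>"
    then obtain \<alpha> j where \<alpha>: "ga_automorphism \<alpha>"
      and j: "isomorphism projective_space projective_space j"
      and e: "\<And>a p. p \<in> proj_points \<Longrightarrow> j (\<phi> a p) = \<psi> (\<alpha> a) (j p)"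
      unfolding ga_equivalent_def by blast
    from \<alpha> obtain \<beta> where \<beta>: "morphism affine_space affine_space \<beta>"
      "\<And>a. \<beta> (\<alpha> a) = a" "\<And>a. \<alpha> (\<beta> a) = a"
      by (auto simp: ga_automorphism_def isomorphism_def topspace_affine_space)
    from j obtain g where g: "morphism projective_space projective_space g"
      "\<And>p. p \<in> proj_points \<Longrightarrow> g (j p) = p" "\<And>p. p \<in> proj_points \<Longrightarrow> j (g p) = p"
      by (auto simp: isomorphism_def)
    have cl: "\<phi> a p \<in> proj_points" if "p \<in> proj_points" for a p
      using \<phi> that morphism_in[of affine_times_projective projective_space "\<lambda>(a, p). \<phi> a p" "(a, p)"]
      by (auto simp: ga_structure_def topspace_affine_times_projective)
    have "\<beta> (a + b) = \<beta> a + \<beta> b" for a b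
      using \<alpha> \<beta>(2)[of "\<beta> a + \<beta> b"] \<beta>(3) by (simp add: ga_automorphism_def)
    then have "ga_automorphism \<beta>"
      using \<alpha> \<beta> by (auto simp: ga_automorphism_def isomorphism_def)
    moreover have "isomorphism projective_space projective_space g"
      using g j by (auto simp: isomorphism_def)
    moreover have "g (\<psi> b q) = \<phi> (\<beta> b) (g q)" if q: "q \<in> proj_points" for b q
    proof -
      have "g q \<in> proj_points" using g(1) q by (rule morphism_in)
      then have "j (\<phi> (\<beta> b) (g q)) = \<psi> b q" using e \<beta>(3) g(3)[OF q] by simp
      then show ?thesis using g(2) cl \<open>g q \<in> proj_points\<close> by metis
    qed
    ultimately show "ga_equivalent \<psi> \<phi>" unfolding ga_equivalent_def by blast
  qed
  show "trans {(\<phi> :: qbar ^ 'n \<Rightarrow> (qbar ^ 'k) set \<Rightarrow> (qbar ^ 'k) set, \<psi>).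
      ga_structure \<phi> \<and> ga_structure \<psi> \<and> ga_equivalent \<phi> \<psi>}"
  proof (rule transI, clarify)
    fix \<phi> \<psi> \<chi>' :: "qbar ^ 'n \<Rightarrow> (qbar ^ 'k) set \<Rightarrow> (qbar ^ 'k) set"
    assume "ga_equivalent \<phi> \<psi>" "ga_equivalent \<psi> \<chi>'"
    then obtain \<alpha> j \<beta> i where \<alpha>: "ga_automorphism \<alpha>" "ga_automorphism \<beta>"
      and j: "isomorphism projective_space projective_space j"
        "isomorphism projective_space projective_space i"
      and e: "\<And>a p. p \<in> proj_points \<Longrightarrow> j (\<phi> a p) = \<psi> (\<alpha> a) (j p)"
        "\<And>a p. p \<in> proj_points \<Longrightarrow> i (\<psi> a p) = \<chi>' (\<beta> a) (i p)"
      unfolding ga_equivalent_def by blast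
    have "j p \<in> proj_points" if "p \<in> proj_points" for p
      using j(1) that by (auto simp: isomorphism_def intro: morphism_in)
    moreover have "ga_automorphism (\<lambda>a. \<beta> (\<alpha> a))"
      using \<alpha> isomorphism_comp[of affine_space affine_space \<alpha> affine_space \<beta>]
      by (auto simp: ga_automorphism_def)
    ultimately show "ga_equivalent \<phi> \<chi>'"
      unfolding ga_equivalent_def using isomorphism_comp[OF j] e
      by (intro exI[of _ "\<lambda>a. \<beta> (\<alpha> a)"] exI[of _ "\<lambda>p. i (j p)"]) auto
  qed
qed auto

definition ga_representation :: "(qbar ^ 'n::finite \<Rightarrow> qbar ^ 'k ^ 'k::finite) \<Rightarrow> bool" where
  "ga_representation \<tau> \<longleftrightarrow>
     (\<forall>i j. (\<lambda>a. \<tau> a $ i $ j) \<in> regular_functions affine_space UNIV) \<and>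
     \<tau> 0 = mat 1 \<and> (\<forall>a b. \<tau> (a + b) = \<tau> a ** \<tau> b)"

definition proj_action ::
    "(qbar ^ 'n::finite \<Rightarrow> qbar ^ 'k ^ 'k::finite) \<Rightarrow> qbar ^ 'n \<Rightarrow> (qbar ^ 'k) set \<Rightarrow> (qbar ^ 'k) set"
  where
  "proj_action \<tau> a L = (\<lambda>v. \<tau> a *v v) ` L"

section \<open>Local algebras and the corresponding structures\<close>

definition artinian_ring :: "('a, 'b) ring_scheme \<Rightarrow> bool" where
  "artinian_ring R \<longleftrightarrow> cring R \<and> \<not> (\<exists>J. \<forall>i::nat. ideal (J i) R \<and> J (Suc i) \<subset> J i)"

text \<open>The length of \<open>R\<close> as a module over itself; its submodules are the ideals.\<close>

definition ring_length :: "('a, 'b) ring_scheme \<Rightarrow> enat" where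
  "ring_length R =
     (SUP l \<in> {l::nat. \<exists>J. (\<forall>i\<le>l. ideal (J i) R) \<and> (\<forall>i<l. J i \<subset> J (Suc i))}. enat l)"

abbreviation poly_ring :: "('i::finite) mpoly ring" where
  "poly_ring \<equiv> ring_of_type_algebra"

abbreviation quot_alg :: "('i::finite) mpoly set \<Rightarrow> 'i mpoly set ring" where
  "quot_alg I \<equiv> poly_ring Quot I"

abbreviation residue_class :: "('i::finite) mpoly set \<Rightarrow> 'i mpoly \<Rightarrow> 'i mpoly set" where
  "residue_class I p \<equiv> I +>\<^bsub>poly_ring\<^esub> p"

definition linear_form :: "qbar ^ 'n::finite \<Rightarrow> 'n mpoly" where
  "linear_form a = (\<Sum>i\<in>UNIV. mconst (a $ i) * mvar i)"

text \<open>The bijection says that the images of the variables form a basis of the maximal ideal.\<close>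

definition admissible_ideal :: "('n::finite) mpoly set \<Rightarrow> bool" where
  "admissible_ideal I \<longleftrightarrow>
     ideal I poly_ring \<and>
     artinian_ring (quot_alg I) \<and>
     ring_length (quot_alg I) = enat (CARD('n) + 1) \<and>
     (\<exists>!M. maximalideal M (quot_alg I)) \<and>
     (\<forall>M. maximalideal M (quot_alg I) \<longrightarrow>
        bij_betw (\<lambda>a::qbar ^ 'n. residue_class I (linear_form a)) UNIV M)"

text \<open>If the linear form is nilpotent modulo \<open>I\<close>, then only the terms of the exponential series
  that are nonzero modulo \<open>I\<close> are summed, and there are finitely many of them.\<close>

definition exp_class :: "('n::finite) mpoly set \<Rightarrow> qbar ^ 'n \<Rightarrow> 'n mpoly set" where
  "exp_class I a = residue_class I
     (\<Sum>k | linear_form a ^ k \<notin> I. mconst (1 / fact k) * linear_form a ^ k)"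

definition quot_line :: "('n::finite) mpoly set \<Rightarrow> 'n mpoly set \<Rightarrow> 'n mpoly set set" where
  "quot_line I r = range (\<lambda>c. residue_class I (mconst c) \<otimes>\<^bsub>quot_alg I\<^esub> r)"

definition quot_proj :: "('n::finite) mpoly set \<Rightarrow> 'n mpoly set set set" where
  "quot_proj I = quot_line I ` (carrier (quot_alg I) - {\<zero>\<^bsub>quot_alg I\<^esub>})"

definition exp_action ::
    "('n::finite) mpoly set \<Rightarrow> qbar ^ 'n \<Rightarrow> 'n mpoly set set \<Rightarrow> 'n mpoly set set" where
  "exp_action I a L = (\<lambda>r. exp_class I a \<otimes>\<^bsub>quot_alg I\<^esub> r) ` L"

definition linear_coordinates ::
    "('n::finite) mpoly set \<Rightarrow> (qbar ^ 'k::finite \<Rightarrow> 'n mpoly set) \<Rightarrow> bool" where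
  "linear_coordinates I \<theta> \<longleftrightarrow>
     bij_betw \<theta> UNIV (carrier (quot_alg I)) \<and>
     (\<forall>u v. \<theta> (u + v) = \<theta> u \<oplus>\<^bsub>quot_alg I\<^esub> \<theta> v) \<and>
     (\<forall>c v. \<theta> (c *s v) = residue_class I (mconst c) \<otimes>\<^bsub>quot_alg I\<^esub> \<theta> v)"

text \<open>The structure \<open>\<phi>\<close> is the one that corresponds to the quotient by \<open>I\<close>: a linear identification
  of \<open>qbar ^ 'k\<close> with the quotient algebra carries \<open>\<phi>\<close> to the action by exponentials on lines.\<close>

definition corresponds ::
    "(qbar ^ 'n::finite \<Rightarrow> (qbar ^ 'k::finite) set \<Rightarrow> (qbar ^ 'k) set) \<Rightarrow> 'n mpoly set \<Rightarrow> bool" where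
  "corresponds \<phi> I \<longleftrightarrow>
     admissible_ideal I \<and>
     (\<exists>\<theta>. linear_coordinates I \<theta> \<and>
        bij_betw ((`) \<theta>) proj_points (quot_proj I) \<and>
        (\<forall>a. \<forall>p\<in>proj_points. \<theta> ` \<phi> a p = exp_action I a (\<theta> ` p)))"

section \<open>The two structures on the plane\<close>

definition \<tau>\<^sub>2 :: "qbar ^ 2 \<Rightarrow> qbar ^ 3 ^ 3" where
  "\<tau>\<^sub>2 a = vector [vector [1, 0, a $ 2],
                   vector [0, 1, a $ 1],
                   vector [0, 0, 1]]"

definition \<rho> :: "qbar ^ 2 \<Rightarrow> qbar ^ 3 ^ 3" where
  "\<rho> a = vector [vector [1, a $ 1, a $ 2 + 1 / 2 * (a $ 1)^2],
                 vector [0, 1, a $ 1],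
                 vector [0, 0, 1]]"

definition I\<^sub>1 :: "2 mpoly set" where
  "I\<^sub>1 = Idl\<^bsub>poly_ring\<^esub> {mvar 1 * mvar 2, mvar 2 ^ 2, mvar 1 ^ 2}"

definition I\<^sub>2 :: "2 mpoly set" where
  "I\<^sub>2 = Idl\<^bsub>poly_ring\<^esub> {mvar 1 * mvar 2, mvar 2 - mvar 1 ^ 2}"

end

theory Submission
  imports Defs
begin

text \<open>An automorphism \<open>f\<close> of the plane is given by a triple \<open>F\<close> of coprime polynomials; by unique
  factorization every local description of \<open>f\<close> is a multiple of \<open>F\<close>, so \<open>F\<close> has no zero apart from
  the origin. If \<open>G\<close> describes the inverse, then \<open>G \<circ> F\<close> is a nonvanishing multiple of the
  identity, hence a constant one, and comparing degrees shows that \<open>F\<close> is linear.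

  An action of the vector group on the plane is therefore a homomorphism to \<open>PGL\<^sub>3\<close>. Since the group is
  divisible, it lifts to \<open>SL\<^sub>3\<close>. The lift is a rational function on each line \<open>t \<mapsto> t a\<close>, by the
  group law it has no poles, and a polynomial one-parameter group is \<open>exp (t N)\<close> with \<open>N\<close> nilpotent.
  So the action is \<open>a \<mapsto> exp (N a)\<close> with \<open>N\<close> linear and with commuting nilpotent values.

  If \<open>(N a)\<^sup>2 = 0\<close> for all \<open>a\<close>, a vector \<open>v\<close> that spans a line with trivial stabilizer gives the basis
  \<open>N e\<^sub>2 v, N e\<^sub>1 v, v\<close>, in which the action is \<open>\<tau>\<^sub>2\<close>. Otherwise let \<open>S = N b\<close> with \<open>S\<^sup>2 w \<noteq> 0\<close>. Every
  \<open>N a\<close> is then a combination of \<open>S\<close> and \<open>S\<^sup>2\<close>, and in the basis \<open>S\<^sup>2 w, S w, w\<close> the action is \<open>\<rho>\<close> up to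
  a linear automorphism of the group.\<close>

text \<open>The field has no topology, so a one-parameter group can be differentiated only formally,
  after it is known to be polynomial. The obstacle is that lifts to SL(3) exist by mere choice:
  regularity in the group variable is known for the images of points, not for matrix entries. It is
  recovered by following the images of the three basis vectors and of their sum along a line of the
  group, since four points in general position determine a projective map; the cube root of unity
  left open by the determinant disappears on taking third powers. That no semisimple part occurs is
  a matter of degree: the Taylor coefficients of the group are the powers of \<open>N\<close>
  divided by factorials, and a polynomial has only finitely many. Likewise homogeneity of
  \<open>F\<close> is not given with a morphism and is replaced by a scaling rule with a polynomial
  factor \<open>C\<close>, whose degree is then computed.\<close>

no_notation fps_nth (infixl "$" 75)
hide_const (open) up_ring.coeff up_ring.monom module.smult Polynomials.degree

section \<open>Polynomial functions\<close>

lemma mpoly_eval_superset: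
  assumes "finite K" "Poly_Mapping.keys p \<subseteq> K"
  shows "mpoly_eval p x =
    (\<Sum>m\<in>K. Poly_Mapping.lookup p m * (\<Prod>i\<in>UNIV. x $ i ^ Poly_Mapping.lookup m i))"
  unfolding mpoly_eval_def using assms
  by (intro sum.mono_neutral_left) (auto simp: in_keys_iff)

lemma mpoly_eval_zero [simp]: "mpoly_eval 0 x = 0"
  by (simp add: mpoly_eval_def)

lemma mpoly_eval_single:
  "mpoly_eval (Poly_Mapping.single m c) x = c * (\<Prod>i\<in>UNIV. x $ i ^ Poly_Mapping.lookup m i)"
  by (subst mpoly_eval_superset[of "{m}"]) auto

lemma mpoly_eval_mconst [simp]: "mpoly_eval (mconst c) x = c"
  by (simp add: mconst_def mpoly_eval_single)

lemma mpoly_eval_mvar [simp]: "mpoly_eval (mvar i) x = x $ i"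
proof -
  have "(\<Prod>j\<in>UNIV. x $ j ^ Poly_Mapping.lookup (Poly_Mapping.single i (1::nat)) j) =
    (\<Prod>j\<in>UNIV. if j = i then x $ j else 1)"
    by (intro prod.cong) (auto simp: lookup_single when_def)
  then show ?thesis by (simp add: mvar_def mpoly_eval_single)
qed

lemma mpoly_eval_add: "mpoly_eval (p + q) x = mpoly_eval p x + mpoly_eval q x"
proof -
  let ?K = "Poly_Mapping.keys p \<union> Poly_Mapping.keys q"
  have "Poly_Mapping.keys (p + q) \<subseteq> ?K" by (rule Poly_Mapping.keys_add)
  then show ?thesis
    by (simp add: mpoly_eval_superset[of ?K] lookup_add distrib_right sum.distrib)
qed

lemma mpoly_eval_sum: "mpoly_eval (\<Sum>a\<in>A. f a) x = (\<Sum>a\<in>A. mpoly_eval (f a) x)"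
  by (induction A rule: infinite_finite_induct) (auto simp: mpoly_eval_add)

lemma mpoly_expansion:
  "p = (\<Sum>m\<in>Poly_Mapping.keys p. Poly_Mapping.single m (Poly_Mapping.lookup p m))"
  by (rule poly_mapping_eqI)
    (auto simp: lookup_sum lookup_single when_def sum.delta in_keys_iff)

lemma mpoly_eval_mult: "mpoly_eval (p * q) x = mpoly_eval p x * mpoly_eval q x"
proof -
  have *: "p * q = (\<Sum>m\<in>Poly_Mapping.keys p. \<Sum>n\<in>Poly_Mapping.keys q.
      Poly_Mapping.single (m + n) (Poly_Mapping.lookup p m * Poly_Mapping.lookup q n))"
    by (subst mpoly_expansion[of p], subst mpoly_expansion[of q])
      (simp add: sum_product mult_single)
  show ?thesis
    unfolding * mpoly_eval_sum mpoly_eval_single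
    by (simp add: mpoly_eval_def sum_product lookup_add power_add prod.distrib mult_ac)
qed

lemma mpoly_eval_one [simp]: "mpoly_eval 1 x = 1"
  using mpoly_eval_mconst[of 1 x] by (simp add: mconst_def single_one)

lemma mpoly_eval_power: "mpoly_eval (p ^ k) x = mpoly_eval p x ^ k"
  by (induction k) (auto simp: mpoly_eval_mult)

lemma mpoly_eval_prod: "mpoly_eval (\<Prod>a\<in>A. f a) x = (\<Prod>a\<in>A. mpoly_eval (f a) x)"
  by (induction A rule: infinite_finite_induct) (auto simp: mpoly_eval_mult)

lemma weight_homogeneous_mconst [simp]: "weight_homogeneous w 0 (mconst c)"
  by (auto simp: weight_homogeneous_def mconst_def)

lemma weight_homogeneous_one [simp]: "weight_homogeneous w 0 1"
  using weight_homogeneous_mconst[of w 1] by (simp add: mconst_def single_one)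

lemma weight_homogeneous_zero [simp]: "weight_homogeneous w d 0"
  by (simp add: weight_homogeneous_def)

lemma weight_homogeneous_mvar: "weight_homogeneous w (w i) (mvar i)"
proof -
  have "(\<Sum>j\<in>UNIV. w j * Poly_Mapping.lookup (Poly_Mapping.single i (1::nat)) j) =
    (\<Sum>j\<in>UNIV. if j = i then w j else 0)"
    by (intro sum.cong) (auto simp: lookup_single when_def)
  then show ?thesis by (simp add: weight_homogeneous_def mvar_def)
qed

lemma weight_homogeneous_add:
  "weight_homogeneous w d p \<Longrightarrow> weight_homogeneous w d q \<Longrightarrow> weight_homogeneous w d (p + q)"
  using Poly_Mapping.keys_add[of p q] by (fastforce simp: weight_homogeneous_def)

lemma weight_homogeneous_sum:
  "(\<And>a. a \<in> A \<Longrightarrow> weight_homogeneous w d (f a)) \<Longrightarrow> weight_homogeneous w d (\<Sum>a\<in>A. f a)"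
  by (induction A rule: infinite_finite_induct) (auto intro: weight_homogeneous_add)

lemma weight_homogeneous_mult:
  assumes "weight_homogeneous w d p" "weight_homogeneous w e q"
  shows "weight_homogeneous w (d + e) (p * q)"
  unfolding weight_homogeneous_def
proof
  fix m assume "m \<in> Poly_Mapping.keys (p * q)"
  then obtain a b where "m = a + b" "a \<in> Poly_Mapping.keys p" "b \<in> Poly_Mapping.keys q"
    using keys_mult[of p q] by auto
  with assms show "(\<Sum>i\<in>UNIV. w i * Poly_Mapping.lookup m i) = d + e"
    by (simp add: weight_homogeneous_def lookup_add distrib_left sum.distrib)
qed

lemma weight_homogeneous_power:
  "weight_homogeneous w d p \<Longrightarrow> weight_homogeneous w (k * d) (p ^ k)"
  by (induction k) (auto intro: weight_homogeneous_mult)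

lemma weight_homogeneous_prod:
  "(\<And>a. a \<in> A \<Longrightarrow> weight_homogeneous w (d a) (f a)) \<Longrightarrow>
    weight_homogeneous w (\<Sum>a\<in>A. d a) (\<Prod>a\<in>A. f a)"
  by (induction A rule: infinite_finite_induct) (auto intro: weight_homogeneous_mult)

text \<open>Polynomials that raise weights by the factor \<open>e\<close> multiply every weighted
  degree by \<open>e\<close>. Numerators and denominators of equal degree therefore stay of equal
  degree when they are pulled back.\<close>

lemma weight_homogeneous_substitution:
  fixes F :: "'j::finite \<Rightarrow> ('i::finite) mpoly"
  assumes g: "weight_homogeneous w d g" and F: "\<And>j. weight_homogeneous w' (e * w j) (F j)"
  obtains h where "weight_homogeneous w' (e * d) h"
    "\<And>x. mpoly_eval h x = mpoly_eval g (\<chi> j. mpoly_eval (F j) x)"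
proof
  let ?h = "\<Sum>m\<in>Poly_Mapping.keys g. mconst (Poly_Mapping.lookup g m) *
    (\<Prod>j\<in>UNIV. F j ^ Poly_Mapping.lookup m j)"
  show "mpoly_eval ?h x = mpoly_eval g (\<chi> j. mpoly_eval (F j) x)" for x
    by (simp add: mpoly_eval_sum mpoly_eval_mult mpoly_eval_prod mpoly_eval_power)
      (simp add: mpoly_eval_def)
  show "weight_homogeneous w' (e * d) ?h"
  proof (rule weight_homogeneous_sum)
    fix m assume "m \<in> Poly_Mapping.keys g"
    then have "(\<Sum>j\<in>UNIV. w j * Poly_Mapping.lookup m j) = d"
      using g by (simp add: weight_homogeneous_def)
    then have "e * d = 0 + (\<Sum>j\<in>UNIV. Poly_Mapping.lookup m j * (e * w j))"
      by (simp add: sum_distrib_left algebra_simps flip: sum_distrib_left)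
    then show "weight_homogeneous w' (e * d) (mconst (Poly_Mapping.lookup g m) *
        (\<Prod>j\<in>UNIV. F j ^ Poly_Mapping.lookup m j))"
      using F by (metis (no_types, lifting) weight_homogeneous_mconst weight_homogeneous_mult
        weight_homogeneous_power weight_homogeneous_prod)
  qed
qed

lemma weight_homogeneous_scale:
  assumes "weight_homogeneous w d f"
  shows "mpoly_eval f (\<chi> i. c ^ w i * x $ i) = c ^ d * mpoly_eval f x"
proof -
  have "(\<Prod>i\<in>UNIV. (c ^ w i * x $ i) ^ Poly_Mapping.lookup m i) =
      c ^ d * (\<Prod>i\<in>UNIV. x $ i ^ Poly_Mapping.lookup m i)"
    if "m \<in> Poly_Mapping.keys f" for m
    using that assms
    by (auto simp: weight_homogeneous_def power_mult_distrib prod.distrib simp flip: power_mult power_sum)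
  then show ?thesis
    by (simp add: mpoly_eval_def sum_distrib_left mult_ac)
qed

text \<open>Describes the functions themselves: composition and restriction to lines become
  inductions on these four rules, without monomials.\<close>

inductive_set polyfun :: "(qbar ^ 'n \<Rightarrow> qbar) set" where
  const: "(\<lambda>x. c) \<in> polyfun"
| coord: "(\<lambda>x. x $ i) \<in> polyfun"
| add: "f \<in> polyfun \<Longrightarrow> g \<in> polyfun \<Longrightarrow> (\<lambda>x. f x + g x) \<in> polyfun"
| mult: "f \<in> polyfun \<Longrightarrow> g \<in> polyfun \<Longrightarrow> (\<lambda>x. f x * g x) \<in> polyfun"

lemma polyfun_sum: "(\<And>a. a \<in> A \<Longrightarrow> f a \<in> polyfun) \<Longrightarrow> (\<lambda>x. \<Sum>a\<in>A. f a x) \<in> polyfun"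
  by (induction A rule: infinite_finite_induct) (auto intro: polyfun.intros)

lemma polyfun_prod: "(\<And>a. a \<in> A \<Longrightarrow> f a \<in> polyfun) \<Longrightarrow> (\<lambda>x. \<Prod>a\<in>A. f a x) \<in> polyfun"
  by (induction A rule: infinite_finite_induct) (auto intro: polyfun.intros)

lemma polyfun_power: "f \<in> polyfun \<Longrightarrow> (\<lambda>x. f x ^ k) \<in> polyfun"
  by (induction k) (auto intro: polyfun.intros)

lemma polyfun_mpoly_eval: "mpoly_eval p \<in> polyfun"
proof -
  have "mpoly_eval p = (\<lambda>x. \<Sum>m\<in>Poly_Mapping.keys p.
        Poly_Mapping.lookup p m * (\<Prod>i\<in>UNIV. x $ i ^ Poly_Mapping.lookup m i))"
    by (simp add: mpoly_eval_def fun_eq_iff)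
  also have "\<dots> \<in> polyfun"
    by (intro polyfun_sum polyfun.mult polyfun.const polyfun_prod polyfun_power polyfun.coord)
  finally show ?thesis .
qed

lemma polyfun_compose:
  fixes F :: "qbar ^ 'm \<Rightarrow> qbar ^ 'n"
  assumes "f \<in> polyfun" and F: "\<And>i. (\<lambda>x. F x $ i) \<in> polyfun"
  shows "(\<lambda>x. f (F x)) \<in> polyfun"
  using assms(1) by induction (auto intro: polyfun.intros F)

text \<open>Restricting to a line reduces questions in several variables to univariate polynomials,
  where algebraic closedness supplies roots.\<close>

lemma polyfun_line:
  fixes x y :: "qbar ^ 'n"
  assumes "f \<in> polyfun"
  obtains p where "\<And>t. f (x + t *s y) = poly p t"
proof -
  have "\<exists>p. \<forall>t. f (x + t *s y) = poly p t"
    using assms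
  proof induction
    case (const c)
    show ?case by (rule exI[of _ "[:c:]"]) simp
  next
    case (coord i)
    show ?case by (rule exI[of _ "[:x $ i, y $ i:]"]) simp
  next
    case (add f g)
    then show ?case by (metis poly_add)
  next
    case (mult f g)
    then show ?case by (metis poly_mult)
  qed
  with that show thesis by blast
qed

section \<open>Morphisms in homogeneous coordinates\<close>

text \<open>Homogeneous coordinates of a point are unique up to the weighted scaling action, so the
  vanishing of a weighted homogeneous polynomial at a point is well defined.\<close>

definition graded_presentation :: "('i::finite, 'p) presented_variety \<Rightarrow> bool" where
  "graded_presentation Z \<longleftrightarrow> (\<forall>x\<in>coords Z. \<forall>y\<in>coords Z. pt Z x = pt Z y \<longrightarrow>
     (\<exists>c. c \<noteq> 0 \<and> y = (\<chi> i. c ^ weight Z i * x $ i)))"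

lemma graded_presentation_vanish:
  assumes "graded_presentation Z" "x \<in> coords Z" "y \<in> coords Z" "pt Z x = pt Z y"
    "weight_homogeneous (weight Z) d f"
  shows "mpoly_eval f x = 0 \<longleftrightarrow> mpoly_eval f y = 0"
proof -
  obtain c where "c \<noteq> 0" "y = (\<chi> i. c ^ weight Z i * x $ i)"
    using assms by (auto simp: graded_presentation_def)
  then show ?thesis by (simp add: weight_homogeneous_scale[OF assms(5)])
qed

lemma openin_zariski_basic:
  "weight_homogeneous (weight Z) d f \<Longrightarrow>
    openin (zariski Z) (pt Z ` {x \<in> coords Z. mpoly_eval f x \<noteq> 0})"
  unfolding zariski_def by (intro topology_generated_by_Basis) blast

text \<open>A product of homogeneous polynomials is homogeneous, so the generating sets form a base
  and not merely a subbase.\<close>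

lemma openin_zariski_nbhd:
  assumes Z: "graded_presentation Z" and "openin (zariski Z) V" "x \<in> coords Z" "pt Z x \<in> V"
  obtains q d where "weight_homogeneous (weight Z) d q" "mpoly_eval q x \<noteq> 0"
    "\<And>y. y \<in> coords Z \<Longrightarrow> mpoly_eval q y \<noteq> 0 \<Longrightarrow> pt Z y \<in> V"
proof -
  let ?P = "\<lambda>V. pt Z x \<in> V \<longrightarrow> (\<exists>q d. weight_homogeneous (weight Z) d q \<and> mpoly_eval q x \<noteq> 0 \<and>
    (\<forall>y\<in>coords Z. mpoly_eval q y \<noteq> 0 \<longrightarrow> pt Z y \<in> V))"
  have "generate_topology_on
      {pt Z ` {x \<in> coords Z. mpoly_eval f x \<noteq> 0} | f d. weight_homogeneous (weight Z) d f} V"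
    using assms(2) by (simp add: zariski_def openin_topology_generated_by_iff)
  then have "?P V"
  proof induction
    case Empty
    then show ?case by simp
  next
    case (Int a b)
    show ?case
    proof
      assume "pt Z x \<in> a \<inter> b"
      then obtain q d r e where "weight_homogeneous (weight Z) d q" "mpoly_eval q x \<noteq> 0"
        "\<forall>y\<in>coords Z. mpoly_eval q y \<noteq> 0 \<longrightarrow> pt Z y \<in> a"
        "weight_homogeneous (weight Z) e r" "mpoly_eval r x \<noteq> 0"
        "\<forall>y\<in>coords Z. mpoly_eval r y \<noteq> 0 \<longrightarrow> pt Z y \<in> b"
        using Int.IH by blast
      then show "\<exists>q d. weight_homogeneous (weight Z) d q \<and> mpoly_eval q x \<noteq> 0 \<and>
          (\<forall>y\<in>coords Z. mpoly_eval q y \<noteq> 0 \<longrightarrow> pt Z y \<in> a \<inter> b)"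
        by (intro exI[of _ "q * r"] exI[of _ "d + e"])
          (auto simp: mpoly_eval_mult intro: weight_homogeneous_mult)
    qed
  next
    case (UN K)
    then show ?case by (meson UnionE UnionI)
  next
    case (Basis s)
    then obtain f d where s: "s = pt Z ` {x \<in> coords Z. mpoly_eval f x \<noteq> 0}"
      and f: "weight_homogeneous (weight Z) d f" by blast
    \<comment> \<open>The coordinates that witness membership in \<open>s\<close> may differ from
      \<open>x\<close>, but non-vanishing does not depend on that choice.\<close>
    then show ?case
      using graded_presentation_vanish[OF Z] assms(3) by blast
  qed
  with assms(4) that show thesis by blast
qed

section \<open>Scaling of coordinates in the concrete presentations\<close>

lemma span_singleton_eq_iff:
  fixes x y :: "qbar ^ 'k"
  assumes "x \<noteq> 0" "y \<noteq> 0"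
  shows "vec.span {x} = vec.span {y} \<longleftrightarrow> (\<exists>c. c \<noteq> 0 \<and> y = c *s x)"
proof
  assume "vec.span {x} = vec.span {y}"
  then have "y \<in> vec.span {x}" using vec.span_base[of y "{y}"] by simp
  then obtain c where "y = c *s x" by (auto simp: vec.span_singleton)
  with assms show "\<exists>c. c \<noteq> 0 \<and> y = c *s x" by (intro exI[of _ c]) auto
next
  assume "\<exists>c. c \<noteq> 0 \<and> y = c *s x"
  then obtain c where c: "c \<noteq> 0" "y = c *s x" by blast
  have "\<exists>l. k *s x = l *s y" for k
    using c by (intro exI[of _ "k / c"]) simp
  then show "vec.span {x} = vec.span {y}"
    using c unfolding vec.span_singleton
    by (auto simp: image_iff)
qed

lemma graded_presentation_projective: "graded_presentation projective_space"
  unfolding graded_presentation_def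
proof (intro ballI impI)
  fix x y :: "qbar ^ 'k"
  assume "x \<in> coords projective_space" "y \<in> coords projective_space"
    "pt projective_space x = pt projective_space y"
  then obtain c where "c \<noteq> 0" "y = c *s x"
    using span_singleton_eq_iff by (force simp: projective_space_def)
  then show "\<exists>c. c \<noteq> 0 \<and> y = (\<chi> i. c ^ weight projective_space i * x $ i)"
    by (intro exI[of _ c]) (auto simp: projective_space_def vec_eq_iff)
qed

lemma graded_presentation_affine: "graded_presentation affine_space"
  by (auto simp: graded_presentation_def affine_space_def intro!: exI[of _ 1])

lemma graded_presentation_affine_times_projective:
  "graded_presentation
    (affine_times_projective :: ('n::finite + 'k::finite, (qbar ^ 'n) \<times> (qbar ^ 'k) set) presented_variety)"
  (is "graded_presentation ?Z")
  unfolding graded_presentation_def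
proof (intro ballI impI)
  fix x y :: "qbar ^ ('n + 'k)"
  assume xy: "x \<in> coords ?Z" "y \<in> coords ?Z" "pt ?Z x = pt ?Z y"
  then have 1: "x $ Inl i = y $ Inl i" for i
    by (simp add: affine_times_projective_def vec_eq_iff)
  obtain c where c: "c \<noteq> 0" "(\<chi> j. y $ Inr j) = c *s (\<chi> j. x $ Inr j)"
    using xy span_singleton_eq_iff[of "\<chi> j. x $ Inr j" "\<chi> j. y $ Inr j"]
    by (auto simp: affine_times_projective_def)
  then have "y $ Inr j = c * x $ Inr j" for j by (simp add: vec_eq_iff)
  with 1 c show "\<exists>c. c \<noteq> 0 \<and> y = (\<chi> i. c ^ weight ?Z i * x $ i)"
    by (intro exI[of _ c]) (auto simp: affine_times_projective_def vec_eq_iff split: sum.split)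
qed

text \<open>With \<open>e = 1\<close> this covers equivariant polynomial maps; \<open>e = 0\<close> is the case of a source that has
  only affine coordinates.\<close>

lemma morphism_polynomial:
  fixes Z :: "('i::finite, 'p) presented_variety" and W :: "('j::finite, 'q) presented_variety"
    and F :: "'j \<Rightarrow> 'i mpoly"
  assumes W: "graded_presentation W"
    and F: "\<And>j. weight_homogeneous (weight Z) (e * weight W j) (F j)"
    and coords: "\<And>x. x \<in> coords Z \<Longrightarrow> (\<chi> j. mpoly_eval (F j) x) \<in> coords W"
    and f: "\<And>x. x \<in> coords Z \<Longrightarrow> f (pt Z x) = pt W (\<chi> j. mpoly_eval (F j) x)"
  shows "morphism Z W f"
proof -
  have into: "f ` topspace (zariski Z) \<subseteq> topspace (zariski W)"
    using coords f by (auto simp: topspace_zariski)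
  have cont: "continuous_map (zariski Z) (zariski W) f"
    unfolding zariski_def[of W]
  proof (rule continuous_on_generated_topo)
    fix U assume "U \<in> {pt W ` {x \<in> coords W. mpoly_eval g x \<noteq> 0} | g d.
        weight_homogeneous (weight W) d g}"
    then obtain g d where U: "U = pt W ` {x \<in> coords W. mpoly_eval g x \<noteq> 0}"
      and g: "weight_homogeneous (weight W) d g" by blast
    obtain h where h: "weight_homogeneous (weight Z) (e * d) h"
      "\<And>x. mpoly_eval h x = mpoly_eval g (\<chi> j. mpoly_eval (F j) x)"
      using weight_homogeneous_substitution[OF g F] by blast
    have "f -` U \<inter> topspace (zariski Z) = pt Z ` {x \<in> coords Z. mpoly_eval h x \<noteq> 0}"
    proof -
      have "pt W (\<chi> j. mpoly_eval (F j) x) \<in> U \<longleftrightarrow> mpoly_eval h x \<noteq> 0" if "x \<in> coords Z" for x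
      proof -
        have "mpoly_eval g y = 0 \<longleftrightarrow> mpoly_eval h x = 0"
          if "y \<in> coords W" "pt W y = pt W (\<chi> j. mpoly_eval (F j) x)" for y
          using graded_presentation_vanish[OF W that(1) coords[OF \<open>x \<in> coords Z\<close>] that(2) g] h
          by simp
        then show ?thesis using coords[OF that] by (auto simp: U image_iff)
      qed
      with f show ?thesis by (force simp: topspace_zariski)
    qed
    then show "openin (zariski Z) (f -` U \<inter> topspace (zariski Z))"
      using openin_zariski_basic[OF h(1)] by simp
  next
    show "f ` topspace (zariski Z) \<subseteq> \<Union> {pt W ` {x \<in> coords W. mpoly_eval g x \<noteq> 0} | g d.
        weight_homogeneous (weight W) d g}"
      using into by (simp add: zariski_def[of W] topology_generated_by_topspace)
  qed
  show ?thesis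
    unfolding morphism_def
  proof (intro conjI allI impI ballI cont)
    fix V h assume V: "openin (zariski W) V" and h: "h \<in> regular_functions W V"
    let ?V = "{p \<in> topspace (zariski Z). f p \<in> V}"
    show "h \<circ> f \<in> regular_functions Z ?V"
      unfolding regular_functions_def
    proof (intro CollectI ballI)
      fix p assume p: "p \<in> ?V"
      with h obtain V' a b d where V': "openin (zariski W) V'" "f p \<in> V'" "V' \<subseteq> V"
        and ab: "weight_homogeneous (weight W) d a" "weight_homogeneous (weight W) d b"
        and eq: "\<forall>x\<in>coords W. pt W x \<in> V' \<longrightarrow>
          mpoly_eval b x \<noteq> 0 \<and> h (pt W x) = mpoly_eval a x / mpoly_eval b x"
        unfolding regular_functions_def by blast
      obtain a' where a': "weight_homogeneous (weight Z) (e * d) a'"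
        "\<And>x. mpoly_eval a' x = mpoly_eval a (\<chi> j. mpoly_eval (F j) x)"
        using weight_homogeneous_substitution[OF ab(1) F] by blast
      obtain b' where b': "weight_homogeneous (weight Z) (e * d) b'"
        "\<And>x. mpoly_eval b' x = mpoly_eval b (\<chi> j. mpoly_eval (F j) x)"
        using weight_homogeneous_substitution[OF ab(2) F] by blast
      show "\<exists>V f' g d. openin (zariski Z) V \<and> p \<in> V \<and> V \<subseteq> ?V \<and>
        weight_homogeneous (weight Z) d f' \<and> weight_homogeneous (weight Z) d g \<and>
        (\<forall>x\<in>coords Z. pt Z x \<in> V \<longrightarrow>
          mpoly_eval g x \<noteq> 0 \<and> (h \<circ> f) (pt Z x) = mpoly_eval f' x / mpoly_eval g x)"
      proof (intro exI conjI ballI impI)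
        show "openin (zariski Z) {p \<in> topspace (zariski Z). f p \<in> V'}"
          using cont V' by (auto intro: openin_continuous_map_preimage)
      next
        fix x assume "x \<in> coords Z" "pt Z x \<in> {p \<in> topspace (zariski Z). f p \<in> V'}"
        then show "mpoly_eval b' x \<noteq> 0" "(h \<circ> f) (pt Z x) = mpoly_eval a' x / mpoly_eval b' x"
          using eq coords f a' b' by auto
      qed (use a' b' p V' in auto)
    qed
  qed
qed

text \<open>The choice operator selects the vector of the line with i-th coordinate 1, so this is an
  affine coordinate of a standard chart. Pulling it back along a morphism yields coordinates of the
  image.\<close>

lemma projective_coordinate_regular:
  fixes i j :: "'k::finite"
  shows "(\<lambda>L. (SOME y. y \<in> L \<and> y $ i = 1) $ j) \<in> regular_functions projective_space
      (pt projective_space ` {y \<in> coords projective_space. mpoly_eval (mvar i) y \<noteq> 0})"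
    and "y $ i \<noteq> 0 \<Longrightarrow> (SOME z. z \<in> vec.span {y} \<and> z $ i = 1) $ j = y $ j / (y $ i :: qbar)"
proof -
  have *: "(SOME z. z \<in> vec.span {y} \<and> z $ i = 1) $ j = y $ j / y $ i"
    if "y $ i \<noteq> 0" for y :: "qbar ^ 'k"
  proof -
    have "(SOME z. z \<in> vec.span {y} \<and> z $ i = 1) = inverse (y $ i) *s y"
    proof (rule some_equality)
      show "inverse (y $ i) *s y \<in> vec.span {y} \<and> (inverse (y $ i) *s y) $ i = 1"
        using that by (auto simp: vec.span_singleton)
    next
      fix z assume "z \<in> vec.span {y} \<and> z $ i = 1"
      then obtain k where k: "z = k *s y" "k * y $ i = 1"
        unfolding vec.span_singleton by force
      then have "k = inverse (y $ i)" using that by (simp add: field_simps)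
      with k show "z = inverse (y $ i) *s y" by simp
    qed
    then show ?thesis by (simp add: divide_inverse mult.commute)
  qed
  then show "y $ i \<noteq> 0 \<Longrightarrow> (SOME z. z \<in> vec.span {y} \<and> z $ i = 1) $ j = y $ j / y $ i" .
  have wh: "weight_homogeneous (weight projective_space) 1 (mvar l)" for l :: 'k
    using weight_homogeneous_mvar[of "weight projective_space" l] by (simp add: projective_space_def)
  show "(\<lambda>L. (SOME y. y \<in> L \<and> y $ i = 1) $ j) \<in> regular_functions projective_space
      (pt projective_space ` {y \<in> coords projective_space. mpoly_eval (mvar i) y \<noteq> 0})"
    (is "?h \<in> regular_functions _ ?W")
    unfolding regular_functions_def
  proof (intro CollectI ballI)
    fix p assume "p \<in> ?W"
    moreover have "mpoly_eval (mvar i) x \<noteq> 0 \<and> ?h (pt projective_space x) =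
        mpoly_eval (mvar j) x / mpoly_eval (mvar i) x"
      if "x \<in> coords projective_space" "pt projective_space x \<in> ?W" for x
    proof -
      from that(2) obtain y where y: "y \<in> coords projective_space"
        "pt projective_space x = pt projective_space y" "mpoly_eval (mvar i) y \<noteq> 0" by auto
      then have "mpoly_eval (mvar i) x \<noteq> 0"
        using graded_presentation_vanish[OF graded_presentation_projective that(1) y(1,2) wh] by blast
      then show ?thesis using * by (simp add: projective_space_def)
    qed
    ultimately show "\<exists>V f g d. openin (zariski projective_space) V \<and> p \<in> V \<and> V \<subseteq> ?W \<and>
       weight_homogeneous (weight projective_space) d f \<and>
       weight_homogeneous (weight projective_space) d g \<and>
       (\<forall>x\<in>coords projective_space. pt projective_space x \<in> V \<longrightarrow> mpoly_eval g x \<noteq> 0 \<and>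
          ?h (pt projective_space x) = mpoly_eval f x / mpoly_eval g x)"
      using openin_zariski_basic[OF wh] wh
      by (intro exI[of _ ?W] exI[of _ "mvar j"] exI[of _ "mvar i"] exI[of _ 1]) blast
  qed
qed

text \<open>In a chart around the image of \<open>x0\<close> the affine coordinates pull back to
  quotients of polynomials; clearing denominators gives \<open>F\<close>. The polynomial
  \<open>q\<close> cuts out a neighbourhood on which all quotients are valid at once.\<close>

lemma morphism_projective_local:
  fixes Z :: "('i::finite, 'p) presented_variety" and f :: "'p \<Rightarrow> (qbar ^ 'k::finite) set"
  assumes Z: "graded_presentation Z" and f: "morphism Z projective_space f" and x0: "x0 \<in> coords Z"
  obtains q and F :: "qbar ^ 'i \<Rightarrow> qbar ^ 'k"
  where "q \<in> polyfun" "\<And>j. (\<lambda>x. F x $ j) \<in> polyfun" "q x0 \<noteq> 0"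
    "\<And>x. x \<in> coords Z \<Longrightarrow> q x \<noteq> 0 \<Longrightarrow> F x \<noteq> 0 \<and> f (pt Z x) = vec.span {F x}"
proof -
  let ?P = "projective_space :: ('k, (qbar ^ 'k) set) presented_variety"
  have "f (pt Z x0) \<in> proj_points"
    using f x0 by (intro morphism_in[OF f]) (auto simp: topspace_zariski)
  then obtain u where u: "u \<noteq> 0" "f (pt Z x0) = vec.span {u}" by (auto simp: proj_points_eq)
  then obtain i where i: "u $ i \<noteq> 0" by (auto simp: vec_eq_iff)
  define W where "W = pt ?P ` {y \<in> coords ?P. mpoly_eval (mvar i) y \<noteq> 0}"
  define h where "h = (\<lambda>j L. (SOME y :: qbar ^ 'k. y \<in> L \<and> y $ i = 1) $ j)"
  have "weight_homogeneous (weight ?P) (weight ?P i) (mvar i)" by (rule weight_homogeneous_mvar)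
  then have W: "openin (zariski ?P) W" unfolding W_def by (rule openin_zariski_basic)
  have uW: "f (pt Z x0) \<in> W" using u i by (auto simp: W_def projective_space_def)
  let ?V = "{p \<in> topspace (zariski Z). f p \<in> W}"
  have "pt Z x0 \<in> ?V" using uW x0 by (auto simp: topspace_zariski)
  have reg: "h j \<circ> f \<in> regular_functions Z ?V" for j
    using f W projective_coordinate_regular(1)[of i j] by (auto simp: morphism_def h_def W_def)
  define R where "R j V a b \<longleftrightarrow> openin (zariski Z) V \<and> pt Z x0 \<in> V \<and> V \<subseteq> ?V \<and>
     (\<forall>x\<in>coords Z. pt Z x \<in> V \<longrightarrow>
        mpoly_eval b x \<noteq> 0 \<and> (h j \<circ> f) (pt Z x) = mpoly_eval a x / mpoly_eval b x)" for j V a b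
  have "\<exists>V a b. R j V a b" for j
    using bspec[OF reg[of j, unfolded regular_functions_def, THEN CollectD] \<open>pt Z x0 \<in> ?V\<close>]
    unfolding R_def by (elim exE conjE) (intro exI conjI)
  then obtain V a b where R: "\<And>j. R j (V j) (a j) (b j)" by metis
  have V: "openin (zariski Z) (V j)" "pt Z x0 \<in> V j" "V j \<subseteq> ?V" for j
    using R[of j] unfolding R_def by simp_all
  have ab: "mpoly_eval (b j) x \<noteq> 0 \<and> h j (f (pt Z x)) = mpoly_eval (a j) x / mpoly_eval (b j) x"
    if "x \<in> coords Z" "pt Z x \<in> V j" for j x
    using R[of j] that unfolding R_def comp_def by (elim conjE) (drule bspec, assumption, simp)
  define Q where "Q j q \<longleftrightarrow>
    mpoly_eval q x0 \<noteq> 0 \<and> (\<forall>y\<in>coords Z. mpoly_eval q y \<noteq> 0 \<longrightarrow> pt Z y \<in> V j)" for j q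
  have "\<exists>q. Q j q" for j
    by (rule openin_zariski_nbhd[OF Z V(1)[of j] x0 V(2)[of j]]) (auto simp: Q_def)
  then obtain q where Q: "\<And>j. Q j (q j)" by metis
  have q: "mpoly_eval (q j) x0 \<noteq> 0"
    "y \<in> coords Z \<Longrightarrow> mpoly_eval (q j) y \<noteq> 0 \<Longrightarrow> pt Z y \<in> V j" for j y
    using Q[of j] unfolding Q_def by simp_all
  \<comment> \<open>The quotient of \<open>a j\<close> by \<open>b j\<close>, times the product of
    all denominators.\<close>
  define F where "F x = (\<chi> j. mpoly_eval (a j) x * (\<Prod>l\<in>UNIV - {j}. mpoly_eval (b l) x))" for x
  show thesis
  proof
    show "(\<lambda>x. \<Prod>j\<in>UNIV. mpoly_eval (q j) x) \<in> polyfun"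
      by (intro polyfun_prod polyfun_mpoly_eval)
    show "(\<lambda>x. F x $ j) \<in> polyfun" for j
      unfolding F_def by (auto intro!: polyfun.mult polyfun_prod polyfun_mpoly_eval)
    show "(\<Prod>j\<in>UNIV. mpoly_eval (q j) x0) \<noteq> 0" using q by simp
    fix x assume x: "x \<in> coords Z" "(\<Prod>j\<in>UNIV. mpoly_eval (q j) x) \<noteq> 0"
    then have xV: "pt Z x \<in> V j" for j using q by auto
    then have "f (pt Z x) \<in> W" using V(3) by blast
    then obtain y where y: "y \<noteq> 0" "f (pt Z x) = vec.span {y}" "y $ i \<noteq> 0"
      by (auto simp: W_def projective_space_def)
    have b: "mpoly_eval (b j) x \<noteq> 0" for j using ab[OF x(1) xV] by blast
    have eq: "mpoly_eval (a j) x = y $ j / y $ i * mpoly_eval (b j) x" for j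
      using ab[OF x(1) xV, of j] y projective_coordinate_regular(2)[of y i j]
      by (simp add: h_def field_simps)
    \<comment> \<open>The denominators were multiplied in, and the chart normalizes coordinate
      \<open>i\<close> of \<open>y\<close> to 1.\<close>
    let ?c = "(\<Prod>l\<in>UNIV. mpoly_eval (b l) x) / y $ i"
    have "F x = ?c *s y"
    proof -
      have "F x $ j = ?c * y $ j" for j
        using prod.remove[of UNIV j "\<lambda>l. mpoly_eval (b l) x"] by (simp add: F_def eq)
      then show ?thesis by (simp add: vec_eq_iff)
    qed
    moreover have "?c \<noteq> 0" using b y by simp
    ultimately show "F x \<noteq> 0 \<and> f (pt Z x) = vec.span {F x}"
      using y span_singleton_eq_iff[of y "F x"] by auto
  qed
qed

section \<open>Automorphisms of the projective plane\<close>

text \<open>\<open>r * (p - q)\<close> vanishes everywhere on an infinite field. This extends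
  identities known off finitely many points; taking \<open>[:0, 1:]\<close> for \<open>r\<close>
  excludes just 0.\<close>

lemma poly_eqI_cofinite:
  fixes p q r :: "qbar poly"
  assumes "r \<noteq> 0" "\<And>t. poly r t \<noteq> 0 \<Longrightarrow> poly p t = poly q t"
  shows "p = q"
proof -
  have "poly (r * (p - q)) t = 0" for t using assms(2)[of t] by auto
  then have "r * (p - q) = 0" using poly_all_0_iff_0 by blast
  with assms(1) show ?thesis by simp
qed

text \<open>Iterated univariate polynomials form a ring with gcds, in which common factors of the
  components of a map can be removed. The outermost variable is the third coordinate.\<close>

definition eval3 :: "qbar poly poly poly \<Rightarrow> qbar ^ 3 \<Rightarrow> qbar" where
  "eval3 P x = poly (poly (poly P [:[:x $ 3:]:]) [:x $ 2:]) (x $ 1)"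

lemma eval3_simps [simp]:
  "eval3 (P + Q) x = eval3 P x + eval3 Q x" "eval3 (P * Q) x = eval3 P x * eval3 Q x"
  "eval3 (P - Q) x = eval3 P x - eval3 Q x" "eval3 0 x = 0" "eval3 1 x = 1"
  by (simp_all add: eval3_def)

lemma polyfun_eval3: "eval3 P \<in> polyfun"
proof -
  have 1: "(\<lambda>x :: qbar ^ 3. poly (p :: qbar poly) (x $ 1)) \<in> polyfun" for p
    unfolding poly_altdef by (intro polyfun_sum polyfun.mult polyfun.const polyfun_power polyfun.coord)
  have 2: "(\<lambda>x :: qbar ^ 3. poly (poly p [:x $ 2:]) (x $ 1)) \<in> polyfun" for p :: "qbar poly poly"
  proof -
    have "(\<lambda>x :: qbar ^ 3. poly (poly p [:x $ 2:]) (x $ 1)) =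
        (\<lambda>x :: qbar ^ 3. \<Sum>i\<le>degree p. poly (coeff p i) (x $ 1) * (x $ 2) ^ i)"
      by (simp add: poly_altdef[of p] poly_sum fun_eq_iff)
    also have "\<dots> \<in> polyfun" by (intro polyfun_sum polyfun.mult 1 polyfun_power polyfun.coord)
    finally show ?thesis .
  qed
  have "eval3 P = (\<lambda>x. \<Sum>i\<le>degree P. poly (poly (coeff P i) [:x $ 2:]) (x $ 1) * (x $ 3) ^ i)"
    by (simp add: eval3_def poly_altdef[of P] poly_sum fun_eq_iff)
  also have "\<dots> \<in> polyfun" by (intro polyfun_sum polyfun.mult 2 polyfun_power polyfun.coord)
  finally show ?thesis .
qed

lemma eval3_coord:
  "eval3 [:[:[:0, 1:]:]:] x = x $ 1" "eval3 [:[:0, 1:]:] x = x $ 2" "eval3 [:0, 1:] x = x $ 3"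
  by (simp_all add: eval3_def)

lemma polyfun_imp_eval3: "f \<in> polyfun \<Longrightarrow> \<exists>P. f = eval3 P"
proof (induction rule: polyfun.induct)
  case (const c)
  show ?case by (rule exI[of _ "[:[:[:c:]:]:]"]) (simp add: eval3_def fun_eq_iff)
next
  case (coord i)
  show ?case
    using exhaust_3[of i] eval3_coord by (metis (no_types, lifting) ext)
next
  case (add f g)
  then show ?case by (metis (no_types, lifting) ext eval3_simps(1))
next
  case (mult f g)
  then show ?case by (metis (no_types, lifting) ext eval3_simps(2))
qed

text \<open>\<open>f\<close> embeds the infinite base field into the coefficient domain, which
  contains only finitely many roots of \<open>p\<close>. Variables can thus be specialized one at a
  time without killing a polynomial.\<close>

lemma poly_nonzero_at:
  fixes p :: "('a::idom) poly" and f :: "qbar \<Rightarrow> 'a"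
  assumes "p \<noteq> 0" "inj f"
  obtains c where "poly p (f c) \<noteq> 0"
proof -
  have "finite (f -` {x. poly p x = 0})"
    by (intro finite_vimageI poly_roots_finite assms)
  then have "f -` {x. poly p x = 0} \<noteq> UNIV"
    using infinite_UNIV_char_0[where 'a = qbar] by auto
  with that show thesis by blast
qed

lemma eval3_eq_0_iff: "(\<forall>x. eval3 P x = 0) \<longleftrightarrow> P = 0"
proof
  assume *: "\<forall>x. eval3 P x = 0"
  show "P = 0"
  proof (rule ccontr)
    assume "P \<noteq> 0"
    then obtain c where "poly P [:[:c:]:] \<noteq> 0"
      using poly_nonzero_at[of P "\<lambda>c. [:[:c:]:]"] by (auto simp: inj_def)
    then obtain b where "poly (poly P [:[:c:]:]) [:b:] \<noteq> 0"
      using poly_nonzero_at[of "poly P [:[:c:]:]" "\<lambda>c. [:c:]"] by (auto simp: inj_def)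
    then obtain a where "poly (poly (poly P [:[:c:]:]) [:b:]) a \<noteq> 0"
      using poly_nonzero_at[of "poly (poly P [:[:c:]:]) [:b:]" "\<lambda>c. c"] by auto
    then have "eval3 P (vector [a, b, c]) \<noteq> 0" by (simp add: eval3_def)
    with * show False by blast
  qed
qed simp

lemma eval3_eq_iff: "eval3 P = eval3 Q \<longleftrightarrow> P = Q"
  using eval3_eq_0_iff[of "P - Q"] by (auto simp: fun_eq_iff)

lemma polyfun_eqI_dense:
  fixes f g q :: "qbar ^ 3 \<Rightarrow> qbar"
  assumes f: "f \<in> polyfun" and g: "g \<in> polyfun" and q: "q \<in> polyfun" "q x0 \<noteq> 0"
    and eq: "\<And>x. x \<noteq> 0 \<Longrightarrow> q x \<noteq> 0 \<Longrightarrow> f x = g x"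
  shows "f = g"
proof -
  obtain P Q R where P: "f = eval3 P" and Q: "g = eval3 Q" and R: "q = eval3 R"
    using polyfun_imp_eval3 f g q(1) by metis
  \<comment> \<open>The factor \<open>[:0, 1:]\<close> is the third coordinate; it vanishes at the
    origin, about which \<open>eq\<close> says nothing.\<close>
  have "eval3 ([:0, 1:] * (R * (P - Q))) x = 0" for x
    using eq[of x] unfolding eval3_simps eval3_coord by (cases "x = 0") (auto simp: P Q R)
  then have "[:0, 1:] * (R * (P - Q)) = 0" using eval3_eq_0_iff by blast
  moreover have "R \<noteq> 0" using q R by auto
  ultimately show ?thesis by (auto simp: P Q)
qed

text \<open>Coprimality of the components is expressed through its only consequence of interest: every
  polynomial map that is proportional to \<open>F\<close> is a polynomial multiple of \<open>F\<close>.\<close>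

definition coprime_map :: "(qbar ^ 3 \<Rightarrow> qbar ^ 3) \<Rightarrow> bool" where
  "coprime_map F \<longleftrightarrow> (\<forall>i. (\<lambda>x. F x $ i) \<in> polyfun) \<and>
     (\<forall>G. (\<forall>i. (\<lambda>x. G x $ i) \<in> polyfun) \<longrightarrow>
        (\<forall>x i j. F x $ i * G x $ j = F x $ j * G x $ i) \<longrightarrow> (\<exists>c\<in>polyfun. \<forall>x. G x = c x *s F x))"

lemma coprime_mapE:
  assumes "coprime_map F" "\<And>i. (\<lambda>x. G x $ i) \<in> polyfun"
    "\<And>x i j. F x $ i * G x $ j = F x $ j * G x $ i"
  obtains c where "c \<in> polyfun" "\<And>x. G x = c x *s F x"
proof -
  have "\<exists>c\<in>polyfun. \<forall>x. G x = c x *s F x"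
    using assms(1)[unfolded coprime_map_def, THEN conjunct2, THEN spec, of G] assms(2,3) by simp
  with that show thesis by blast
qed

text \<open>Proportionality gives \<open>P i * Q j = P j * Q i\<close>, so \<open>P i\<close>
  divides \<open>Q i\<close> times every component, hence \<open>Q i\<close> times their gcd, which
  is 1. The resulting quotient serves all components.\<close>

lemma coprime_map_eval3:
  fixes P :: "3 \<Rightarrow> qbar poly poly poly"
  assumes "gcd (P 1) (gcd (P 2) (P 3)) = 1"
  shows "coprime_map (\<lambda>x. \<chi> i. eval3 (P i) x)"
  unfolding coprime_map_def
proof (intro conjI allI impI)
  show "(\<lambda>x. (\<chi> i. eval3 (P i) x) $ i) \<in> polyfun" for i by (simp add: polyfun_eval3)
  fix G :: "qbar ^ 3 \<Rightarrow> qbar ^ 3"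
  assume G: "\<forall>i. (\<lambda>x. G x $ i) \<in> polyfun"
    and eq: "\<forall>x i j. (\<chi> i. eval3 (P i) x) $ i * G x $ j = (\<chi> i. eval3 (P i) x) $ j * G x $ i"
  from G have "\<forall>i. \<exists>Q. (\<lambda>x. G x $ i) = eval3 Q" using polyfun_imp_eval3 by blast
  then obtain Q where "\<And>i. (\<lambda>x. G x $ i) = eval3 (Q i)" by metis
  then have Q: "G x $ i = eval3 (Q i) x" for x i by (metis)
  have PQ: "P i * Q j = P j * Q i" for i j
    using eq by (subst eval3_eq_iff[symmetric]) (auto simp: Q fun_eq_iff)
  have "\<exists>i. P i \<noteq> 0" by (rule ccontr) (use assms in simp)
  then obtain i where i: "P i \<noteq> 0" ..
  have "P i dvd Q i * P j" for j using PQ[of i j] by (metis dvd_triv_left mult.commute)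
  then have "P i dvd gcd (Q i * P 1) (gcd (Q i * P 2) (Q i * P 3))" by simp
  also have "\<dots> = normalize (Q i * gcd (P 1) (gcd (P 2) (P 3)))"
    by (simp add: gcd_mult_left)
  finally obtain c where c: "Q i = P i * c" using assms by (auto elim: dvdE)
  have "Q j = c * P j" for j
    using PQ[of i j] i by (auto simp: c mult_ac)
  then have "\<forall>x. G x = eval3 c x *s (\<chi> i. eval3 (P i) x)"
    by (simp add: vec_eq_iff Q)
  with polyfun_eval3 show "\<exists>c\<in>polyfun. \<forall>x. G x = c x *s (\<chi> i. eval3 (P i) x)" by blast
qed

text \<open>A common divisor of the first and third coordinate is constant in the third variable,
  and as such divides the coefficient 1.\<close>

lemma coprime_map_id: "coprime_map (\<lambda>x. x)"
proof -
  define P :: "3 \<Rightarrow> qbar poly poly poly"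
    where "P i = (if i = 1 then [:[:[:0, 1:]:]:] else if i = 2 then [:[:0, 1:]:] else [:0, 1:])" for i
  have "is_unit d" if "d dvd P 1" "d dvd P 3" for d
  proof -
    have "degree d = 0"
      using dvd_imp_degree_le[OF that(1)] by (simp add: P_def)
    then obtain e where e: "d = [:e:]" by (rule degree_eq_zeroE)
    then have "e dvd coeff (P 3) 1" using that(2) const_poly_dvd_iff by blast
    then show ?thesis by (simp add: e P_def is_unit_const_poly_iff)
  qed
  then have "is_unit (gcd (P 1) (gcd (P 2) (P 3)))"
    by (meson dvd_trans gcd_dvd1 gcd_dvd2)
  then have "gcd (P 1) (gcd (P 2) (P 3)) = 1" by (simp add: is_unit_gcd_iff)
  moreover have "(\<lambda>x. \<chi> i. eval3 (P i) x) = (\<lambda>x. x)"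
    by (simp add: P_def vec_eq_iff forall_3 eval3_coord fun_eq_iff)
  ultimately show ?thesis using coprime_map_eval3[of P] by simp
qed

lemma coprime_map_exists:
  fixes F :: "qbar ^ 3 \<Rightarrow> qbar ^ 3"
  assumes F: "\<And>i. (\<lambda>x. F x $ i) \<in> polyfun" and x0: "F x0 \<noteq> 0"
  obtains G d where "coprime_map G" "\<And>x. F x = d x *s G x"
proof -
  have "\<forall>i. \<exists>Q. (\<lambda>x. F x $ i) = eval3 Q" using polyfun_imp_eval3 F by blast
  then obtain P where "\<And>i. (\<lambda>x. F x $ i) = eval3 (P i)" by metis
  then have P: "F x $ i = eval3 (P i) x" for x i by (metis)
  define d where "d = gcd (P 1) (gcd (P 2) (P 3))"
  have "d \<noteq> 0"
  proof
    assume "d = 0"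
    then have "P i = 0" for i using exhaust_3[of i] by (auto simp: d_def)
    with x0 show False by (simp add: vec_eq_iff P)
  qed
  have "\<forall>i. d dvd P i"
    unfolding forall_3 d_def
    by (intro conjI gcd_dvd1 dvd_trans[OF gcd_dvd2 gcd_dvd1] dvd_trans[OF gcd_dvd2 gcd_dvd2])
  then have "\<forall>i. \<exists>Q. P i = d * Q" unfolding dvd_def .
  then obtain Q where Q: "\<And>i. P i = d * Q i" by metis
  \<comment> \<open>Factoring the gcd out of itself leaves gcd 1 for the cofactors, because
    \<open>d\<close> is normalized and nonzero.\<close>
  have "d = normalize (d * gcd (Q 1) (gcd (Q 2) (Q 3)))"
    using d_def by (simp add: Q gcd_mult_left)
  also have "\<dots> = normalize d * gcd (Q 1) (gcd (Q 2) (Q 3))" by (simp add: normalize_mult)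
  also have "normalize d = d" by (simp add: d_def)
  finally have "gcd (Q 1) (gcd (Q 2) (Q 3)) = 1" using \<open>d \<noteq> 0\<close> by simp
  from coprime_map_eval3[OF this] show thesis
    by (rule that[of _ "eval3 d"]) (simp add: vec_eq_iff P Q)
qed

text \<open>On a line that avoids the origin \<open>c\<close> restricts to a univariate polynomial
  without roots, that is to a constant. The lines towards the coordinate vectors suffice to join any
  two nonzero vectors.\<close>

lemma nonvanishing_polyfun_const:
  fixes c :: "qbar ^ 3 \<Rightarrow> qbar"
  assumes c: "c \<in> polyfun" and nz: "\<And>x. x \<noteq> 0 \<Longrightarrow> c x \<noteq> 0"
  obtains k where "k \<noteq> 0" "\<And>x. x \<noteq> 0 \<Longrightarrow> c x = k"
proof -
  have line: "c (x + y) = c x" if "\<And>t. x + t *s y \<noteq> 0" for x y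
  proof -
    obtain p where p: "\<And>t. c (x + t *s y) = poly p t" using polyfun_line[OF c] by metis
    then have "degree p = 0" using nz that alg_closed_imp_poly_has_root[of p] by (metis neq0_conv)
    then obtain a where "p = [:a:]" by (rule degree_eq_zeroE)
    then show ?thesis using p[of 0] p[of 1] by simp
  qed
  have ax: "c x = c (axis j 1)" if "x $ i \<noteq> 0" "i \<noteq> j" for x i j
  proof -
    have "x + t *s (axis j 1 - x) \<noteq> 0" for t
    proof
      assume *: "x + t *s (axis j 1 - x) = 0"
      \<comment> \<open>Coordinate \<open>i\<close> vanishes only at \<open>t = 1\<close>, where the
        line has reached the nonzero vector \<open>axis j 1\<close>.\<close>
      have "x $ i * (1 - t) = (x + t *s (axis j 1 - x)) $ i"
        using that by (simp add: axis_def algebra_simps)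
      then have "x $ i * (1 - t) = 0" using * by (simp only: zero_index)
      then have "t = 1" using that by simp
      then have "axis j 1 = (0 :: qbar ^ 3)" using * by simp
      then show False by (simp add: axis_eq_0_iff)
    qed
    from line[OF this] show ?thesis by simp
  qed
  have ax2: "c (axis i 1) = c (axis j 1)" for i j
    by (cases "i = j") (auto intro: ax[of _ i])
  show thesis
  proof
    show "c (axis 1 1) \<noteq> 0" by (rule nz) (simp add: axis_eq_0_iff)
    fix x :: "qbar ^ 3" assume "x \<noteq> 0"
    then obtain i where "x $ i \<noteq> 0" by (auto simp: vec_eq_iff)
    \<comment> \<open>A second index exists because the dimension exceeds one; in dimension one the
      coordinate function itself would be a counterexample.\<close>
    moreover have "\<exists>j :: 3. i \<noteq> j"
      by (cases "i = 1") (auto intro: exI[of _ 1] exI[of _ 2])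
    then obtain j where "i \<noteq> j" ..
    ultimately show "c x = c (axis 1 1)" using ax ax2 by metis
  qed
qed

lemma span_singleton_cross:
  fixes x y :: "qbar ^ 'k"
  assumes "vec.span {x} = vec.span {y}"
  shows "x $ i * y $ j = x $ j * y $ i"
proof -
  have "y \<in> vec.span {x}" using assms vec.span_base[of y "{y}"] by simp
  then obtain c where "y = c *s x" by (auto simp: vec.span_singleton)
  then show ?thesis by simp
qed

text \<open>For fixed \<open>t\<close> the map sending \<open>y\<close> to \<open>F (t *s y)\<close>
  is a multiple of \<open>F\<close> by coprimality. The factor has no zero off the origin, so it
  does not depend on \<open>y\<close>; as a function of \<open>t\<close> it is the polynomial
  \<open>C\<close>.\<close>

lemma morphism_plane_global:
  fixes f :: "(qbar ^ 3) set \<Rightarrow> (qbar ^ 3) set"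
  assumes f: "morphism projective_space projective_space f"
  obtains F C where "coprime_map F"
    "\<And>x. x \<noteq> 0 \<Longrightarrow> F x \<noteq> 0 \<and> f (vec.span {x}) = vec.span {F x}"
    "\<And>t x. t \<noteq> 0 \<Longrightarrow> x \<noteq> 0 \<Longrightarrow> F (t *s x) = poly C t *s F x"
proof -
  have loc: "\<exists>q H. q \<in> polyfun \<and> (\<forall>i. (\<lambda>x. H x $ i) \<in> polyfun) \<and> q x0 \<noteq> 0 \<and>
      (\<forall>x. x \<noteq> 0 \<longrightarrow> q x \<noteq> 0 \<longrightarrow> H x \<noteq> 0 \<and> f (vec.span {x}) = vec.span {H x :: qbar ^ 3})"
    if "x0 \<noteq> 0" for x0 :: "qbar ^ 3"
    by (rule morphism_projective_local[OF graded_presentation_projective f, of x0])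
      (use that in \<open>auto simp: projective_space_def\<close>)
  define e :: "qbar ^ 3" where "e = axis 1 1"
  have e: "e \<noteq> 0" by (simp add: e_def axis_eq_0_iff)
  obtain q H where q: "q \<in> polyfun" "q e \<noteq> 0" and H: "\<And>i. (\<lambda>x. H x $ i) \<in> polyfun"
    and fH: "\<And>x. x \<noteq> 0 \<Longrightarrow> q x \<noteq> 0 \<Longrightarrow> H x \<noteq> 0 \<and> f (vec.span {x}) = vec.span {H x :: qbar ^ 3}"
    using loc[OF e] by blast
  obtain F d where F: "coprime_map F" and d: "\<And>x. H x = d x *s F x"
    using coprime_map_exists[of H e] H fH[OF e q(2)] by blast
  have Fp: "(\<lambda>x. F x $ i) \<in> polyfun" for i using F by (simp add: coprime_map_def)
  have fF0: "f (vec.span {x}) = vec.span {F x}" if "x \<noteq> 0" "q x \<noteq> 0" for x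
    using fH[OF that] d[of x] span_singleton_eq_iff[of "F x" "H x"] by auto
  have fF: "F x \<noteq> 0 \<and> f (vec.span {x}) = vec.span {F x}" if x: "x \<noteq> 0" for x
  proof -
    obtain r G where r: "r \<in> polyfun" "r x \<noteq> 0" and G: "\<And>i. (\<lambda>x. G x $ i) \<in> polyfun"
      and fG: "\<And>x. x \<noteq> 0 \<Longrightarrow> r x \<noteq> 0 \<Longrightarrow> G x \<noteq> 0 \<and> f (vec.span {x}) = vec.span {G x :: qbar ^ 3}"
      using loc[OF x] by blast
    \<comment> \<open>Both descriptions of \<open>f\<close> hold where \<open>q\<close> and
      \<open>r\<close> are nonzero; this set is dense, so the cross products agree
      everywhere.\<close>
    have "(\<lambda>y. F y $ i * G y $ j) = (\<lambda>y. F y $ j * G y $ i)" for i j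
    proof -
      have qr: "(\<lambda>y. q y * r y) \<in> polyfun" using q r by (intro polyfun.mult)
      obtain P Q where PQ: "q = eval3 P" "r = eval3 Q" using q r polyfun_imp_eval3 by metis
      then have "P * Q \<noteq> 0" using q r by auto
      then have "\<exists>z. q z * r z \<noteq> 0" using eval3_eq_0_iff[of "P * Q"] PQ by auto
      then obtain z where z: "q z * r z \<noteq> 0" by blast
      show ?thesis
      proof (rule polyfun_eqI_dense[OF _ _ qr, of _ _ z])
        show "F y $ i * G y $ j = F y $ j * G y $ i" if "y \<noteq> 0" "q y * r y \<noteq> 0" for y
          using span_singleton_cross[of "F y" "G y" i j] fF0[of y] fG[of y] that by simp
      qed (use z in \<open>auto intro: polyfun.mult Fp G\<close>)
    qed
    then have "F y $ i * G y $ j = F y $ j * G y $ i" for i j y by metis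
    then obtain c where c: "\<And>y. G y = c y *s F y" using coprime_mapE[OF F G] by blast
    show ?thesis
      using fG[OF x r(2)] c[of x] span_singleton_eq_iff[of "F x" "G x"] by auto
  qed
  \<comment> \<open>A coordinate that does not vanish at \<open>e\<close> makes the factor visible:
    it is \<open>p\<close> divided by \<open>F e $ i\<close>.\<close>
  obtain i where i: "F e $ i \<noteq> 0" using fF[OF e] by (auto simp: vec_eq_iff)
  obtain p where p: "\<And>t. F (0 + t *s e) $ i = poly p t" using polyfun_line[OF Fp] by metis
  show thesis
  proof
    show "coprime_map F" by fact
    show "F x \<noteq> 0 \<and> f (vec.span {x}) = vec.span {F x}" if "x \<noteq> 0" for x using fF[OF that] .
    show "F (t *s x) = poly (smult (inverse (F e $ i)) p) t *s F x" if t: "t \<noteq> 0" and x: "x \<noteq> 0" for t x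
    proof -
      have "F y $ i * F (t *s y) $ j = F y $ j * F (t *s y) $ i" for i j y
      proof (cases "y = 0")
        case False
        then have "vec.span {y} = vec.span {t *s y}"
          using t by (subst span_singleton_eq_iff) auto
        then show ?thesis
          using fF[of y] fF[of "t *s y"] False t by (intro span_singleton_cross) auto
      qed (simp add: mult.commute)
      moreover have "(\<lambda>y. F (t *s y) $ i) \<in> polyfun" for i
        by (rule polyfun_compose[OF Fp]) (auto intro: polyfun.intros)
      ultimately obtain c where c: "c \<in> polyfun" "\<And>y. F (t *s y) = c y *s F y"
        using coprime_mapE[OF F, of "\<lambda>y. F (t *s y)"] by blast
      have cnz: "c y \<noteq> 0" if "y \<noteq> 0" for y
        using fF[of "t *s y"] c(2)[of y] that t by auto
      obtain k where k: "\<And>y. y \<noteq> 0 \<Longrightarrow> c y = k"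
        by (rule nonvanishing_polyfun_const[OF c(1) cnz], assumption) (rule that)
      have "poly p t = k * F e $ i" using p[of t] c(2)[of e] k[OF e] by simp
      then show ?thesis using c(2)[of x] k[OF x] i by simp
    qed
  qed
qed

text \<open>With w(t) the value at \<open>x + t *s y\<close> and v(s) the value at
  \<open>y + s *s x\<close>, homogeneity gives v(s) = s w(1/s). Both are polynomials, so
  \<open>w\<close> has degree at most 1 and \<open>v\<close> has its coefficients in reverse
  order.\<close>

lemma homogeneous_degree_1_additive:
  fixes f :: "qbar ^ 'n \<Rightarrow> qbar"
  assumes f: "f \<in> polyfun" and hom: "\<And>t x. f (t *s x) = t * f x"
  shows "f (x + y) = f x + f y"
proof -
  obtain w where w: "\<And>t. f (x + t *s y) = poly w t" using polyfun_line[OF f] by metis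
  obtain v where v: "\<And>t. f (y + t *s x) = poly v t" using polyfun_line[OF f] by metis
  have vw: "poly v s = s * poly w (inverse s)" if "s \<noteq> 0" for s
  proof -
    have "y + s *s x = s *s (x + inverse s *s y)" using that by (simp add: vec.scale_right_distrib)
    then show ?thesis using v[of s] w[of "inverse s"] hom by metis
  qed
  \<comment> \<open>\<open>reflect_poly w\<close> is \<open>w\<close> at the inverse, times the
    power \<open>degree w\<close> of the argument; this clears denominators.\<close>
  have "monom 1 (degree w) * v = [:0, 1:] * reflect_poly w"
  proof (rule poly_eqI_cofinite[of "[:0, 1:]"])
    fix t :: qbar assume "poly [:0, 1:] t \<noteq> 0"
    then show "poly (monom 1 (degree w) * v) t = poly ([:0, 1:] * reflect_poly w) t"
      by (simp add: poly_monom vw poly_reflect_poly_nz)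
  qed simp
  then have co: "coeff (monom 1 (degree w) * v) 1 = coeff ([:0, 1:] * reflect_poly w) 1" by simp
  have "degree w \<le> 1"
  proof (rule ccontr)
    assume "\<not> degree w \<le> 1"
    \<comment> \<open>The left side has no linear term, whereas the right side has the leading
      coefficient of \<open>w\<close> there.\<close>
    then show False using co by (auto simp: coeff_monom_mult coeff_pCons)
  qed
  then have "w = [:coeff w 0, coeff w 1:]"
    by (intro poly_eqI) (auto simp: coeff_pCons coeff_eq_0 split: nat.splits)
  then obtain a b where ab: "w = [:a, b:]" by blast
  have "v = [:b, a:]"
  proof (rule poly_eqI_cofinite[of "[:0, 1:]"])
    fix t :: qbar assume "poly [:0, 1:] t \<noteq> 0"
    then have t: "t \<noteq> 0" by simp
    have "poly v t = t * a + (t * inverse t) * b"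
      unfolding vw[OF t] ab by (simp add: algebra_simps)
    with t show "poly v t = poly [:b, a:] t" by simp
  qed simp
  with v[of 0] w[of 0] w[of 1] show ?thesis by (simp add: ab)
qed

text \<open>Degrees are compared in the scaling factors: \<open>D\<close> composed with
  \<open>C\<close> is the identity polynomial, so \<open>C\<close> has degree 1. It has no root
  except possibly 0 and takes the value 1 at 1, so \<open>F\<close> is homogeneous of degree
  1.\<close>

lemma plane_automorphism_linear:
  fixes f g :: "(qbar ^ 3) set \<Rightarrow> (qbar ^ 3) set"
  assumes f: "morphism projective_space projective_space f"
    and g: "morphism projective_space projective_space g"
    and gf: "\<And>p. p \<in> proj_points \<Longrightarrow> g (f p) = p"
  obtains A where "invertible A" "\<And>x. x \<noteq> 0 \<Longrightarrow> f (vec.span {x}) = vec.span {A *v x}"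
proof -
  obtain F C where F: "coprime_map F"
    and fF: "\<And>x. x \<noteq> 0 \<Longrightarrow> F x \<noteq> 0 \<and> f (vec.span {x}) = vec.span {F x}"
    and C: "\<And>t x. t \<noteq> 0 \<Longrightarrow> x \<noteq> 0 \<Longrightarrow> F (t *s x) = poly C t *s F x"
    by (rule morphism_plane_global[OF f]) (rule that)
  obtain G D where G: "coprime_map G"
    and gG: "\<And>x. x \<noteq> 0 \<Longrightarrow> G x \<noteq> 0 \<and> g (vec.span {x}) = vec.span {G x}"
    and D: "\<And>t x. t \<noteq> 0 \<Longrightarrow> x \<noteq> 0 \<Longrightarrow> G (t *s x) = poly D t *s G x"
    by (rule morphism_plane_global[OF g]) (rule that)
  have Fp: "(\<lambda>x. F x $ i) \<in> polyfun" for i using F by (simp add: coprime_map_def)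
  have Gp: "(\<lambda>x. G x $ i) \<in> polyfun" for i using G by (simp add: coprime_map_def)
  have GF: "vec.span {x} = vec.span {G (F x)}" if "x \<noteq> 0" for x
    using gf[of "vec.span {x}"] fF[OF that] gG[of "F x"] that by (auto simp: proj_points_eq)
  have "x $ i * G (F x) $ j = x $ j * G (F x) $ i" for x i j
    using span_singleton_cross[OF GF] by (cases "x = 0") auto
  moreover have "(\<lambda>x. G (F x) $ i) \<in> polyfun" for i
    by (rule polyfun_compose[OF Gp Fp])
  ultimately obtain c where c: "c \<in> polyfun" "\<And>x. G (F x) = c x *s x"
    using coprime_mapE[OF coprime_map_id, of "\<lambda>x. G (F x)"] by blast
  have cnz: "c x \<noteq> 0" if "x \<noteq> 0" for x
    using c(2)[of x] gG[of "F x"] fF[OF that] by auto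
  obtain k where k: "k \<noteq> 0" "\<And>x. x \<noteq> 0 \<Longrightarrow> c x = k"
    by (rule nonvanishing_polyfun_const[OF c(1) cnz], assumption) (rule that)
  define e :: "qbar ^ 3" where "e = axis 1 1"
  have e: "e \<noteq> 0" by (simp add: e_def axis_eq_0_iff)
  have Cnz: "poly C t \<noteq> 0" if "t \<noteq> 0" for t
    using fF[of "t *s e"] C[OF that e] that e by auto
  have "pcompose D C = [:0, 1:]"
  proof (rule poly_eqI_cofinite[of "[:0, 1:]"])
    fix t :: qbar assume "poly [:0, 1:] t \<noteq> 0"
    then have t: "t \<noteq> 0" by simp
    then have "k *s (t *s e) = G (F (t *s e))" using c(2) k e by simp
    also have "\<dots> = poly D (poly C t) *s G (F e)"
      using C[OF t e] D[OF Cnz[OF t]] fF[OF e] by simp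
    also have "G (F e) = k *s e" using c(2) k e by simp
    finally have "(k * t) *s e = (k * poly D (poly C t)) *s e" by (simp add: mult_ac)
    then show "poly (pcompose D C) t = poly [:0, 1:] t"
      using k e by (simp add: poly_pcompose)
  qed simp
  then have "degree (pcompose D C) = 1" by simp
  then have "degree D * degree C = 1" by (simp only: degree_pcompose)
  then have "degree C = 1" by simp
  then obtain a b where ab: "C = [:a, b:]" "b \<noteq> 0" by (rule degree1_coeffs)
  have "a = 0"
  proof (rule ccontr)
    assume "a \<noteq> 0"
    then show False using Cnz[of "- a / b"] ab by simp
  qed
  moreover have "poly C 1 = 1"
  proof -
    obtain i where "F e $ i \<noteq> 0" using fF[OF e] by (auto simp: vec_eq_iff)
    moreover have "F e $ i = poly C 1 * F e $ i"
      using arg_cong[OF C[of 1 e], of "\<lambda>v. v $ i"] e by simp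
    ultimately show ?thesis by simp
  qed
  ultimately have Ct: "poly C t = t" for t by (simp add: ab)
  \<comment> \<open>The scaling rule excludes the zero vector; the value there is obtained by
    continuing it along a line.\<close>
  have F0: "F 0 = 0"
  proof -
    have "F 0 $ i = 0" for i
    proof -
      obtain p where p: "\<And>t. F (0 + t *s e) $ i = poly p t" using polyfun_line[OF Fp] by metis
      have "p = [:0, F e $ i:]"
      proof (rule poly_eqI_cofinite[of "[:0, 1:]"])
        fix t :: qbar assume "poly [:0, 1:] t \<noteq> 0"
        then show "poly p t = poly [:0, F e $ i:] t" using p[of t] C[of t e] e by (simp add: Ct)
      qed simp
      then show ?thesis using p[of 0] by simp
    qed
    then show ?thesis by (simp add: vec_eq_iff)
  qed
  have hom: "F (t *s x) = t *s F x" for t x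
    using C[of t x] F0 by (cases "t = 0 \<or> x = 0") (auto simp: Ct)
  have "F (x + y) = F x + F y" for x y
    using homogeneous_degree_1_additive[OF Fp] hom by (simp add: vec_eq_iff)
  then have "Vector_Spaces.linear (*s) (*s) F"
    using hom by unfold_locales auto
  then have A: "matrix F *v x = F x" for x by (rule matrix_works)
  show thesis
  proof
    have "\<forall>x. matrix F *v x = 0 \<longrightarrow> x = 0" using A fF by auto
    then show "invertible (matrix F)"
      using invertible_left_inverse matrix_left_invertible_ker by blast
    show "f (vec.span {x}) = vec.span {matrix F *v x}" if "x \<noteq> 0" for x
      using fF[OF that] by (simp add: A)
  qed
qed

section \<open>Lifting an action to unimodular matrices\<close>

lemma ga_structure_morphism_point:
  fixes \<phi> :: "qbar ^ 'n::finite \<Rightarrow> (qbar ^ 'k::finite) set \<Rightarrow> (qbar ^ 'k) set"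
  assumes "ga_structure \<phi>"
  shows "morphism projective_space projective_space (\<phi> a)"
proof -
  let ?Z = "affine_times_projective :: ('n + 'k, (qbar ^ 'n) \<times> (qbar ^ 'k) set) presented_variety"
  have "morphism projective_space ?Z (\<lambda>p. (a, p))"
  proof (rule morphism_polynomial[where e = 1
        and F = "case_sum (\<lambda>i. mconst (a $ i)) mvar", OF graded_presentation_affine_times_projective])
    show "weight_homogeneous (weight projective_space) (1 * weight ?Z j)
        (case_sum (\<lambda>i. mconst (a $ i)) mvar j)" for j
      using weight_homogeneous_mvar[of "weight (projective_space :: ('k, _) presented_variety)"]
      by (cases j) (simp_all add: affine_times_projective_def projective_space_def)
  qed (auto simp: affine_times_projective_def projective_space_def)
  from morphism_comp[OF this, of projective_space "\<lambda>(a, p). \<phi> a p"] assms show ?thesis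
    by (simp add: ga_structure_def)
qed

lemma ga_structure_morphism_line:
  fixes \<phi> :: "qbar ^ 'n::finite \<Rightarrow> (qbar ^ 'k::finite) set \<Rightarrow> (qbar ^ 'k) set"
  assumes "ga_structure \<phi>" "x \<noteq> 0"
  shows "morphism affine_space projective_space (\<lambda>t :: qbar ^ 1. \<phi> (t $ 1 *s v) (vec.span {x}))"
proof -
  let ?Z = "affine_times_projective :: ('n + 'k, (qbar ^ 'n) \<times> (qbar ^ 'k) set) presented_variety"
  let ?F = "case_sum (\<lambda>i. mvar (1 :: 1) * mconst (v $ i)) (\<lambda>j. mconst (x $ j))"
  have "morphism (affine_space :: (1, qbar ^ 1) presented_variety) ?Z (\<lambda>t. (t $ 1 *s v, vec.span {x}))"
  proof (rule morphism_polynomial[where e = 0 and F = ?F, OF graded_presentation_affine_times_projective])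
    show "weight_homogeneous (weight affine_space) (0 * weight ?Z j) (?F j)" for j
      using weight_homogeneous_mult[OF weight_homogeneous_mvar weight_homogeneous_mconst,
          of "\<lambda>_. 0" "1 :: 1"]
      by (cases j) (simp_all add: affine_space_def)
  qed (use assms(2) in \<open>auto simp: affine_times_projective_def affine_space_def mpoly_eval_mult vec_eq_iff\<close>)
  from morphism_comp[OF this, of projective_space "\<lambda>(a, p). \<phi> a p"] assms show ?thesis
    by (simp add: ga_structure_def)
qed

text \<open>In this form the regularity of the action in the group variable enters the study of its
  lift: along a line of the group the image of a point has polynomial coordinates, apart from
  finitely many parameters.\<close>

lemma ga_structure_line_rational:
  fixes \<phi> :: "qbar ^ 'n::finite \<Rightarrow> (qbar ^ 'k::finite) set \<Rightarrow> (qbar ^ 'k) set"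
  assumes "ga_structure \<phi>" "x \<noteq> 0"
  obtains q and f :: "'k \<Rightarrow> qbar poly" where "q \<noteq> 0"
    "\<And>t. poly q t \<noteq> 0 \<Longrightarrow> (\<chi> i. poly (f i) t) \<noteq> 0 \<and>
      \<phi> (t *s v) (vec.span {x}) = vec.span {\<chi> i. poly (f i) t}"
proof -
  obtain r and F :: "qbar ^ 1 \<Rightarrow> qbar ^ 'k" where r: "r \<in> polyfun"
    and F: "\<And>j. (\<lambda>x. F x $ j) \<in> polyfun" and r0: "r 0 \<noteq> 0"
    and rF: "\<And>t. t \<in> coords (affine_space :: (1, qbar ^ 1) presented_variety) \<Longrightarrow> r t \<noteq> 0 \<Longrightarrow> F t \<noteq> 0 \<and>
      \<phi> (pt affine_space t $ 1 *s v) (vec.span {x}) = vec.span {F t}"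
    by (rule morphism_projective_local[OF graded_presentation_affine
          ga_structure_morphism_line[OF assms, of v], of 0])
      (simp add: affine_space_def, rule that)
  let ?e = "(\<chi> i. 1) :: qbar ^ 1"
  obtain q where q: "\<And>t. r (0 + t *s ?e) = poly q t" by (rule polyfun_line[OF r]) (rule that)
  have "\<exists>p. \<forall>t. F (0 + t *s ?e) $ i = poly p t" for i
    by (rule polyfun_line[OF F[of i], of 0 ?e]) (rule exI, rule allI)
  then obtain f where f: "\<And>i t. F (0 + t *s ?e) $ i = poly (f i) t" by metis
  show thesis
  proof
    show "q \<noteq> 0" using q[of 0] r0 by auto
    fix t assume "poly q t \<noteq> 0"
    then have "r (t *s ?e) \<noteq> 0" using q[of t] by simp
    moreover have "F (t *s ?e) = (\<chi> i. poly (f i) t)" using f by (simp add: vec_eq_iff)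
    ultimately show "(\<chi> i. poly (f i) t) \<noteq> 0 \<and>
        \<phi> (t *s v) (vec.span {x}) = vec.span {\<chi> i. poly (f i) t}"
      using rF[of "t *s ?e"] by (simp add: affine_space_def)
  qed
qed

section \<open>Matrices up to scalars\<close>

lemma mat_mult_vec: "mat c *v x = c *s (x :: 'a::field ^ 'n)"
  by (simp add: vec_eq_iff matrix_vector_mult_def mat_def if_distrib[of "\<lambda>z. z * _"] sum.delta cong: if_cong)

lemma matrix_eqI_vec:
  fixes A B :: "'a::field ^ 'n ^ 'm"
  assumes "\<And>x. A *v x = B *v x"
  shows "A = B"
  using assms matrix_eq by blast

lemma mat_commute: "mat c ** A = A ** mat (c :: 'a::field)"
  by (rule matrix_eqI_vec) (simp add: mat_mult_vec vector_scalar_commute flip: matrix_vector_mul_assoc)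

lemma mat_mult_mat: "mat c ** mat d = (mat (c * d) :: 'a::field ^ 'n ^ 'n)"
  by (rule matrix_eqI_vec) (simp add: mat_mult_vec flip: matrix_vector_mul_assoc)

lemma det_mat_3: "det (mat c :: qbar ^ 3 ^ 3) = c ^ 3"
  by (simp add: det_3 mat_def power3_eq_cube)

text \<open>The basis vectors force a diagonal matrix, and the vector with all entries 1 forces
  equal entries.\<close>

lemma scalar_if_all_eigenvectors:
  fixes C :: "qbar ^ 'n ^ 'n"
  assumes "\<And>x. x \<noteq> 0 \<Longrightarrow> \<exists>c. C *v x = c *s x"
  shows "\<exists>c. C = mat c"
proof -
  define u :: "qbar ^ 'n" where "u = (\<chi> i. 1)"
  have "u \<noteq> 0" by (simp add: u_def vec_eq_iff)
  then obtain c where c: "C *v u = c *s u" using assms by blast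
  have "\<forall>i. \<exists>d. C *v axis i 1 = d *s axis i 1" using assms by (simp add: axis_eq_0_iff)
  then obtain d where d: "\<And>i. C *v axis i 1 = d i *s axis i 1" by metis
  have C: "C $ j $ i = (if i = j then d i else 0)" for i j
  proof -
    have "(C *v axis i 1) $ j = C $ j $ i" by (simp add: matrix_vector_mult_def axis_def if_distrib cong: if_cong)
    with d[of i] show ?thesis by (simp add: axis_def split: if_splits)
  qed
  have "d j = c" for j
  proof -
    have "(C *v u) $ j = d j" by (simp add: matrix_vector_mult_def u_def C)
    with c show ?thesis by (simp add: u_def)
  qed
  with C have "C = mat c" by (simp add: vec_eq_iff mat_def)
  then show ?thesis ..
qed

lemma proportional_matrices:
  fixes A B :: "qbar ^ 'n ^ 'n"
  assumes A: "invertible A" and AB: "\<And>x. x \<noteq> 0 \<Longrightarrow> vec.span {A *v x} = vec.span {B *v x}"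
  obtains c where "B = mat c ** A"
proof -
  from A obtain A' where A': "A ** A' = mat 1" "A' ** A = mat 1" unfolding invertible_def by blast
  have "\<exists>c. (A' ** B) *v x = c *s x" if "x \<noteq> 0" for x
  proof -
    have "B *v x \<in> vec.span {A *v x}" using AB[OF that] vec.span_base[of "B *v x" "{B *v x}"] by simp
    then obtain c where c: "B *v x = c *s (A *v x)" by (auto simp: vec.span_singleton)
    have "(A' ** B) *v x = c *s ((A' ** A) *v x)"
      unfolding matrix_vector_mul_assoc[symmetric] c
      by (simp add: vector_scalar_commute)
    with A' show ?thesis by auto
  qed
  then obtain c where "A' ** B = mat c" using scalar_if_all_eigenvectors by blast
  then have "A ** (A' ** B) = A ** mat c" by simp
  then have "B = mat c ** A" by (simp add: matrix_mul_assoc A' mat_commute)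
  with that show thesis .
qed

text \<open>The determinant condition leaves only a cube root of unity undetermined in a matrix that
  induces \<open>f\<close>.\<close>

definition unimodular_lift :: "((qbar ^ 3) set \<Rightarrow> (qbar ^ 3) set) \<Rightarrow> qbar ^ 3 ^ 3 \<Rightarrow> bool" where
  "unimodular_lift f A \<longleftrightarrow> det A = 1 \<and> (\<forall>x. x \<noteq> 0 \<longrightarrow> f (vec.span {x}) = vec.span {A *v x})"

lemma det_1_nonzero: "det (A :: qbar ^ 3 ^ 3) = 1 \<Longrightarrow> x \<noteq> 0 \<Longrightarrow> A *v x \<noteq> 0"
  by (metis invertible_det_nz invertible_left_inverse matrix_left_invertible_ker zero_neq_one)

lemma unimodular_lift_comp:
  assumes "unimodular_lift f A" "unimodular_lift g B"
  shows "unimodular_lift (\<lambda>p. f (g p)) (A ** B)"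
  using assms det_1_nonzero[of B]
  by (auto simp: unimodular_lift_def det_mul matrix_vector_mul_assoc)

lemma unimodular_lift_unique:
  assumes "unimodular_lift f A" "unimodular_lift f B"
  obtains c where "B = mat c ** A" "c ^ 3 = 1"
proof -
  have "invertible A" using assms by (simp add: invertible_det_nz unimodular_lift_def)
  then obtain c where c: "B = mat c ** A"
    by (rule proportional_matrices[of A B]) (use assms in \<open>simp add: unimodular_lift_def\<close>, rule that)
  then have "det B = c ^ 3 * det A" by (simp add: det_mul det_mat_3)
  then have "c ^ 3 = 1" using assms by (simp add: unimodular_lift_def)
  with c that show thesis by blast
qed

lemma unimodular_lift_exists:
  assumes "invertible A" "\<And>x. x \<noteq> 0 \<Longrightarrow> f (vec.span {x}) = vec.span {A *v x}"
  obtains B where "unimodular_lift f B"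
proof -
  have d: "det A \<noteq> 0" using assms by (simp add: invertible_det_nz)
  have "degree (monom 1 3 + [:- (1 / det A):] :: qbar poly) = 3"
    by (subst degree_add_eq_left) (auto simp: degree_monom_eq)
  \<comment> \<open>A root is a cube root of \<open>1 / det A\<close>, by which the determinant is
    scaled to 1.\<close>
  then obtain c where "poly (monom 1 3 + [:- (1 / det A):]) c = 0"
    using alg_closed_imp_poly_has_root[of "monom 1 3 + [:- (1 / det A):]"] by auto
  then have c: "c ^ 3 * det A = 1" using d by (simp add: poly_monom)
  then have "c \<noteq> 0" by auto
  have "vec.span {A *v x} = vec.span {(mat c ** A) *v x}" if "x \<noteq> 0" for x
  proof -
    have "A *v x \<noteq> 0" using assms(1) that
      by (metis invertible_left_inverse matrix_left_invertible_ker)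
    then show ?thesis using \<open>c \<noteq> 0\<close>
      by (subst span_singleton_eq_iff) (auto simp: mat_mult_vec simp flip: matrix_vector_mul_assoc)
  qed
  then have "unimodular_lift f (mat c ** A)"
    using assms c by (simp add: unimodular_lift_def det_mul det_mat_3)
  with that show thesis .
qed

text \<open>A scalar commutator is multiplicative in \<open>A\<close>, so cubing \<open>A\<close>
  cubes the scalar; a cube root of unity becomes 1.\<close>

lemma mat_conj_cube:
  fixes A B :: "'a::field ^ 'n ^ 'n"
  assumes "A ** B = mat c ** (B ** A)"
  shows "(A ** A ** A) ** B = mat (c ^ 3) ** (B ** (A ** A ** A))"
proof -
  have *: "A ** (B ** Z) = mat c ** (B ** (A ** Z))" for Z :: "'a ^ 'n ^ 'n"
    using assms by (metis matrix_mul_assoc)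
  have comm: "A ** (mat c ** Z) = mat c ** (A ** Z)" for Z :: "'a ^ 'n ^ 'n"
    by (metis mat_commute matrix_mul_assoc)
  have "(A ** A ** A) ** B = mat c ** (mat c ** (mat c ** (B ** (A ** (A ** A)))))"
    using assms by (simp add: comm * flip: matrix_mul_assoc)
  also have "\<dots> = mat (c ^ 3) ** (B ** (A ** A ** A))"
    by (simp add: matrix_mul_assoc mat_mult_mat power3_eq_cube mult.assoc)
  finally show ?thesis .
qed

text \<open>The group is divisible and the kernel of \<open>SL\<^sub>3 \<rightarrow> PGL\<^sub>3\<close> is the group of cube roots of unity.
  Hence lifts of commuting elements commute, and the cube of a lift of \<open>a / 3\<close> is a lift of \<open>a\<close>
  that does not depend on choices.\<close>

lemma additive_action_lift:
  fixes \<phi> :: "qbar ^ 'n \<Rightarrow> (qbar ^ 3) set \<Rightarrow> (qbar ^ 3) set"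
  assumes ex: "\<And>a. \<exists>A. unimodular_lift (\<phi> a) A"
    and add: "\<And>a b p. p \<in> proj_points \<Longrightarrow> \<phi> (a + b) p = \<phi> a (\<phi> b p)"
  obtains M where "\<And>a. unimodular_lift (\<phi> a) (M a)" "\<And>a b. M (a + b) = M a ** M b"
proof -
  have mult: "unimodular_lift (\<phi> (a + b)) (A ** B)"
    if "unimodular_lift (\<phi> a) A" "unimodular_lift (\<phi> b) B" for a b A B
    using unimodular_lift_comp[OF that] add[of "vec.span {x}" a b for x]
    by (auto simp: unimodular_lift_def proj_points_eq)
  have third: "inverse 3 *s a + inverse 3 *s a + inverse 3 *s a = a" for a :: "qbar ^ 'n"
  proof -
    have "inverse 3 *s a + inverse 3 *s a + inverse 3 *s a = (3 * inverse 3) *s a"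
      by (simp add: vec_eq_iff algebra_simps)
    then show ?thesis by simp
  qed
  have cube: "unimodular_lift (\<phi> a) (A ** A ** A)"
    if "unimodular_lift (\<phi> (inverse 3 *s a)) A" for a A
    using mult[OF mult[OF that that] that] by (simp only: third)
  have commute: "A ** B = B ** A"
    if A: "unimodular_lift (\<phi> a) A" and B: "unimodular_lift (\<phi> b) B" for a b A B
  proof -
    \<comment> \<open>\<open>C\<close> lifts a third of \<open>a\<close>. Its commutator with
      \<open>B\<close> is a scalar whose cube is 1, so the cube of \<open>C\<close>, which is
      \<open>A\<close> up to a scalar, commutes with \<open>B\<close>.\<close>
    obtain C where C: "unimodular_lift (\<phi> (inverse 3 *s a)) C" using ex by blast
    obtain w where w: "A = mat w ** (C ** C ** C)"
      by (rule unimodular_lift_unique[OF cube[OF C] A]) (rule that)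
    obtain c where c: "C ** B = mat c ** (B ** C)" "c ^ 3 = 1"
      using mult[OF C B] mult[OF B C]
      by (auto simp: add.commute elim: unimodular_lift_unique[of _ "B ** C" "C ** B"])
    have "(C ** C ** C) ** B = B ** (C ** C ** C)"
      using mat_conj_cube[OF c(1)] by (simp add: c(2))
    then show ?thesis unfolding w by (metis mat_commute matrix_mul_assoc)
  qed
  \<comment> \<open>\<open>N a\<close> is an arbitrary lift of a third of \<open>a\<close>; the map
    sought is its cube.\<close>
  define N where "N a = (SOME A. unimodular_lift (\<phi> (inverse 3 *s a)) A)" for a
  have N: "unimodular_lift (\<phi> (inverse 3 *s a)) (N a)" for a
    unfolding N_def using ex by (rule someI_ex)
  show thesis
  proof
    show "unimodular_lift (\<phi> a) (N a ** N a ** N a)" for a using cube[OF N] .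
    fix a b
    have AB: "unimodular_lift (\<phi> (inverse 3 *s (a + b))) (N a ** N b)"
      using mult[OF N N, of a b] by (simp add: vec.scale_right_distrib)
    \<comment> \<open>Two lifts of a third of \<open>a + b\<close> differ by a cube root of unity,
      which cubing removes.\<close>
    obtain w where w: "N (a + b) = mat w ** (N a ** N b)" "w ^ 3 = 1"
      by (rule unimodular_lift_unique[OF AB N[of "a + b"]]) (rule that)
    have c: "N b ** (N a ** Z) = N a ** (N b ** Z)" for Z
      using commute[OF N N, of b a] by (metis matrix_mul_assoc)
    have m: "Z ** (mat w ** Y) = mat w ** (Z ** Y)" for Z Y :: "qbar ^ 3 ^ 3"
      by (metis mat_commute matrix_mul_assoc)
    have "N (a + b) ** N (a + b) ** N (a + b) =
        mat w ** (mat w ** (mat w ** (N a ** (N a ** (N a ** (N b ** (N b ** N b)))))))"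
      by (simp add: w(1) m[of "N a"] m[of "N b"] c commute[OF N N, of b a] flip: matrix_mul_assoc)
    also have "\<dots> = mat (w ^ 3) ** ((N a ** N a ** N a) ** (N b ** N b ** N b))"
      by (simp add: matrix_mul_assoc mat_mult_mat power3_eq_cube mult.assoc)
    finally show "N (a + b) ** N (a + b) ** N (a + b) =
        (N a ** N a ** N a) ** (N b ** N b ** N b)" by (simp add: w(2))
  qed
qed

lemma ga_structure_lift:
  fixes \<phi> :: "qbar ^ 'n::finite \<Rightarrow> (qbar ^ 3) set \<Rightarrow> (qbar ^ 3) set"
  assumes \<phi>: "ga_structure \<phi>"
  obtains M where "\<And>a. unimodular_lift (\<phi> a) (M a)" "\<And>a b. M (a + b) = M a ** M b"
proof -
  have add: "\<phi> (a + b) p = \<phi> a (\<phi> b p)" if "p \<in> proj_points" for a b p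
    using \<phi> that by (simp add: ga_structure_def)
  have "\<exists>A. unimodular_lift (\<phi> a) A" for a
  proof -
    have inv: "\<phi> (- a) (\<phi> a p) = p" if "p \<in> proj_points" for p
      using add[OF that, of "- a" a] \<phi> that by (simp add: ga_structure_def)
    obtain A where A: "invertible A" "\<And>x. x \<noteq> 0 \<Longrightarrow> \<phi> a (vec.span {x}) = vec.span {A *v x}"
      by (rule plane_automorphism_linear[OF ga_structure_morphism_point[OF \<phi>]
            ga_structure_morphism_point[OF \<phi>] inv], assumption) (rule that)
    show ?thesis by (rule unimodular_lift_exists[OF A], assumption) (rule exI)
  qed
  from additive_action_lift[of \<phi>, OF this add] that show thesis by blast
qed

section \<open>Rational one-parameter groups of matrices\<close>

definition columns3 :: "'a ^ 3 \<Rightarrow> 'a ^ 3 \<Rightarrow> 'a ^ 3 \<Rightarrow> 'a ^ 3 ^ 3" where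
  "columns3 a b c = (\<chi> i j. if j = 1 then a $ i else if j = 2 then b $ i else c $ i)"

lemma columns3_mult_vec:
  "columns3 a b c *v x = x $ 1 *s a + x $ 2 *s b + x $ 3 *s (c :: 'a::field ^ 3)"
  by (simp add: vec_eq_iff columns3_def matrix_vector_mult_def sum_3 mult.commute)

lemma mult_columns3:
  "A ** columns3 a b c = columns3 (A *v a) (A *v b) (A *v (c :: 'a::field ^ 3))"
  by (simp add: vec_eq_iff columns3_def matrix_matrix_mult_def matrix_vector_mult_def forall_3)

text \<open>This is a Jordan basis: applying the square of \<open>N\<close>, then \<open>N\<close>,
  to a linear relation isolates its coefficients in turn.\<close>

lemma invertible_columns3_cyclic:
  fixes N :: "qbar ^ 3 ^ 3"
  assumes "N *v (N *v (N *v y)) = 0" "N *v (N *v y) \<noteq> 0"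
  shows "invertible (columns3 (N *v (N *v y)) (N *v y) y)"
proof -
  have "x = 0" if x: "columns3 (N *v (N *v y)) (N *v y) y *v x = 0" for x
  proof -
    have eq: "x $ 1 *s (N *v (N *v y)) + x $ 2 *s (N *v y) + x $ 3 *s y = 0"
      using x by (simp add: columns3_mult_vec)
    have "N *v (N *v (x $ 1 *s (N *v (N *v y)) + x $ 2 *s (N *v y) + x $ 3 *s y)) = x $ 3 *s (N *v (N *v y))"
      using assms by (simp add: matrix_vector_right_distrib vector_scalar_commute)
    then have 3: "x $ 3 = 0" using assms by (simp add: eq)
    have "N *v (x $ 1 *s (N *v (N *v y)) + x $ 2 *s (N *v y) + x $ 3 *s y) = x $ 2 *s (N *v (N *v y))"
      using assms 3 by (simp add: matrix_vector_right_distrib vector_scalar_commute)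
    then have 2: "x $ 2 = 0" using assms by (simp add: eq)
    with 3 eq assms have "x $ 1 = 0" by simp
    with 2 3 show ?thesis by (simp add: vec_eq_iff forall_3)
  qed
  then show ?thesis using invertible_left_inverse matrix_left_invertible_ker by blast
qed

text \<open>Lowers the exponent while it exceeds 3. If the power \<open>d\<close> were nonzero, some
  \<open>y\<close> would have nonzero third and zero fourth iterate; its first three iterates would
  then be a basis killed by the third power, contradicting the choice of \<open>y\<close>.\<close>

lemma nilpotent_cube_eq_0:
  fixes N :: "qbar ^ 3 ^ 3"
  assumes "\<And>x. ((*v) N ^^ d) x = 0"
  shows "N ** N ** N = 0"
proof -
  have "((*v) N ^^ 3) x = 0" for x
    using assms
  proof (induction d arbitrary: x)
    case 0
    then have "x = 0" by simp
    then show ?case by (simp add: eval_nat_numeral)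
  next
    case (Suc d)
    show ?case
    proof (cases "d \<ge> 3")
      case False
      then obtain k where "3 = k + Suc d" by (metis add.commute le_add_diff_inverse not_less_eq_eq)
      then have "((*v) N ^^ 3) x = ((*v) N ^^ k) (((*v) N ^^ Suc d) x)" by (simp only: funpow_add comp_apply)
      also have "\<dots> = ((*v) N ^^ k) 0" using Suc.prems by simp
      also have "\<dots> = 0" by (induction k) auto
      finally show ?thesis .
    next
      case True
      then obtain k where d: "d = 3 + k" by (metis le_add_diff_inverse)
      have "((*v) N ^^ d) x = 0" for x
      proof (rule ccontr)
        assume nz: "((*v) N ^^ d) x \<noteq> 0"
        define y where "y = ((*v) N ^^ k) x"
        define z where "z = N *v y"
        have 1: "N *v (N *v z) \<noteq> 0"
          using nz by (simp add: d z_def y_def eval_nat_numeral)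
        have 2: "N *v (N *v (N *v z)) = 0"
          using Suc.prems[of x] by (simp add: d z_def y_def eval_nat_numeral)
        from invertible_columns3_cyclic[OF 2 1]
        obtain B where "columns3 (N *v (N *v z)) (N *v z) z ** B = mat 1"
          by (auto simp: invertible_def)
        then have "columns3 (N *v (N *v z)) (N *v z) z *v (B *v y) = y"
          by (simp add: matrix_vector_mul_assoc)
        then have "N *v (N *v (N *v y)) =
            N *v (N *v (N *v (columns3 (N *v (N *v z)) (N *v z) z *v (B *v y))))" by simp
        also have "\<dots> = 0"
          using 2 by (simp add: columns3_mult_vec matrix_vector_right_distrib vector_scalar_commute)
        finally show False using 1 by (simp add: z_def)
      qed
      then show ?thesis by (rule Suc.IH)
    qed
  qed
  then have "(N ** N ** N) *v x = 0 *v x" for x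
    by (simp add: eval_nat_numeral flip: matrix_vector_mul_assoc)
  then show ?thesis by (rule matrix_eqI_vec)
qed

section \<open>From rational to polynomial dependence on the parameter\<close>

definition poly_matrix :: "qbar poly ^ 'n ^ 'm \<Rightarrow> qbar \<Rightarrow> qbar ^ 'n ^ 'm" where
  "poly_matrix P t = (\<chi> i j. poly (P $ i $ j) t)"

lemma poly_matrix_nth [simp]: "poly_matrix P t $ i $ j = poly (P $ i $ j) t"
  by (simp add: poly_matrix_def)

lemma poly_matrix_mult: "poly_matrix (P ** Q) t = poly_matrix P t ** poly_matrix Q t"
  by (simp add: vec_eq_iff matrix_matrix_mult_def poly_sum)

lemma det_poly_matrix_3: "det (poly_matrix P t :: qbar ^ 3 ^ 3) = poly (det P) t"
  by (simp add: det_3)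

lemma mat_mult_nth [simp]: "(mat c ** A) $ i $ j = c * (A $ i $ j :: 'a::field)"
  by (simp add: matrix_matrix_mult_def mat_def if_distrib[of "\<lambda>z. z * _"] sum.delta cong: if_cong)

text \<open>The scalars relating the images of the basis vectors are determined up to a common factor by the
  image of \<open>(1, 1, 1)\<close>, through Cramer's rule.\<close>

lemma one_parameter_projectively_rational:
  fixes K :: "qbar \<Rightarrow> qbar ^ 3 ^ 3"
  assumes det: "\<And>t. det (K t) = 1"
    and rat: "\<And>x. x \<noteq> 0 \<Longrightarrow> \<exists>q f. q \<noteq> 0 \<and> (\<forall>t. poly q t \<noteq> 0 \<longrightarrow> (\<chi> i. poly (f i) t) \<noteq> 0 \<and>
      vec.span {K t *v x} = vec.span {\<chi> i. poly (f i) t})"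
  obtains r C where "r \<noteq> 0" "\<And>t. poly r t \<noteq> 0 \<Longrightarrow> \<exists>c. c \<noteq> 0 \<and> poly_matrix C t = mat c ** K t"
proof -
  have rat': "\<exists>q f. q \<noteq> 0 \<and> (\<forall>t. poly q t \<noteq> 0 \<longrightarrow>
      (\<exists>c. c \<noteq> 0 \<and> K t *v x = c *s (\<chi> i. poly (f i) t)))" if x: "x \<noteq> 0" for x
  proof -
    obtain q f where q: "q \<noteq> 0" and f: "\<And>t. poly q t \<noteq> 0 \<Longrightarrow> (\<chi> i. poly (f i) t) \<noteq> 0 \<and>
      vec.span {K t *v x} = vec.span {\<chi> i. poly (f i) t}" using rat[OF x] by blast
    have "\<exists>c. c \<noteq> 0 \<and> K t *v x = c *s (\<chi> i. poly (f i) t)" if "poly q t \<noteq> 0" for t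
      using f[OF that] span_singleton_eq_iff[of "\<chi> i. poly (f i) t" "K t *v x"]
        det_1_nonzero[OF det x] by simp
    with q show ?thesis by blast
  qed
  define u :: "qbar ^ 3" where "u = (\<chi> i. 1)"
  have "u \<noteq> 0" by (simp add: u_def vec_eq_iff)
  then obtain q0 g where q0: "q0 \<noteq> 0"
    and g: "\<And>t. poly q0 t \<noteq> 0 \<Longrightarrow> \<exists>c. c \<noteq> 0 \<and> K t *v u = c *s (\<chi> i. poly (g i) t)"
    using rat' by blast
  have "\<forall>j. \<exists>q f. q \<noteq> 0 \<and> (\<forall>t. poly q t \<noteq> 0 \<longrightarrow>
      (\<exists>c. c \<noteq> 0 \<and> K t *v axis j 1 = c *s (\<chi> i. poly (f i) t)))"
    using rat' by (simp add: axis_eq_0_iff)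
  then obtain q f where q: "\<And>j. q j \<noteq> 0"
    and f: "\<And>j t. poly (q j) t \<noteq> 0 \<Longrightarrow> \<exists>c. c \<noteq> 0 \<and> K t *v axis j 1 = c *s (\<chi> i. poly (f j i) t)"
    by metis
  \<comment> \<open>Cramer numerators: the sum of the columns \<open>f j\<close> with factors
    \<open>d j\<close> is \<open>c\<close> times \<open>g\<close>, so replacing column
    \<open>k\<close> by \<open>g\<close> multiplies the determinant by \<open>d k / c\<close>. Up to
    a common factor the \<open>m k\<close> are the unknown scalars.\<close>
  define m where "m k = det (\<chi> i j. if j = k then g i else f j i :: qbar poly ^ 3 ^ 3)" for k
  define C where "C = (\<chi> i j. m j * f j i)"
  show thesis
  proof
    show "q0 * (\<Prod>j\<in>UNIV. q j) \<noteq> 0" using q0 q by simp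
    fix t assume "poly (q0 * (\<Prod>j\<in>UNIV. q j)) t \<noteq> 0"
    then have nz: "poly q0 t \<noteq> 0" "\<And>j. poly (q j) t \<noteq> 0" by (auto simp: poly_prod)
    obtain c where c: "c \<noteq> 0" "K t *v u = c *s (\<chi> i. poly (g i) t)" using g[OF nz(1)] by blast
    have "\<forall>j. \<exists>c. c \<noteq> 0 \<and> K t *v axis j 1 = c *s (\<chi> i. poly (f j i) t)" using f[OF nz(2)] by blast
    then obtain d where d: "\<And>j. d j \<noteq> 0" "\<And>j. K t *v axis j 1 = d j *s (\<chi> i. poly (f j i) t)"
      by metis
    define F where "F = (\<chi> i j. poly (f j i) t)"
    have K: "K t $ i $ j = d j * F $ i $ j" for i j
    proof -
      have "(K t *v axis j 1) $ i = K t $ i $ j"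
        by (simp add: matrix_vector_mult_def axis_def if_distrib cong: if_cong)
      with d(2)[of j] show ?thesis by (simp add: F_def)
    qed
    then have "K t = F ** (\<chi> i j. if i = j then d i else 0)"
      by (simp add: vec_eq_iff matrix_matrix_mult_def if_distrib[of "\<lambda>z. _ * z"] sum.delta cong: if_cong)
    then have F: "det F \<noteq> 0" using det[of t] by (auto simp: det_mul)
    have Fg: "F *v (\<chi> j. d j / c) = (\<chi> i. poly (g i) t)"
    proof -
      have "(K t *v u) $ i = c * (F *v (\<chi> j. d j / c)) $ i" for i
        using c(1) by (simp add: u_def matrix_vector_mult_def K sum_distrib_left mult.commute)
      then show ?thesis using c by (simp add: vec_eq_iff)
    qed
    have "poly (m k) t = d k / c * det F" for k
    proof -
      have "poly (m k) t = det (\<chi> i j. if j = k then (F *v (\<chi> j. d j / c)) $ i else F $ i $ j)"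
        unfolding m_def det_poly_matrix_3[symmetric] Fg
        by (rule arg_cong[of _ _ det]) (simp add: vec_eq_iff F_def)
      then show ?thesis by (simp add: cramer_lemma)
    qed
    then have "poly_matrix C t = mat (det F / c) ** K t"
      using c(1) by (simp add: vec_eq_iff C_def K F_def)
    with c(1) F show "\<exists>c. c \<noteq> 0 \<and> poly_matrix C t = mat c ** K t"
      by (intro exI[of _ "det F / c"]) simp
  qed
qed

text \<open>The cube of a lift is insensitive to the choice of a cube root of unity, so after normalizing
  the determinant it depends rationally on the parameter.\<close>

lemma one_parameter_rational:
  fixes K :: "qbar \<Rightarrow> qbar ^ 3 ^ 3"
  assumes det: "\<And>t. det (K t) = 1" and add: "\<And>s t. K (s + t) = K s ** K t"
    and rat: "\<And>x. x \<noteq> 0 \<Longrightarrow> \<exists>q f. q \<noteq> 0 \<and> (\<forall>t. poly q t \<noteq> 0 \<longrightarrow> (\<chi> i. poly (f i) t) \<noteq> 0 \<and>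
      vec.span {K t *v x} = vec.span {\<chi> i. poly (f i) t})"
  obtains q r Q where "q \<noteq> 0" "r \<noteq> 0" "\<And>t. poly r t \<noteq> 0 \<Longrightarrow> mat (poly q t) ** K t = poly_matrix Q t"
proof -
  obtain r C where r: "r \<noteq> 0"
    and C: "\<And>t. poly r t \<noteq> 0 \<Longrightarrow> \<exists>c. c \<noteq> 0 \<and> poly_matrix C t = mat c ** K t"
    by (rule one_parameter_projectively_rational[OF det rat], assumption) (rule that)
  \<comment> \<open>The determinant is \<open>c ^ 3\<close>, and the cube of the matrix is
    \<open>c ^ 3\<close> times \<open>K (3 * t)\<close>, so the unknown scalar drops out.\<close>
  have *: "poly (det C) t \<noteq> 0 \<and> mat (poly (det C) t) ** K (3 * t) = poly_matrix (C ** C ** C) t"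
    if t: "poly r t \<noteq> 0" for t
  proof -
    obtain c where c: "c \<noteq> 0" "poly_matrix C t = mat c ** K t" using C[OF t] by blast
    have d: "poly (det C) t = c ^ 3"
      unfolding det_poly_matrix_3[symmetric] c(2) by (simp add: det_mul det det_mat_3)
    have m: "K t ** (mat c ** Z) = mat c ** (K t ** Z)" for Z :: "qbar ^ 3 ^ 3"
      by (metis mat_commute matrix_mul_assoc)
    have "3 * t = t + t + t" by simp
    then have "K (3 * t) = K t ** K t ** K t" by (simp only: add)
    moreover have "poly_matrix (C ** C ** C) t = mat c ** (mat c ** (mat c ** (K t ** (K t ** K t))))"
      by (simp add: poly_matrix_mult c(2) m flip: matrix_mul_assoc)
    ultimately have "mat (poly (det C) t) ** K (3 * t) = poly_matrix (C ** C ** C) t"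
      by (simp add: d matrix_mul_assoc mat_mult_mat power3_eq_cube mult.assoc)
    with c d show ?thesis by simp
  qed
  have "\<exists>t. poly r t \<noteq> 0" using r poly_all_0_iff_0 by blast
  then have dC: "det C \<noteq> 0" using * by auto
  \<comment> \<open>Substitutes \<open>t / 3\<close> for \<open>t\<close>, since the relation
    obtained concerns \<open>K (3 * t)\<close>.\<close>
  let ?s = "\<lambda>p. pcompose p [:0, 1 / 3:]"
  have s: "?s p \<noteq> 0" if "p \<noteq> 0" for p :: "qbar poly"
    using that by (simp add: pcompose_eq_0_iff)
  show thesis
  proof
    show "?s (det C) \<noteq> 0" "?s r \<noteq> 0" using s dC r by auto
    fix t assume "poly (?s r) t \<noteq> 0"
    then have "poly r (t / 3) \<noteq> 0" by (simp add: poly_pcompose)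
    from *[OF this] show "mat (poly (?s (det C)) t) ** K t =
        poly_matrix (\<chi> i j. ?s ((C ** C ** C) $ i $ j)) t"
      by (simp add: poly_pcompose vec_eq_iff)
  qed
qed

lemma coprime_if_no_common_root:
  fixes p q :: "qbar poly"
  assumes "q \<noteq> 0" "\<And>x. poly p x = 0 \<Longrightarrow> poly q x \<noteq> 0"
  shows "coprime p q"
proof (rule coprimeI)
  fix c assume c: "c dvd p" "c dvd q"
  have "degree c = 0"
  proof (rule ccontr)
    assume "degree c \<noteq> 0"
    then obtain x where "poly c x = 0" using alg_closed_imp_poly_has_root[of c] by blast
    then have "poly p x = 0" "poly q x = 0" using c by (auto elim!: dvdE)
    with assms show False by blast
  qed
  then obtain e where e: "c = [:e:]" by (rule degree_eq_zeroE)
  then have "e \<noteq> 0" using c assms(1) by auto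
  then show "is_unit c" by (simp add: e is_unit_const_poly_iff dvd_field_iff)
qed

text \<open>The differences of zeros form a finite set, which cannot exhaust the field.\<close>

lemma exists_good_shift:
  fixes q :: "qbar poly"
  assumes "q \<noteq> 0"
  obtains s where "\<And>x. poly q x = 0 \<Longrightarrow> poly q (x - s) \<noteq> 0"
proof -
  let ?Z = "{x. poly q x = 0}"
  have "finite ((\<lambda>(x, y). x - y) ` (?Z \<times> ?Z))" using poly_roots_finite[OF assms] by blast
  then obtain s where s: "s \<notin> (\<lambda>(x, y). x - y) ` (?Z \<times> ?Z)"
    using infinite_UNIV_char_0[where 'a = qbar] ex_new_if_finite by blast
  show thesis
  proof
    fix x assume "poly q x = 0"
    then show "poly q (x - s) \<noteq> 0"
      using s image_eqI[of s "\<lambda>(x, y). x - y" "(x, x - s)" "?Z \<times> ?Z"] by auto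
  qed
qed

text \<open>A pole of \<open>K\<close> at \<open>t\<close> would, by \<open>K t = K (t - s) ** K s\<close>, be a pole at \<open>t - s\<close> for every \<open>s\<close>.\<close>

lemma one_parameter_polynomial:
  fixes K :: "qbar \<Rightarrow> qbar ^ 3 ^ 3"
  assumes add: "\<And>s t. K (s + t) = K s ** K t"
    and q: "q \<noteq> 0" and r: "r \<noteq> 0"
    and Q: "\<And>t. poly r t \<noteq> 0 \<Longrightarrow> mat (poly q t) ** K t = poly_matrix Q t"
  obtains P where "\<And>t. K t = poly_matrix P t"
proof -
  obtain s where s: "\<And>x. poly q x = 0 \<Longrightarrow> poly q (x - s) \<noteq> 0" by (rule exists_good_shift[OF q]) (rule that)
  let ?s = "\<lambda>p. pcompose p [:- s, 1:]"
  have nz: "?s p \<noteq> 0" if "p \<noteq> 0" for p :: "qbar poly"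
    using that by (simp add: pcompose_eq_0_iff)
  \<comment> \<open>By the choice of \<open>s\<close>, the polynomial \<open>q\<close> and its
    translate have no common zero.\<close>
  have cop: "coprime q (?s q)"
    by (rule coprime_if_no_common_root) (use nz q s in \<open>auto simp: poly_pcompose\<close>)
  have "q dvd Q $ i $ j" for i j
  proof -
    \<comment> \<open>The relation \<open>K t = K (t - s) ** K s\<close> with denominators cleared;
      \<open>q\<close> is a factor of the right side.\<close>
    have "?s q * (Q $ i $ j) = q * (\<Sum>l\<in>UNIV. smult (K s $ l $ j) (?s (Q $ i $ l)))"
    proof (rule poly_eqI_cofinite[of "r * ?s r"])
      show "r * ?s r \<noteq> 0" using nz r by simp
      fix t assume "poly (r * ?s r) t \<noteq> 0"
      then have 1: "poly r t \<noteq> 0" "poly r (t - s) \<noteq> 0" by (auto simp: poly_pcompose)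
      have "K t = K (t - s) ** K s" using add[of "t - s" s] by simp
      then have "poly (Q $ i $ j) t = poly q t * (\<Sum>l\<in>UNIV. K (t - s) $ i $ l * K s $ l $ j)"
        using Q[OF 1(1)] by (simp add: vec_eq_iff matrix_matrix_mult_def[of "K (t - s)"])
      moreover have "poly (Q $ i $ l) (t - s) = poly q (t - s) * K (t - s) $ i $ l" for l
        using Q[OF 1(2)] by (simp add: vec_eq_iff)
      ultimately show "poly (?s q * (Q $ i $ j)) t =
          poly (q * (\<Sum>l\<in>UNIV. smult (K s $ l $ j) (?s (Q $ i $ l)))) t"
        by (simp add: poly_pcompose poly_sum sum_distrib_left mult_ac)
    qed
    then have "q dvd ?s q * (Q $ i $ j)" by simp
    with cop show ?thesis by (simp add: coprime_dvd_mult_right_iff)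
  qed
  then have "\<forall>i j. \<exists>p. Q $ i $ j = q * p" unfolding dvd_def by blast
  then obtain p where p: "\<And>i j. Q $ i $ j = q * p i j" by metis
  define P where "P = (\<chi> i j. p i j)"
  define b where "b = q * r"
  have b: "b \<noteq> 0" using q r by (simp add: b_def)
  have KP: "K t = poly_matrix P t" if "poly b t \<noteq> 0" for t
    using Q[of t] that by (simp add: vec_eq_iff p P_def b_def)
  \<comment> \<open>The group law for \<open>P\<close> holds even when \<open>t\<close> is a zero of
    \<open>b\<close>. It gives \<open>K = P\<close> at a bad argument, written as a sum of two good
    ones.\<close>
  have PP: "poly_matrix P (s + t) = poly_matrix P s ** poly_matrix P t" if "poly b s \<noteq> 0" for s t
  proof -
    have "pcompose (P $ i $ j) [:s, 1:] = (\<Sum>l\<in>UNIV. smult (poly (P $ i $ l) s) (P $ l $ j))" for i j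
    proof (rule poly_eqI_cofinite[of "b * pcompose b [:s, 1:]"])
      show "b * pcompose b [:s, 1:] \<noteq> 0" using b by (simp add: pcompose_eq_0_iff)
      fix t assume t: "poly (b * pcompose b [:s, 1:]) t \<noteq> 0"
      then have "poly_matrix P (s + t) = poly_matrix P s ** poly_matrix P t"
        using add[of s t] KP[OF that] KP[of t] KP[of "s + t"] by (simp add: poly_pcompose)
      then show "poly (pcompose (P $ i $ j) [:s, 1:]) t =
          poly (\<Sum>l\<in>UNIV. smult (poly (P $ i $ l) s) (P $ l $ j)) t"
        by (simp add: vec_eq_iff matrix_matrix_mult_def poly_pcompose poly_sum)
    qed
    from arg_cong[OF this, of "\<lambda>p. poly p t"] show ?thesis
      by (simp add: vec_eq_iff matrix_matrix_mult_def poly_pcompose poly_sum)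
  qed
  show thesis
  proof
    fix t
    have "b * pcompose b [:t, - 1:] \<noteq> 0" using b by (simp add: pcompose_eq_0_iff)
    then obtain s where "poly (b * pcompose b [:t, - 1:]) s \<noteq> 0" using poly_all_0_iff_0 by blast
    then have s: "poly b s \<noteq> 0" "poly b (t - s) \<noteq> 0" by (auto simp: poly_pcompose)
    show "K t = poly_matrix P t"
      using add[of s "t - s"] PP[OF s(1), of "t - s"] KP[OF s(1)] KP[OF s(2)] by simp
  qed
qed

text \<open>The exponential series of \<open>t\<close> times \<open>N\<close>, complete as soon as
  the cube of \<open>N\<close> is zero.\<close>

definition exp_nilpotent :: "qbar ^ 3 ^ 3 \<Rightarrow> qbar \<Rightarrow> qbar ^ 3 ^ 3" where
  "exp_nilpotent N t = mat 1 + mat t ** N + mat (t\<^sup>2 / 2) ** (N ** N)"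

text \<open>Differentiating the group law at 0 gives the formal differential equation P' = P N,
  where \<open>N\<close> is the linear coefficient of \<open>P\<close>. Hence \<open>fact n\<close>
  times the n-th coefficient is the n-th power of \<open>N\<close>, which is zero beyond the degrees
  of the entries.\<close>

lemma one_parameter_exp:
  fixes K :: "qbar \<Rightarrow> qbar ^ 3 ^ 3"
  assumes add: "\<And>s t. K (s + t) = K s ** K t" and K0: "K 0 = mat 1"
    and P: "\<And>t. K t = poly_matrix P t"
  obtains N where "N ** N ** N = 0" "\<And>t. K t = exp_nilpotent N t"
proof -
  define C where "C n = (\<chi> i j. coeff (P $ i $ j) n)" for n
  define N where "N = C 1"
  have der: "pderiv (P $ i $ j) = (\<Sum>l\<in>UNIV. smult (N $ l $ j) (P $ i $ l))" for i j
  proof -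
    have "poly (pderiv (P $ i $ j)) s = poly (\<Sum>l\<in>UNIV. smult (N $ l $ j) (P $ i $ l)) s" for s
    proof -
      have "pcompose (P $ i $ j) [:s, 1:] = (\<Sum>l\<in>UNIV. smult (poly (P $ i $ l) s) (P $ l $ j))"
      proof (rule poly_eqI_cofinite[of 1])
        fix t show "poly (pcompose (P $ i $ j) [:s, 1:]) t =
            poly (\<Sum>l\<in>UNIV. smult (poly (P $ i $ l) s) (P $ l $ j)) t"
          using add[of s t] by (simp add: P vec_eq_iff matrix_matrix_mult_def poly_pcompose poly_sum)
      qed simp
      then have "poly (pderiv (pcompose (P $ i $ j) [:s, 1:])) 0 =
          poly (pderiv (\<Sum>l\<in>UNIV. smult (poly (P $ i $ l) s) (P $ l $ j))) 0" by simp
      moreover have "poly (pderiv (P $ l $ j)) 0 = N $ l $ j" for l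
        by (simp add: poly_0_coeff_0 coeff_pderiv N_def C_def)
      ultimately show ?thesis
        by (simp add: sum_3 pderiv_pcompose poly_pcompose pderiv_add pderiv_smult pderiv_pCons mult.commute)
    qed
    then show ?thesis using poly_eq_poly_eq_iff by blast
  qed
  have rec: "mat (of_nat (Suc n)) ** C (Suc n) = C n ** N" for n
  proof -
    have "of_nat (Suc n) * coeff (P $ i $ j) (Suc n) = (\<Sum>l\<in>UNIV. coeff (P $ i $ l) n * N $ l $ j)" for i j
      using arg_cong[OF der[of i j], of "\<lambda>p. coeff p n"]
      by (simp add: coeff_pderiv coeff_sum mult.commute)
    then show ?thesis by (simp add: vec_eq_iff C_def matrix_matrix_mult_def[of _ N])
  qed
  have C0: "C 0 = mat 1"
    using P[of 0] K0 by (simp add: vec_eq_iff C_def poly_0_coeff_0)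
  have pow: "(mat (fact n) ** C n) *v x = ((*v) N ^^ n) x" for n x
  proof (induction n arbitrary: x)
    case 0
    then show ?case by (simp add: C0 flip: matrix_vector_mul_assoc)
  next
    case (Suc n)
    have "mat (fact (Suc n)) ** C (Suc n) = mat (fact n) ** (mat (of_nat (Suc n)) ** C (Suc n))"
      by (simp add: matrix_mul_assoc mat_mult_mat mult.commute)
    also have "\<dots> = (mat (fact n) ** C n) ** N" unfolding rec by (simp only: matrix_mul_assoc)
    finally have "(mat (fact (Suc n)) ** C (Suc n)) *v x = (mat (fact n) ** C n) *v (N *v x)"
      by (simp add: matrix_vector_mul_assoc)
    then show ?case by (simp add: Suc.IH funpow_swap1)
  qed
  have N3: "N ** N ** N = 0"
  proof (rule nilpotent_cube_eq_0)
    define d where "d = Suc (\<Sum>i\<in>UNIV. \<Sum>j\<in>UNIV. degree (P $ i $ j))"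
    have "C d = 0"
    proof -
      have "degree (P $ i $ j) < d" for i j
        using member_le_sum[of j UNIV "\<lambda>j. degree (P $ i $ j)"]
          member_le_sum[of i UNIV "\<lambda>i. \<Sum>j\<in>UNIV. degree (P $ i $ j)"]
        by (simp add: d_def)
      then show ?thesis by (simp add: vec_eq_iff C_def coeff_eq_0)
    qed
    then show "((*v) N ^^ d) x = 0" for x using pow[of d x] by (simp add: vec_eq_iff matrix_vector_mult_def)
  qed
  show thesis
  proof
    show "N ** N ** N = 0" by (fact N3)
    fix t
    have C2: "C 2 = mat (1 / 2) ** (N ** N)"
    proof -
      have "mat 2 ** C 2 = N ** N" using rec[of 1] by (simp add: N_def numeral_2_eq_2)
      then have "2 * C 2 $ i $ j = (N ** N) $ i $ j" for i j by (metis mat_mult_nth)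
      then show ?thesis by (simp add: vec_eq_iff mult.commute flip: mult_2)
    qed
    have C3: "C n = 0" if "n \<ge> 3" for n
    proof -
      have k: "n = (n - 3) + 3" using that by simp
      have N3x: "((*v) N ^^ 3) x = 0" for x
        using N3 by (simp add: eval_nat_numeral matrix_vector_mul_assoc matrix_mul_assoc)
      have "((*v) N ^^ k) 0 = 0" for k by (induction k) auto
      then have "((*v) N ^^ n) x = 0" for x
        by (subst k) (simp only: funpow_add comp_apply N3x)
      then have "mat (fact n) ** C n = 0" by (intro matrix_eqI_vec) (simp only: pow matrix_vector_mult_0)
      moreover have "fact n * C n $ i $ j = (mat (fact n) ** C n) $ i $ j" for i j by simp
      ultimately have "fact n * C n $ i $ j = 0" for i j by (simp only: zero_index)
      then show ?thesis by (simp add: vec_eq_iff)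
    qed
    have "P $ i $ j = [:C 0 $ i $ j, C 1 $ i $ j, C 2 $ i $ j:]" for i j
    proof (rule poly_eqI)
      fix n
      show "coeff (P $ i $ j) n = coeff [:C 0 $ i $ j, C 1 $ i $ j, C 2 $ i $ j:] n"
      proof (cases "n \<ge> 3")
        case True
        then have "C n $ i $ j = 0" by (simp add: C3)
        with True show ?thesis by (auto simp: coeff_eq_0 C_def)
      next
        case False
        then have "n = 0 \<or> n = 1 \<or> n = 2" by auto
        then show ?thesis by (auto simp: C_def numeral_2_eq_2)
      qed
    qed
    then show "K t = exp_nilpotent N t"
      by (simp add: P exp_nilpotent_def vec_eq_iff C0 C2) (simp add: N_def power2_eq_square algebra_simps)
  qed
qed

section \<open>Classification of the actions\<close>

text \<open>Compares linear terms: a truncated exponential is quadratic in its parameter, a product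
  of two is quartic.\<close>

lemma quartic_odd_part:
  fixes c x y z c2 c3 c4 z2 :: qbar
  assumes "\<And>t. c + t * z + t\<^sup>2 * z2 = c + t * (x + y) + t\<^sup>2 * c2 + t ^ 3 * c3 + t ^ 4 * c4"
  shows "z = x + y"
proof -
  have "[:c, z, z2, 0, 0:] = [:c, x + y, c2, c3, c4:]"
  proof (rule poly_eqI_cofinite[of 1])
    show "poly [:c, z, z2, 0, 0:] t = poly [:c, x + y, c2, c3, c4:] t" for t
      using assms[of t] by (simp add: algebra_simps power2_eq_square power3_eq_cube power4_eq_xxxx)
  qed simp
  then show ?thesis by simp
qed

section \<open>Products and logarithms of truncated exponentials\<close>

lemma matrix_distribs:
  fixes A B C :: "'a::field ^ 'n ^ 'n"
  shows matrix_add_rdistrib: "(A + B) ** C = A ** C + B ** C"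
    and matrix_diff_rdistrib: "(A - B) ** C = A ** C - B ** C"
    and matrix_diff_ldistrib: "A ** (B - C) = A ** B - A ** C"
  by (simp_all add: vec_eq_iff matrix_matrix_mult_def distrib_right left_diff_distrib
      right_diff_distrib sum.distrib sum_subtractf)

lemma mat_mult_mat_mult:
  "(mat a ** A) ** (mat b ** B) = mat (a * b) ** (A ** (B :: 'a::field ^ 'n ^ 'n))"
  by (metis mat_commute mat_mult_mat matrix_mul_assoc)

lemma quadratic_matrix_mult:
  fixes A B A' B' :: "'a::field ^ 'n ^ 'n"
  shows "(mat 1 + mat t ** A + mat s ** A') ** (mat 1 + mat t ** B + mat s ** B') =
    mat 1 + mat t ** (A + B) + mat (t * t) ** (A ** B) + mat s ** (A' + B') +
    mat (t * s) ** (A ** B' + A' ** B) + mat (s * s) ** (A' ** B')"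
  unfolding matrix_add_ldistrib matrix_add_rdistrib mat_mult_mat_mult
  by (simp add: mult.commute[of s t])

lemma quartic_expansion:
  "c + t * x + t * t * p + t\<^sup>2 / 2 * q + t * (t\<^sup>2 / 2) * r + t\<^sup>2 / 2 * (t\<^sup>2 / 2) * u =
    c + t * x + t\<^sup>2 * (p + q / 2) + t ^ 3 * (r / 2) + t ^ 4 * (u / 4)" for t :: "'a::field_char_0"
  by (simp add: field_simps power2_eq_square power3_eq_cube power4_eq_xxxx)

lemma exp_nilpotent_inject:
  assumes "\<And>t. exp_nilpotent A t = exp_nilpotent B t"
  shows "A = B"
proof -
  have "A $ i $ j = B $ i $ j" for i j
    using quartic_odd_part[of "mat 1 $ i $ j" "A $ i $ j" "1 / 2 * (A ** A) $ i $ j" "B $ i $ j" 0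
        "1 / 2 * (B ** B) $ i $ j" 0 0] assms
    by (simp add: exp_nilpotent_def vec_eq_iff)
  then show ?thesis by (simp add: vec_eq_iff)
qed

lemma exp_nilpotent_additive:
  assumes "\<And>t. exp_nilpotent C t = exp_nilpotent A t ** exp_nilpotent B t"
  shows "C = A + B"
proof -
  have "C $ i $ j = A $ i $ j + B $ i $ j" for i j
  proof (rule quartic_odd_part)
    fix t
    have e: "mat 1 + mat t ** C + mat (t\<^sup>2 / 2) ** (C ** C) =
      mat 1 + mat t ** (A + B) + mat (t * t) ** (A ** B) + mat (t\<^sup>2 / 2) ** (A ** A + B ** B) +
      mat (t * (t\<^sup>2 / 2)) ** (A ** (B ** B) + (A ** A) ** B) +
      mat (t\<^sup>2 / 2 * (t\<^sup>2 / 2)) ** ((A ** A) ** (B ** B))"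
      using assms[of t] unfolding exp_nilpotent_def quadratic_matrix_mult .
    have "mat 1 $ i $ j + t * C $ i $ j + t\<^sup>2 / 2 * (C ** C) $ i $ j =
      mat 1 $ i $ j + t * (A $ i $ j + B $ i $ j) + t * t * (A ** B) $ i $ j +
      t\<^sup>2 / 2 * ((A ** A) $ i $ j + (B ** B) $ i $ j) +
      t * (t\<^sup>2 / 2) * ((A ** (B ** B)) $ i $ j + ((A ** A) ** B) $ i $ j) +
      t\<^sup>2 / 2 * (t\<^sup>2 / 2) * ((A ** A) ** (B ** B)) $ i $ j"
      using arg_cong[OF e, of "\<lambda>Z. Z $ i $ j"]
      unfolding vector_add_component mat_mult_nth .
    then show "mat 1 $ i $ j + t * C $ i $ j + t\<^sup>2 * (1 / 2 * (C ** C) $ i $ j) =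
      mat 1 $ i $ j + t * (A $ i $ j + B $ i $ j) +
      t\<^sup>2 * ((A ** B) $ i $ j + ((A ** A) $ i $ j + (B ** B) $ i $ j) / 2) +
      t ^ 3 * (((A ** (B ** B)) $ i $ j + ((A ** A) ** B) $ i $ j) / 2) +
      t ^ 4 * (((A ** A) ** (B ** B)) $ i $ j / 4)"
      unfolding quartic_expansion by (simp only: times_divide_eq_left times_divide_eq_right mult_1_left)
  qed
  then show ?thesis by (simp add: vec_eq_iff)
qed

text \<open>Here \<open>d\<close>, \<open>n\<close>, \<open>s\<close> stand for entries of the
  identity, of \<open>N\<close> and of its square. The constants come from the truncated logarithm
  (E - 1) - (E - 1)^2 / 2 = 2 E - E^2 / 2 - 3 / 2.\<close>

lemma log_exp_coefficients:
  "n = 2 * (d + n + s / 2) - 1 / 2 * (d + 2 * n + 2 * s) - 3 / 2 * d" for n d s :: "'a::field_char_0"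
  by (simp add: field_simps)

text \<open>Writes \<open>N\<close> as a linear combination of group elements and the identity, so
  that commutation of group elements passes to \<open>N\<close>.\<close>

lemma exp_nilpotent_log:
  "N = mat 2 ** exp_nilpotent N 1 - mat (1 / 2) ** exp_nilpotent (mat 2 ** N) 1 - mat (3 / 2) ** mat 1"
proof -
  have "N $ i $ j = (mat 2 ** exp_nilpotent N 1 - mat (1 / 2) ** exp_nilpotent (mat 2 ** N) 1 - mat (3 / 2) ** mat 1) $ i $ j" for i j
    unfolding exp_nilpotent_def mat_mult_mat_mult
    by (rule trans[OF log_exp_coefficients[of _ "mat 1 $ i $ j" "(N ** N) $ i $ j"]])
      (simp add: mult_ac del: matrix_mul_rid)
  then show ?thesis by (simp add: vec_eq_iff)
qed

text \<open>\<open>N\<close> is found on each line of the group separately. Its additivity is read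
  off the linear terms of the group law, its homogeneity off a change of parameter.\<close>

lemma ga_structure_exp:
  fixes \<phi> :: "qbar ^ 'n::finite \<Rightarrow> (qbar ^ 3) set \<Rightarrow> (qbar ^ 3) set"
  assumes \<phi>: "ga_structure \<phi>"
  obtains N where "\<And>a x. x \<noteq> 0 \<Longrightarrow> \<phi> a (vec.span {x}) = vec.span {exp_nilpotent (N a) 1 *v x}"
    "\<And>a. N a ** N a ** N a = 0" "\<And>a b. N (a + b) = N a + N b" "\<And>t a. N (t *s a) = mat t ** N a"
    "\<And>a b. exp_nilpotent (N a) 1 ** N b = N b ** exp_nilpotent (N a) 1"
proof -
  obtain M where M: "\<And>a. unimodular_lift (\<phi> a) (M a)" and add: "\<And>a b. M (a + b) = M a ** M b"
    by (rule ga_structure_lift[OF \<phi>]) (rule that)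
  have det: "det (M a) = 1" and lift: "x \<noteq> 0 \<Longrightarrow> \<phi> a (vec.span {x}) = vec.span {M a *v x}" for a x
    using M[of a] by (auto simp: unimodular_lift_def)
  have ex: "\<exists>N. N ** N ** N = 0 \<and> (\<forall>t. M (t *s a) = exp_nilpotent N t)" for a
  proof -
    define K where "K t = M (t *s a)" for t
    have Kdet: "det (K t) = 1" for t by (simp add: K_def det)
    have Kadd: "K (s + t) = K s ** K t" for s t
      by (simp add: K_def vec.scale_left_distrib add)
    have K0: "K 0 = mat 1"
    proof -
      \<comment> \<open>An invertible idempotent is the identity.\<close>
      have "K 0 ** K 0 = K 0" using Kadd[of 0 0] by simp
      moreover obtain B where "B ** K 0 = mat 1"
        using Kdet[of 0] by (metis invertible_det_nz invertible_left_inverse zero_neq_one)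
      ultimately show ?thesis by (metis matrix_mul_assoc matrix_mul_lid)
    qed
    have rat: "\<exists>q f. q \<noteq> 0 \<and> (\<forall>t. poly q t \<noteq> 0 \<longrightarrow> (\<chi> i. poly (f i) t) \<noteq> 0 \<and>
      vec.span {K t *v x} = vec.span {\<chi> i. poly (f i) t})" if "x \<noteq> 0" for x
      by (rule ga_structure_line_rational[OF \<phi> that, of a]) (use lift[OF that] in \<open>auto simp: K_def\<close>)
    obtain q r Q where q: "q \<noteq> 0" "r \<noteq> 0"
      and Q: "\<And>t. poly r t \<noteq> 0 \<Longrightarrow> mat (poly q t) ** K t = poly_matrix Q t"
      by (rule one_parameter_rational[OF Kdet Kadd rat], assumption) (rule that)
    obtain P where P: "\<And>t. K t = poly_matrix P t"
      by (rule one_parameter_polynomial[OF Kadd q Q], assumption) (rule that)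
    show ?thesis
      by (rule one_parameter_exp[OF Kadd K0 P]) (auto simp: K_def)
  qed
  then obtain N where N3: "\<And>a. N a ** N a ** N a = 0"
    and N: "\<And>a t. M (t *s a) = exp_nilpotent (N a) t" by metis
  have M1: "M a = exp_nilpotent (N a) 1" for a using N[of 1 a] by simp
  have Mc: "M a ** M b = M b ** M a" for a b by (metis add add.commute)
  have Nadd: "N (a + b) = N a + N b" for a b
    by (rule exp_nilpotent_additive) (simp add: N[symmetric] vec.scale_right_distrib add)
  have Nscale: "N (t *s a) = mat t ** N a" for t a
  proof (rule exp_nilpotent_inject)
    fix s
    have "exp_nilpotent (N (t *s a)) s = exp_nilpotent (N a) (s * t)" by (simp add: N[symmetric])
    also have "\<dots> = exp_nilpotent (mat t ** N a) s"
      unfolding exp_nilpotent_def mat_mult_mat_mult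
      by (simp add: vec_eq_iff power2_eq_square mult_ac)
    finally show "exp_nilpotent (N (t *s a)) s = exp_nilpotent (mat t ** N a) s" .
  qed
  have log: "N b = mat 2 ** M b - mat (1 / 2) ** M (2 *s b) - mat (3 / 2) ** mat 1" for b
    unfolding M1 Nscale by (rule exp_nilpotent_log)
  have comm: "M a ** N b = N b ** M a" for a b
  proof -
    have *: "M a ** (mat c ** Z) = mat c ** (M a ** Z)" for c Z by (metis mat_commute matrix_mul_assoc)
    show ?thesis
      unfolding log matrix_diff_ldistrib matrix_diff_rdistrib * Mc[of a]
      by (simp only: matrix_mul_lid matrix_mul_rid flip: matrix_mul_assoc)
  qed
  show thesis
    by (rule that[of N]) (use lift N3 Nadd Nscale comm in \<open>simp_all add: M1\<close>)
qed

section \<open>Linear maps as automorphisms of the plane and of the group\<close>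

lemma vector_eq_axis_sum:
  fixes a :: "'a::field ^ 2"
  shows "a = a $ 1 *s axis 1 1 + a $ 2 *s axis 2 1"
  by (simp add: vec_eq_iff forall_2 axis_def)

lemma proj_action_span: "proj_action \<tau> a (vec.span {y}) = vec.span {\<tau> a *v y}"
  unfolding proj_action_def vec.span_singleton image_image vector_scalar_commute ..

lemma linear_form_mpoly:
  fixes w :: "'i::finite \<Rightarrow> nat" and c :: "'i \<Rightarrow> qbar"
  assumes "\<And>i. w i = d"
  shows "weight_homogeneous w d (\<Sum>i\<in>UNIV. mconst (c i) * mvar i)"
  by (rule weight_homogeneous_sum)
    (use weight_homogeneous_mult[OF weight_homogeneous_mconst weight_homogeneous_mvar, of w] assms in simp)

lemma morphism_linear_projective:
  fixes A :: "qbar ^ 'k ^ 'k::finite"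
  assumes "invertible A"
  shows "morphism projective_space projective_space (\<lambda>p. (*v) A ` p)"
proof (rule morphism_polynomial[where e = 1 and F = "\<lambda>j. \<Sum>i\<in>UNIV. mconst (A $ j $ i) * mvar i",
      OF graded_presentation_projective])
  have eval: "(\<chi> j. mpoly_eval (\<Sum>i\<in>UNIV. mconst (A $ j $ i) * mvar i) x) = A *v x" for x
    by (simp add: vec_eq_iff mpoly_eval_sum mpoly_eval_mult matrix_vector_mult_def)
  show "weight_homogeneous (weight projective_space) (1 * weight projective_space j)
      (\<Sum>i\<in>UNIV. mconst (A $ j $ i) * mvar i)" for j :: 'k
    by (rule linear_form_mpoly) (simp add: projective_space_def)
  fix x :: "qbar ^ 'k" assume "x \<in> coords projective_space"
  then show "(\<chi> j. mpoly_eval (\<Sum>i\<in>UNIV. mconst (A $ j $ i) * mvar i) x) \<in> coords projective_space"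
    unfolding eval using assms
    by (auto simp: projective_space_def invertible_left_inverse matrix_left_invertible_ker)
  show "(*v) A ` pt projective_space x =
      pt projective_space (\<chi> j. mpoly_eval (\<Sum>i\<in>UNIV. mconst (A $ j $ i) * mvar i) x)"
    unfolding eval projective_space_def
    by (simp add: vec.span_singleton image_image vector_scalar_commute)
qed

lemma isomorphism_linear_projective:
  fixes A :: "qbar ^ 'k ^ 'k::finite"
  assumes "A ** B = mat 1" "B ** A = mat 1"
  shows "isomorphism projective_space projective_space (\<lambda>p. (*v) A ` p)"
proof -
  have "invertible A" "invertible B" using assms unfolding invertible_def by blast+
  then show ?thesis
    unfolding isomorphism_def
    by (intro conjI exI[of _ "\<lambda>p. (*v) B ` p"] morphism_linear_projective)
      (simp_all add: image_image matrix_vector_mul_assoc assms)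
qed

lemma morphism_linear_affine:
  fixes A :: "qbar ^ 'n ^ 'n::finite"
  shows "morphism affine_space affine_space (\<lambda>x. A *v x)"
proof (rule morphism_polynomial[where e = 0 and F = "\<lambda>j. \<Sum>i\<in>UNIV. mconst (A $ j $ i) * mvar i",
      OF graded_presentation_affine])
  show "weight_homogeneous (weight affine_space) (0 * weight affine_space j)
      (\<Sum>i\<in>UNIV. mconst (A $ j $ i) * mvar i)" for j :: 'n
    unfolding mult_zero_left by (rule linear_form_mpoly) (simp add: affine_space_def)
qed (simp_all add: affine_space_def vec_eq_iff mpoly_eval_sum mpoly_eval_mult matrix_vector_mult_def)

lemma ga_automorphism_linear:
  assumes "invertible A"
  shows "ga_automorphism (\<lambda>x. A *v (x :: qbar ^ 'n::finite))"
proof -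
  obtain B where "A ** B = mat 1" "B ** A = mat 1" using assms unfolding invertible_def by blast
  then show ?thesis
    unfolding ga_automorphism_def isomorphism_def
    by (intro conjI exI[of _ "\<lambda>x. B *v x"] morphism_linear_affine)
      (simp_all add: matrix_vector_mul_assoc matrix_vector_right_distrib)
qed

text \<open>The columns of \<open>B\<close> are the basis in which the action takes the form
  \<open>\<tau>\<close>, so the isomorphism of the plane is the inverse \<open>C\<close>.\<close>

lemma ga_equivalent_proj_action:
  fixes \<phi> :: "qbar ^ 'n::finite \<Rightarrow> (qbar ^ 3) set \<Rightarrow> (qbar ^ 3) set"
  assumes \<phi>: "\<And>a x. x \<noteq> 0 \<Longrightarrow> \<phi> a (vec.span {x}) = vec.span {M a *v x}"
    and B: "invertible B" and MB: "\<And>a. M a ** B = B ** \<tau> (A *v a)" and A: "invertible A"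
  shows "ga_equivalent \<phi> (proj_action \<tau>)"
proof -
  obtain C where C: "C ** B = mat 1" "B ** C = mat 1" using B unfolding invertible_def by blast
  have CM: "C *v (M a *v x) = \<tau> (A *v a) *v (C *v x)" for a x
  proof -
    have "C ** M a = C ** (M a ** B) ** C" by (simp add: C flip: matrix_mul_assoc)
    also have "\<dots> = \<tau> (A *v a) ** C" unfolding MB by (simp add: matrix_mul_assoc C)
    finally show ?thesis by (simp add: matrix_vector_mul_assoc)
  qed
  have span: "(*v) C ` vec.span {x} = vec.span {C *v x}" for x
    unfolding vec.span_singleton image_image vector_scalar_commute ..
  show ?thesis
    unfolding ga_equivalent_def
  proof (intro exI conjI allI ballI)
    show "ga_automorphism (\<lambda>x. A *v x)" by (rule ga_automorphism_linear[OF A])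
    show "isomorphism projective_space projective_space (\<lambda>p. (*v) C ` p)"
      by (rule isomorphism_linear_projective[OF C])
    fix a and p :: "(qbar ^ 3) set" assume "p \<in> proj_points"
    then obtain x where x: "p = vec.span {x}" "x \<noteq> 0" by (auto simp: proj_points_eq)
    show "(*v) C ` \<phi> a p = proj_action \<tau> (A *v a) ((*v) C ` p)"
      unfolding x(1) \<phi>[OF x(2)] span proj_action_span CM ..
  qed
qed

lemma ga_structure_free_point:
  fixes \<phi> :: "qbar ^ 'n::finite \<Rightarrow> (qbar ^ 'k::finite) set \<Rightarrow> (qbar ^ 'k) set"
  assumes "ga_structure \<phi>"
  obtains x where "x \<noteq> 0" "\<And>a. \<phi> a (vec.span {x}) = vec.span {x} \<longleftrightarrow> a = 0"
proof -
  have "generically projective_space (\<lambda>p. {a. \<phi> a p = p} = {0})"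
    using assms by (simp add: ga_structure_def)
  then obtain U where U: "openin (zariski projective_space) U" "\<forall>p\<in>U. {a. \<phi> a p = p} = {0}"
    and "U \<noteq> {}" unfolding generically_def by (elim exE conjE) (rule that)
  then obtain p where p: "p \<in> U" by (meson ex_in_conv)
  then have "p \<in> proj_points" using U(1) openin_subset by blast
  then obtain x where x: "p = vec.span {x}" "x \<noteq> 0" by (auto simp: proj_points_eq)
  have "{a. \<phi> a p = p} = {0}" using U(2) p by blast
  then have fixed: "\<phi> a p = p \<longleftrightarrow> a = 0" for a by auto
  show thesis by (rule that[of x]) (use x fixed in auto)
qed

section \<open>Normal forms in an adapted basis\<close>

lemma \<tau>\<^sub>2_mult: "B ** \<tau>\<^sub>2 a = columns3 (column 1 B) (column 2 B)
    (a $ 2 *s column 1 B + a $ 1 *s column 2 B + column 3 B)"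
  by (simp add: vec_eq_iff columns3_def column_def \<tau>\<^sub>2_def matrix_matrix_mult_def sum_3 forall_3 mult.commute)

lemma \<rho>_mult: "B ** \<rho> a = columns3 (column 1 B) (a $ 1 *s column 1 B + column 2 B)
    ((a $ 2 + 1 / 2 * (a $ 1)\<^sup>2) *s column 1 B + a $ 1 *s column 2 B + column 3 B)"
  by (simp add: vec_eq_iff columns3_def column_def \<rho>_def matrix_matrix_mult_def sum_3 forall_3
      distrib_left distrib_right mult_ac)

lemma column_columns3 [simp]:
  "column 1 (columns3 a b c) = a" "column 2 (columns3 a b c) = b" "column 3 (columns3 a b c) = c"
  by (simp_all add: vec_eq_iff column_def columns3_def)

lemma exp_nilpotent_mult_vec:
  "exp_nilpotent N 1 *v x = x + N *v x + (1 / 2) *s (N *v (N *v x))"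
  by (simp add: exp_nilpotent_def matrix_vector_mult_add_rdistrib mat_mult_vec flip: matrix_vector_mul_assoc)

lemma ga_structure_plane_classification:
  fixes \<phi> :: "qbar ^ 2 \<Rightarrow> (qbar ^ 3) set \<Rightarrow> (qbar ^ 3) set"
  assumes "ga_structure \<phi>"
  shows "ga_equivalent \<phi> (proj_action \<tau>\<^sub>2) \<or> ga_equivalent \<phi> (proj_action \<rho>)"
proof -
  obtain N where \<phi>: "\<And>a x. x \<noteq> 0 \<Longrightarrow> \<phi> a (vec.span {x}) = vec.span {exp_nilpotent (N a) 1 *v x}"
    and N3: "\<And>a. N a ** N a ** N a = 0" and Nadd: "\<And>a b. N (a + b) = N a + N b"
    and Nscale: "\<And>t a. N (t *s a) = mat t ** N a"
    and comm: "\<And>a b. exp_nilpotent (N a) 1 ** N b = N b ** exp_nilpotent (N a) 1"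
    by (rule ga_structure_exp[OF assms]) (rule that, assumption+)
  obtain v where v: "v \<noteq> 0" and free: "\<And>a. \<phi> a (vec.span {v}) = vec.span {v} \<longleftrightarrow> a = 0"
    by (rule ga_structure_free_point[OF assms]) (rule that)
  \<comment> \<open>A vector killed by \<open>N a\<close> is fixed by the exponential.\<close>
  have free': "a = 0" if "N a *v v = 0" for a
    using free[of a] \<phi>[OF v, of a] that by (simp add: exp_nilpotent_mult_vec)
  define e1 e2 :: "qbar ^ 2" where "e1 = axis 1 1" and "e2 = axis 2 1"
  have Nv: "N a *v x = a $ 1 *s (N e1 *v x) + a $ 2 *s (N e2 *v x)" for a x
  proof -
    have "a = a $ 1 *s e1 + a $ 2 *s e2" unfolding e1_def e2_def by (rule vector_eq_axis_sum)
    then have "N a = mat (a $ 1) ** N e1 + mat (a $ 2) ** N e2" by (metis Nadd Nscale)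
    then show ?thesis
      by (simp add: matrix_vector_mult_add_rdistrib mat_mult_vec flip: matrix_vector_mul_assoc)
  qed
  have N3v: "N a *v (N a *v (N a *v x)) = 0" for a x
    using N3[of a] by (simp add: matrix_vector_mul_assoc matrix_mul_assoc)
  show ?thesis
  proof (cases "\<forall>a x. N a *v (N a *v x) = 0")
    case True
    then have sq: "N a *v (N a *v x) = 0" for a x by blast
    \<comment> \<open>Polarizing the vanishing squares gives anticommutation; the values commute as
      well, so twice each product is zero.\<close>
    have anti: "N a *v (N b *v x) + N b *v (N a *v x) = 0" for a b x
      using sq[of "a + b" x] sq[of a x] sq[of b x]
      by (simp add: Nadd matrix_vector_mult_add_rdistrib matrix_vector_right_distrib add.commute)
    have cm: "N a *v (N b *v x) = N b *v (N a *v x)" for a b x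
      using arg_cong[OF comm[of a b], of "\<lambda>Z. Z *v x"]
      by (simp add: exp_nilpotent_mult_vec sq matrix_vector_right_distrib flip: matrix_vector_mul_assoc)
    have "2 *s (N a *v (N b *v x)) = N a *v (N b *v x) + N a *v (N b *v x)" for a b x
      by (simp add: vec_eq_iff)
    then have "2 *s (N a *v (N b *v x)) = 0" for a b x
      using anti[of a b x] cm[of a b x] by simp
    then have NN: "N a *v (N b *v x) = 0" for a b x by simp
    \<comment> \<open>The last column of \<open>\<tau>\<^sub>2\<close> has \<open>a $ 2\<close> on
      top, so the image of \<open>v\<close> under \<open>N e2\<close> comes first.\<close>
    define B where "B = columns3 (N e2 *v v) (N e1 *v v) v"
    have "x = 0" if "B *v x = 0" for x
    proof -
      have eq: "x $ 1 *s (N e2 *v v) + x $ 2 *s (N e1 *v v) + x $ 3 *s v = 0"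
        using that by (simp add: B_def columns3_mult_vec)
      \<comment> \<open>Applying \<open>N e1\<close> to the relation kills every term except the
        third.\<close>
      have "x $ 3 *s (N e1 *v v) = N e1 *v (x $ 1 *s (N e2 *v v) + x $ 2 *s (N e1 *v v) + x $ 3 *s v)"
        by (simp add: matrix_vector_right_distrib vector_scalar_commute NN)
      then have "x $ 3 *s (N e1 *v v) = 0" by (simp add: eq)
      moreover have "N e1 *v v \<noteq> 0" using free'[of e1] by (auto simp: e1_def axis_eq_0_iff)
      ultimately have 3: "x $ 3 = 0" by simp
      have "N (vector [x $ 2, x $ 1]) *v v = 0" 
        using eq 3 by (simp add: Nv[of "vector [x $ 2, x $ 1]"] add.commute)
      then have "vector [x $ 2, x $ 1] = (0 :: qbar ^ 2)" by (rule free')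
      then have "x $ 2 = 0" "x $ 1 = 0" by (simp_all add: vec_eq_iff forall_2)
      with 3 show ?thesis by (simp add: vec_eq_iff forall_3)
    qed
    then have "invertible B" using invertible_left_inverse matrix_left_invertible_ker by blast
    have MB: "exp_nilpotent (N a) 1 ** B = B ** \<tau>\<^sub>2 (mat 1 *v a)" for a
      unfolding \<tau>\<^sub>2_mult unfolding B_def mult_columns3
      by (simp add: exp_nilpotent_mult_vec NN) (simp add: Nv[of a v] add_ac)
    have inv1: "invertible (mat 1 :: qbar ^ 2 ^ 2)"
      by (auto simp: invertible_def intro: exI[of _ "mat 1"])
    have "ga_equivalent \<phi> (proj_action \<tau>\<^sub>2)"
      by (rule ga_equivalent_proj_action[where M = "\<lambda>a. exp_nilpotent (N a) 1",
            OF _ \<open>invertible B\<close> _ inv1]) (erule \<phi>, rule MB)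
    then show ?thesis ..
  next
    case False
    then obtain b w where "N b *v (N b *v w) \<noteq> 0" by blast
    define S where "S = N b"
    define B where "B = columns3 (S *v (S *v w)) (S *v w) w"
    have S: "S *v (S *v w) \<noteq> 0" "S *v (S *v (S *v x)) = 0" for x
      using \<open>N b *v (N b *v w) \<noteq> 0\<close> N3v by (simp_all add: S_def)
    have "invertible B" unfolding B_def by (rule invertible_columns3_cyclic) (use S in simp_all)
    then obtain C where C: "B ** C = mat 1" "C ** B = mat 1" unfolding invertible_def by blast
    define c where "c a = C *v (N a *v w)" for a
    have Nw: "N a *v w = c a $ 1 *s (S *v (S *v w)) + c a $ 2 *s (S *v w) + c a $ 3 *s w" for a
    proof -
      have "N a *v w = B *v c a" by (simp add: c_def matrix_vector_mul_assoc matrix_mul_assoc C)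
      then show ?thesis by (simp add: B_def columns3_mult_vec)
    qed
    \<comment> \<open>\<open>S\<close> commutes with the exponential of \<open>t\<close> times
      \<open>N a\<close> for every \<open>t\<close>; comparing linear terms in \<open>t\<close>
      removes the exponential.\<close>
    have NS: "N a *v (S *v x) = S *v (N a *v x)" for a x
    proof -
      have 1: "S *v (exp_nilpotent (N (t *s a)) 1 *v x) = exp_nilpotent (N (t *s a)) 1 *v (S *v x)" for t
        using comm[of "t *s a" b] by (simp add: S_def matrix_vector_mul_assoc)
      have "S *v (exp_nilpotent (N (t *s a)) 1 *v x) = S *v x + t *s (S *v (N a *v x)) +
          (1 / 2 * t\<^sup>2) *s (S *v (N a *v (N a *v x)))" for t and a :: "qbar ^ 2" and x
        by (simp add: exp_nilpotent_mult_vec Nscale mat_mult_vec vector_scalar_commute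
            matrix_vector_right_distrib power2_eq_square mult_ac flip: matrix_vector_mul_assoc)
      moreover have "exp_nilpotent (N (t *s a)) 1 *v (S *v x) = S *v x + t *s (N a *v (S *v x)) +
          (1 / 2 * t\<^sup>2) *s (N a *v (N a *v (S *v x)))" for t and a :: "qbar ^ 2" and x
        by (simp add: exp_nilpotent_mult_vec Nscale mat_mult_vec vector_scalar_commute
            matrix_vector_right_distrib power2_eq_square mult_ac flip: matrix_vector_mul_assoc)
      ultimately have eq: "S *v x + t *s (N a *v (S *v x)) + (1 / 2 * t\<^sup>2) *s (N a *v (N a *v (S *v x))) =
          S *v x + t *s (S *v (N a *v x)) + (1 / 2 * t\<^sup>2) *s (S *v (N a *v (N a *v x)))" for t
        using 1 by simp
      have "(N a *v (S *v x)) $ i = (S *v (N a *v x)) $ i + 0" for i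
      proof (rule quartic_odd_part)
        fix t
        show "(S *v x) $ i + t * (N a *v (S *v x)) $ i + t\<^sup>2 * (1 / 2 * (N a *v (N a *v (S *v x))) $ i) =
          (S *v x) $ i + t * ((S *v (N a *v x)) $ i + 0) +
          t\<^sup>2 * (1 / 2 * (S *v (N a *v (N a *v x))) $ i) + t ^ 3 * 0 + t ^ 4 * 0"
          using arg_cong[OF eq[of t], of "\<lambda>z. z $ i"] by (simp add: mult_ac)
      qed
      then show ?thesis by (simp add: vec_eq_iff)
    qed
    have c3: "c a $ 3 = 0" for a
    proof -
      \<comment> \<open>\<open>N a\<close> multiplies this vector by \<open>c a $ 3\<close>, and a
        nilpotent matrix has no eigenvalue other than 0.\<close>
      define y where "y = S *v (S *v w)"
      have "N a *v y = S *v (S *v (N a *v w))" by (simp add: y_def NS)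
      also have "\<dots> = c a $ 3 *s y"
        by (simp add: Nw matrix_vector_right_distrib vector_scalar_commute S y_def)
      finally have y: "N a *v y = c a $ 3 *s y" .
      have "(c a $ 3) ^ 3 *s y = N a *v (N a *v (N a *v y))"
        by (simp add: y vector_scalar_commute power3_eq_cube mult_ac)
      then show ?thesis using N3v[of a y] S(1) by (simp add: y_def)
    qed
    \<comment> \<open>The index swap follows \<open>\<rho>\<close>: the coefficient of
      \<open>S\<close> becomes the first parameter, that of its square the second.\<close>
    define A :: "qbar ^ 2 ^ 2" where "A = (\<chi> i j. c (axis j 1) $ (if i = 1 then 2 else 1))"
    have cA: "c a $ 1 = (A *v a) $ 2" "c a $ 2 = (A *v a) $ 1" for a
    proof -
      have "c a = a $ 1 *s c e1 + a $ 2 *s c e2"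
        unfolding c_def by (subst Nv) (simp add: matrix_vector_right_distrib vector_scalar_commute)
      then show "c a $ 1 = (A *v a) $ 2" "c a $ 2 = (A *v a) $ 1"
        by (simp_all add: A_def matrix_vector_mult_def sum_2 e1_def e2_def mult.commute)
    qed
    have Nw': "N a *v w = (A *v a) $ 2 *s (S *v (S *v w)) + (A *v a) $ 1 *s (S *v w)" for a
      by (simp add: Nw c3 cA)
    \<comment> \<open>\<open>w\<close> generates the space under \<open>S\<close>, with which
      \<open>N a\<close> commutes; if \<open>N a\<close> kills \<open>w\<close>, it kills
      \<open>v\<close>, and freeness applies.\<close>
    have "a = 0" if "A *v a = 0" for a
    proof (rule free')
      have 0: "N a *v w = 0" using that by (simp add: Nw')
      have "v = B *v (C *v v)" by (simp add: matrix_vector_mul_assoc C)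
      then have "N a *v v = N a *v (B *v (C *v v))" by simp
      also have "\<dots> = 0"
        unfolding B_def columns3_mult_vec
        by (simp add: matrix_vector_right_distrib vector_scalar_commute NS 0)
      finally show "N a *v v = 0" .
    qed
    then have "invertible A" using invertible_left_inverse matrix_left_invertible_ker by blast
    \<comment> \<open>The square of \<open>N a\<close> sends \<open>w\<close> to the squared first
      parameter times \<open>S *v (S *v w)\<close>; half of it is the quadratic term in the corner
      of \<open>\<rho>\<close>.\<close>
    have MB: "exp_nilpotent (N a) 1 ** B = B ** \<rho> (A *v a)" for a
      unfolding \<rho>_mult unfolding B_def mult_columns3 column_columns3 exp_nilpotent_mult_vec NS Nw'
      by (simp add: matrix_vector_right_distrib vector_scalar_commute NS Nw' S vec.scale_left_distrib
          power2_eq_square add_ac)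
    have "ga_equivalent \<phi> (proj_action \<rho>)"
      by (rule ga_equivalent_proj_action[where M = "\<lambda>a. exp_nilpotent (N a) 1",
            OF _ \<open>invertible B\<close> _ \<open>invertible A\<close>]) (erule \<phi>, rule MB)
    then show ?thesis ..
  qed
qed

section \<open>The two actions\<close>

lemma polyfun_imp_mpoly:
  fixes f :: "qbar ^ 'n::finite \<Rightarrow> qbar"
  assumes "f \<in> polyfun"
  obtains p where "f = mpoly_eval p"
proof -
  have "\<exists>p. \<forall>x. mpoly_eval p x = f x"
    using assms
  proof induction
    case (const c)
    show ?case by (rule exI[of _ "mconst c"]) simp
  next
    case (coord i)
    show ?case by (rule exI[of _ "mvar i"]) simp
  next
    case (add f g)
    then obtain p q where "\<forall>x. mpoly_eval p x = f x" "\<forall>x. mpoly_eval q x = g x" by blast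
    then show ?case by (intro exI[of _ "p + q"]) (simp add: mpoly_eval_add)
  next
    case (mult f g)
    then obtain p q where "\<forall>x. mpoly_eval p x = f x" "\<forall>x. mpoly_eval q x = g x" by blast
    then show ?case by (intro exI[of _ "p * q"]) (simp add: mpoly_eval_mult)
  qed
  then obtain p where "\<forall>x. mpoly_eval p x = f x" ..
  then have "f = mpoly_eval p" by (simp add: fun_eq_iff)
  with that show thesis .
qed

lemma weight_homogeneous_zero_weight: "weight_homogeneous (\<lambda>_. 0) 0 p"
  by (simp add: weight_homogeneous_def)

lemma polyfun_regular:
  fixes f :: "qbar ^ 'n::finite \<Rightarrow> qbar"
  assumes "f \<in> polyfun"
  shows "f \<in> regular_functions affine_space UNIV"
proof -
  obtain p where p: "f = mpoly_eval p" by (rule polyfun_imp_mpoly[OF assms]) (rule that)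
  have "openin (zariski affine_space) (UNIV :: (qbar ^ 'n) set)"
    using openin_topspace[of "zariski (affine_space :: ('n, _) presented_variety)"]
    by (simp add: topspace_affine_space)
  then show ?thesis
    unfolding regular_functions_def
    by (intro CollectI ballI exI[of _ UNIV] exI[of _ p] exI[of _ "mconst 1"] exI[of _ 0])
      (simp add: p affine_space_def weight_homogeneous_zero_weight)
qed

text \<open>The matrix entries involve only affine coordinates, of weight 0, so the image
  coordinates have weight 1 whatever the degree of \<open>\<tau>\<close> in the group
  variable.\<close>

lemma morphism_proj_action:
  fixes \<tau> :: "qbar ^ 'n::finite \<Rightarrow> qbar ^ 'k ^ 'k::finite"
  assumes \<tau>: "\<And>i j. (\<lambda>a. \<tau> a $ i $ j) \<in> polyfun"
    and zero: "\<tau> 0 = mat 1" and add: "\<And>a b. \<tau> (a + b) = \<tau> a ** \<tau> b"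
  shows "morphism affine_times_projective projective_space (\<lambda>(a, p). proj_action \<tau> a p)"
proof -
  let ?X = "affine_times_projective :: ('n + 'k, (qbar ^ 'n) \<times> (qbar ^ 'k) set) presented_variety"
  define H where "H i j h \<longleftrightarrow> weight_homogeneous (weight ?X) 0 h \<and>
      (\<forall>x. mpoly_eval h x = \<tau> (\<chi> i. x $ Inl i) $ j $ i)" for i j h
  have "\<exists>h. H i j h" for i j
  proof -
    obtain p where p: "(\<lambda>a. \<tau> a $ j $ i) = mpoly_eval p"
      by (rule polyfun_imp_mpoly[OF \<tau>]) (rule that)
    have "weight_homogeneous (weight ?X) (0 * 0) (mvar (Inl l))" for l
      using weight_homogeneous_mvar[of "weight ?X" "Inl l"] by (simp add: affine_times_projective_def)
    then obtain h where "weight_homogeneous (weight ?X) (0 * 0) h"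
      "\<And>x. mpoly_eval h x = mpoly_eval p (\<chi> l. mpoly_eval (mvar (Inl l)) x)"
      by (rule weight_homogeneous_substitution[OF weight_homogeneous_zero_weight]) (rule that)
    moreover have "mpoly_eval p y = \<tau> y $ j $ i" for y using fun_cong[OF p, of y] by simp
    ultimately show ?thesis unfolding H_def by (intro exI[of _ h]) simp
  qed
  then obtain h where H: "\<And>i j. H i j (h i j)" by metis
  have h: "weight_homogeneous (weight ?X) 0 (h i j)"
    "mpoly_eval (h i j) x = \<tau> (\<chi> i. x $ Inl i) $ j $ i" for i j x
    using H[of i j] by (simp_all add: H_def)
  let ?F = "\<lambda>j. \<Sum>i\<in>UNIV. h i j * mvar (Inr i)"
  have eval: "(\<chi> j. mpoly_eval (?F j) x) = \<tau> (\<chi> i. x $ Inl i) *v (\<chi> j. x $ Inr j)" for x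
    by (simp add: vec_eq_iff mpoly_eval_sum mpoly_eval_mult h matrix_vector_mult_def)
  have inj: "v = 0" if "\<tau> a *v v = 0" for a v
  proof -
    have "\<tau> (- a) ** \<tau> a = mat 1" using add[of "- a" a] zero by simp
    then have "v = \<tau> (- a) *v (\<tau> a *v v)" by (simp add: matrix_vector_mul_assoc)
    with that show ?thesis by simp
  qed
  show ?thesis
  proof (rule morphism_polynomial[where e = 1 and F = ?F, OF graded_presentation_projective])
    show "weight_homogeneous (weight ?X) (1 * weight projective_space j) (?F j)" for j
    proof (rule weight_homogeneous_sum)
      fix i :: 'k
      have "weight_homogeneous (weight ?X) 1 (mvar (Inr i))"
        using weight_homogeneous_mvar[of "weight ?X" "Inr i"] by (simp add: affine_times_projective_def)
      from weight_homogeneous_mult[OF h(1) this]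
      show "weight_homogeneous (weight ?X) (1 * weight projective_space j) (h i j * mvar (Inr i))"
        by (simp add: projective_space_def)
    qed
    fix x assume "x \<in> coords ?X"
    then show "(\<chi> j. mpoly_eval (?F j) x) \<in> coords projective_space"
      unfolding eval using inj by (auto simp: affine_times_projective_def projective_space_def)
    show "(case pt ?X x of (a, p) \<Rightarrow> proj_action \<tau> a p) = pt projective_space (\<chi> j. mpoly_eval (?F j) x)"
      unfolding eval by (simp add: affine_times_projective_def projective_space_def proj_action_span)
  qed
qed

text \<open>The representation acts simply transitively on each affine plane \<open>x\<^sub>3 = c \<noteq> 0\<close>, that is, on the
  complement of a line.\<close>

lemma ga_structure_proj_action:
  fixes \<tau> :: "qbar ^ 'n::finite \<Rightarrow> qbar ^ 3 ^ 3"
  assumes \<tau>: "\<And>i j. (\<lambda>a. \<tau> a $ i $ j) \<in> polyfun"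
    and zero: "\<tau> 0 = mat 1" and add: "\<And>a b. \<tau> (a + b) = \<tau> a ** \<tau> b"
    and third: "\<And>a x. (\<tau> a *v x) $ 3 = x $ 3"
    and trans: "\<And>x y. x $ 3 \<noteq> 0 \<Longrightarrow> x $ 3 = y $ 3 \<Longrightarrow> \<exists>!a. \<tau> a *v x = y"
  shows "ga_structure (proj_action \<tau>)"
proof -
  let ?P = "projective_space :: (3, (qbar ^ 3) set) presented_variety"
  define U where "U = pt ?P ` {x \<in> coords ?P. mpoly_eval (mvar 3) x \<noteq> 0}"
  have "{x \<in> coords ?P. mpoly_eval (mvar 3) x \<noteq> 0} = {x. x $ 3 \<noteq> 0}"
    by (auto simp: projective_space_def)
  then have U_eq: "U = {vec.span {x} | x. x $ 3 \<noteq> 0}"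
    by (simp add: U_def) (simp add: projective_space_def image_Collect)
  have "weight_homogeneous (weight ?P) (weight ?P 3) (mvar 3)" by (rule weight_homogeneous_mvar)
  then have U: "openin (zariski ?P) U" unfolding U_def by (rule openin_zariski_basic)
  have "vec.span {\<chi> i. 1} \<in> U" unfolding U_eq by (intro CollectI exI[of _ "\<chi> i. 1"]) simp
  then have U_ne: "U \<noteq> {}" by blast
  have stab: "{a. proj_action \<tau> a p = p} = {0}" if "p \<in> U" for p
  proof -
    obtain x where x: "p = vec.span {x}" "x $ 3 \<noteq> 0" using \<open>p \<in> U\<close> unfolding U_eq by blast
    have "a = 0" if a: "proj_action \<tau> a p = p" for a
    proof -
      have "x \<noteq> 0" "\<tau> a *v x \<noteq> 0" using x(2) third[of a x] by auto
      then obtain c where c: "\<tau> a *v x = c *s x"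
        using a span_singleton_eq_iff[of x "\<tau> a *v x"] by (auto simp: x proj_action_span)
      \<comment> \<open>The third coordinate is preserved and nonzero.\<close>
      then have "c = 1" using third[of a x] x(2) by simp
      then have "\<tau> a *v x = x" using c by simp
      moreover have "\<tau> 0 *v x = x" by (simp add: zero)
      ultimately show ?thesis using trans[OF x(2), of x] by blast
    qed
    moreover have "proj_action \<tau> 0 p = p" by (simp add: x proj_action_span zero)
    ultimately show ?thesis by blast
  qed
  have orbit: "q \<in> range (\<lambda>a. proj_action \<tau> a p)" if "p \<in> U" "q \<in> U" for p q
  proof -
    obtain x y where x: "p = vec.span {x}" "x $ 3 \<noteq> 0" and y: "q = vec.span {y}" "y $ 3 \<noteq> 0"
      using \<open>p \<in> U\<close> \<open>q \<in> U\<close> unfolding U_eq by blast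
    \<comment> \<open>\<open>y\<close> is rescaled to have the third coordinate of \<open>x\<close>,
      where \<open>trans\<close> applies.\<close>
    obtain a where a: "\<tau> a *v x = (x $ 3 / y $ 3) *s y"
      using trans[OF x(2), of "(x $ 3 / y $ 3) *s y"] y(2) by auto
    have "y \<noteq> 0" "(x $ 3 / y $ 3) *s y \<noteq> 0" using x(2) y(2) by (auto simp: vec_eq_iff)
    then have "vec.span {y} = vec.span {(x $ 3 / y $ 3) *s y}"
      using x(2) y(2) by (subst span_singleton_eq_iff) auto
    then have "q = proj_action \<tau> a p" unfolding x(1) y(1) proj_action_span a .
    then show ?thesis by blast
  qed
  have dense: "Abstract_Topology.closure_of (zariski ?P) (range (\<lambda>a. proj_action \<tau> a p)) = proj_points"
    if p: "p \<in> U" for p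
  proof -
    have "\<exists>q\<in>range (\<lambda>a. proj_action \<tau> a p). q \<in> V"
      if V: "openin (zariski ?P) V" and q: "q \<in> V" for V q
    proof -
      have "q \<in> proj_points" using V q openin_subset by blast
      then obtain y where y: "q = vec.span {y}" "y \<noteq> 0" by (auto simp: proj_points_eq)
      have yP: "y \<in> coords ?P" "pt ?P y \<in> V" using y q by (auto simp: projective_space_def)
      obtain r d where r: "weight_homogeneous (weight ?P) d r" "mpoly_eval r y \<noteq> 0"
        "\<And>z. z \<in> coords ?P \<Longrightarrow> mpoly_eval r z \<noteq> 0 \<Longrightarrow> pt ?P z \<in> V"
        by (rule openin_zariski_nbhd[OF graded_presentation_projective V yP]) (rule that)
      obtain R where R: "mpoly_eval r = eval3 R"
        using polyfun_imp_eval3[OF polyfun_mpoly_eval] by blast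
      have "R \<noteq> 0" using r(2) R by auto
      \<comment> \<open>A point where both factors are nonzero lies in the given open set and off
        the line at infinity, hence on the orbit.\<close>
      then have "[:0, 1:] * R \<noteq> 0" by simp
      then obtain z where "eval3 ([:0, 1:] * R) z \<noteq> 0" using eval3_eq_0_iff by blast
      then have z: "z $ 3 \<noteq> 0" "mpoly_eval r z \<noteq> 0" unfolding eval3_simps eval3_coord R by auto
      then have "z \<noteq> 0" by auto
      then have "vec.span {z} \<in> V" using r(3)[of z] z by (simp add: projective_space_def)
      moreover have "vec.span {z} \<in> U" using z unfolding U_eq by blast
      ultimately show ?thesis using orbit[OF p] by blast
    qed
    then show ?thesis unfolding closure_of_def by blast
  qed
  show ?thesis
    unfolding ga_structure_def generically_def
  proof (intro conjI allI ballI)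
    show "morphism affine_times_projective projective_space (\<lambda>(a, p). proj_action \<tau> a p)"
      by (rule morphism_proj_action[OF \<tau> zero add])
    show "proj_action \<tau> 0 p = p" for p by (simp add: proj_action_def zero)
    show "proj_action \<tau> (a + b) p = proj_action \<tau> a (proj_action \<tau> b p)" for a b p
      by (simp add: proj_action_def add image_image matrix_vector_mul_assoc)
    show "\<exists>U. openin (zariski ?P) U \<and> U \<noteq> {} \<and> (\<forall>p\<in>U. {a. proj_action \<tau> a p = p} = {0})"
      using U U_ne stab by (intro exI[of _ U]) simp
    show "\<exists>U. openin (zariski ?P) U \<and> U \<noteq> {} \<and>
      (\<forall>p\<in>U. Abstract_Topology.closure_of (zariski ?P) (range (\<lambda>a. proj_action \<tau> a p)) = proj_points)"
      using U U_ne dense by (intro exI[of _ U]) simp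
  qed
qed

section \<open>The two representations and their fixed points\<close>

lemma \<tau>\<^sub>2_mult_vec: "\<tau>\<^sub>2 a *v x = vector [x $ 1 + a $ 2 * x $ 3, x $ 2 + a $ 1 * x $ 3, x $ 3]"
  by (simp add: vec_eq_iff forall_3 matrix_vector_mult_def sum_3 \<tau>\<^sub>2_def)

lemma \<rho>_mult_vec: "\<rho> a *v x = vector [x $ 1 + a $ 1 * x $ 2 + (a $ 2 + 1 / 2 * (a $ 1)\<^sup>2) * x $ 3,
    x $ 2 + a $ 1 * x $ 3, x $ 3]"
  by (simp add: vec_eq_iff forall_3 matrix_vector_mult_def sum_3 \<rho>_def)

lemma \<tau>\<^sub>2_polyfun: "(\<lambda>a. \<tau>\<^sub>2 a $ i $ j) \<in> polyfun"
  using exhaust_3[of i] exhaust_3[of j] by (auto simp: \<tau>\<^sub>2_def intro: polyfun.intros)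

lemma \<rho>_polyfun: "(\<lambda>a. \<rho> a $ i $ j) \<in> polyfun"
proof -
  have "(\<lambda>a :: qbar ^ 2. a $ 2 + 1 / 2 * (a $ 1)\<^sup>2) \<in> polyfun"
    by (intro polyfun.intros polyfun_power)
  then show ?thesis
    using exhaust_3[of i] exhaust_3[of j] unfolding \<rho>_def by (auto intro: polyfun.intros)
qed

lemma \<tau>\<^sub>2_hom: "\<tau>\<^sub>2 0 = mat 1" "\<tau>\<^sub>2 (a + b) = \<tau>\<^sub>2 a ** \<tau>\<^sub>2 b"
  by (rule matrix_eqI_vec, simp add: vec_eq_iff forall_3 \<tau>\<^sub>2_mult_vec,
      rule matrix_eqI_vec, simp add: vec_eq_iff forall_3 \<tau>\<^sub>2_mult_vec distrib_right add_ac
        flip: matrix_vector_mul_assoc)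

lemma square_half_add: "(x + y)\<^sup>2 / 2 = x\<^sup>2 / 2 + x * y + y\<^sup>2 / (2 :: 'a::field_char_0)"
  by (simp add: field_simps power2_eq_square)

lemma \<rho>_hom: "\<rho> 0 = mat 1" "\<rho> (a + b) = \<rho> a ** \<rho> b"
proof -
  show "\<rho> 0 = mat 1" by (rule matrix_eqI_vec) (simp add: vec_eq_iff forall_3 \<rho>_mult_vec)
  show "\<rho> (a + b) = \<rho> a ** \<rho> b"
    by (rule matrix_eqI_vec)
      (simp add: vec_eq_iff forall_3 \<rho>_mult_vec square_half_add distrib_left distrib_right
        add_ac mult_ac flip: matrix_vector_mul_assoc)
qed

lemma ga_representation_\<tau>\<^sub>2: "ga_representation \<tau>\<^sub>2"
  unfolding ga_representation_def by (intro conjI allI polyfun_regular \<tau>\<^sub>2_polyfun \<tau>\<^sub>2_hom)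

lemma ga_representation_\<rho>: "ga_representation \<rho>"
  unfolding ga_representation_def by (intro conjI allI polyfun_regular \<rho>_polyfun \<rho>_hom)

lemma ga_structure_\<tau>\<^sub>2: "ga_structure (proj_action \<tau>\<^sub>2)"
proof (rule ga_structure_proj_action[OF \<tau>\<^sub>2_polyfun \<tau>\<^sub>2_hom])
  show "(\<tau>\<^sub>2 a *v x) $ 3 = x $ 3" for a x by (simp add: \<tau>\<^sub>2_mult_vec)
  fix x y :: "qbar ^ 3" assume x: "x $ 3 \<noteq> 0" "x $ 3 = y $ 3"
  show "\<exists>!a. \<tau>\<^sub>2 a *v x = y"
  proof (rule ex1I)
    let ?a = "vector [(y $ 2 - x $ 2) / x $ 3, (y $ 1 - x $ 1) / x $ 3] :: qbar ^ 2"
    show "\<tau>\<^sub>2 ?a *v x = y" using x by (simp add: vec_eq_iff forall_3 \<tau>\<^sub>2_mult_vec)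
    fix a assume "\<tau>\<^sub>2 a *v x = y"
    then have "y $ 1 = x $ 1 + a $ 2 * x $ 3" "y $ 2 = x $ 2 + a $ 1 * x $ 3"
      by (auto simp: vec_eq_iff forall_3 \<tau>\<^sub>2_mult_vec)
    with x(1) show "a = ?a" by (simp add: vec_eq_iff forall_2)
  qed
qed

lemma ga_structure_\<rho>: "ga_structure (proj_action \<rho>)"
proof (rule ga_structure_proj_action[OF \<rho>_polyfun \<rho>_hom])
  show "(\<rho> a *v x) $ 3 = x $ 3" for a x by (simp add: \<rho>_mult_vec)
  fix x y :: "qbar ^ 3" assume x: "x $ 3 \<noteq> 0" "x $ 3 = y $ 3"
  show "\<exists>!a. \<rho> a *v x = y"
  proof (rule ex1I)
    \<comment> \<open>The system is triangular: \<open>u\<close> solves the second row, and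
      \<open>w\<close> is the value that the first row requires of
      \<open>a $ 2 + 1 / 2 * (a $ 1)\<^sup>2\<close>.\<close>
    define u where "u = (y $ 2 - x $ 2) / x $ 3"
    define w where "w = (y $ 1 - x $ 1 - u * x $ 2) / x $ 3"
    let ?a = "vector [u, w - 1 / 2 * u\<^sup>2] :: qbar ^ 2"
    have u: "u * x $ 3 = y $ 2 - x $ 2" and w: "w * x $ 3 = y $ 1 - x $ 1 - u * x $ 2"
      using x by (simp_all add: u_def w_def)
    show "\<rho> ?a *v x = y" using x(1) x(2)[symmetric] by (simp add: vec_eq_iff forall_3 \<rho>_mult_vec u w)
    fix a assume "\<rho> a *v x = y"
    then have 1: "y $ 1 = x $ 1 + a $ 1 * x $ 2 + (a $ 2 + 1 / 2 * (a $ 1)\<^sup>2) * x $ 3"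
      and 2: "y $ 2 = x $ 2 + a $ 1 * x $ 3"
      by (auto simp: vec_eq_iff forall_3 \<rho>_mult_vec)
    have au: "a $ 1 = u" using 2 x(1) by (simp add: u_def)
    have "w = a $ 2 + 1 / 2 * u\<^sup>2" using 1 x(1) unfolding w_def au by simp
    with au show "a = ?a" by (simp add: vec_eq_iff forall_2)
  qed
qed

text \<open>The element \<open>axis 1 1\<close> acts by a single unipotent Jordan block, whose only
  eigenline is spanned by the first basis vector.\<close>

lemma \<rho>_fixed_point:
  assumes "x \<noteq> 0" "\<And>a. proj_action \<rho> a (vec.span {x}) = vec.span {x}"
  shows "x $ 2 = 0" "x $ 3 = 0"
proof -
  have "\<rho> (axis 1 1) *v x \<noteq> 0"
  proof
    assume *: "\<rho> (axis 1 1) *v x = 0"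
    have "\<rho> (- axis 1 1) ** \<rho> (axis 1 1) = mat 1"
      using \<rho>_hom(2)[of "- axis 1 1" "axis 1 1"] \<rho>_hom(1) by simp
    then have "x = \<rho> (- axis 1 1) *v (\<rho> (axis 1 1) *v x)" by (simp add: matrix_vector_mul_assoc)
    with * assms(1) show False by simp
  qed
  then obtain c where c: "\<rho> (axis 1 1) *v x = c *s x"
    using assms(2)[of "axis 1 1"] span_singleton_eq_iff[of x "\<rho> (axis 1 1) *v x"] assms(1)
    by (auto simp: proj_action_span)
  then have eqs: "x $ 1 + x $ 2 + 1 / 2 * x $ 3 = c * x $ 1" "x $ 2 + x $ 3 = c * x $ 2"
    "x $ 3 = c * x $ 3"
    by (auto simp: vec_eq_iff forall_3 \<rho>_mult_vec axis_def)
  show 3: "x $ 3 = 0"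
  proof (rule ccontr)
    assume "x $ 3 \<noteq> 0"
    then have "c = 1" using eqs(3) by simp
    then show False using eqs(2) \<open>x $ 3 \<noteq> 0\<close> by simp
  qed
  show "x $ 2 = 0"
  proof (rule ccontr)
    assume "x $ 2 \<noteq> 0"
    then have "c = 1" using eqs(2) 3 by simp
    then show False using eqs(1) \<open>x $ 2 \<noteq> 0\<close> 3 by simp
  qed
qed

text \<open>The action by \<open>\<tau>\<^sub>2\<close> fixes the line at infinity pointwise; that by \<open>\<rho>\<close> has a single fixed point.\<close>

lemma not_ga_equivalent_\<tau>\<^sub>2_\<rho>: "\<not> ga_equivalent (proj_action \<tau>\<^sub>2) (proj_action \<rho>)"
proof
  assume "ga_equivalent (proj_action \<tau>\<^sub>2) (proj_action \<rho>)"
  then obtain \<alpha> j where \<alpha>: "ga_automorphism \<alpha>"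
    and j: "isomorphism projective_space projective_space j"
    and eq: "\<And>a p. p \<in> proj_points \<Longrightarrow> j (proj_action \<tau>\<^sub>2 a p) = proj_action \<rho> (\<alpha> a) (j p)"
    unfolding ga_equivalent_def by blast
  \<comment> \<open>Surjectivity of \<alpha> makes a point fixed by all of the first action go to
    one fixed by all of the second.\<close>
  obtain \<beta> where \<beta>: "\<And>b. \<alpha> (\<beta> b) = b"
    using \<alpha> by (auto simp: ga_automorphism_def isomorphism_def topspace_affine_space)
  obtain g where g: "\<And>p. p \<in> proj_points \<Longrightarrow> g (j p) = p"
    using j by (auto simp: isomorphism_def)
  have "morphism projective_space projective_space j" using j by (simp add: isomorphism_def)
  then have jP: "j p \<in> proj_points" if "p \<in> proj_points" for p using that by (rule morphism_in)
  have fixed: "j (vec.span {x}) = vec.span {axis 1 1}" if x: "x \<noteq> 0" "x $ 3 = 0" for x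
  proof -
    have xP: "vec.span {x} \<in> proj_points" using x by (auto simp: proj_points_eq)
    then obtain y where y: "j (vec.span {x}) = vec.span {y}" "y \<noteq> 0"
      using jP by (force simp: proj_points_eq)
    have \<tau>x: "\<tau>\<^sub>2 a *v x = x" for a using x by (simp add: vec_eq_iff forall_3 \<tau>\<^sub>2_mult_vec)
    have "proj_action \<rho> b (vec.span {y}) = vec.span {y}" for b
      using eq[OF xP, of "\<beta> b", symmetric] unfolding \<beta> proj_action_span[of \<tau>\<^sub>2] \<tau>x y(1) .
    then have "y $ 2 = 0" "y $ 3 = 0" using \<rho>_fixed_point y(2) by blast+
    then have "y = y $ 1 *s axis 1 1" by (simp add: vec_eq_iff forall_3 axis_def)
    moreover from this have "y $ 1 \<noteq> 0" using y(2) by auto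
    ultimately have "vec.span {axis 1 1} = vec.span {y}"
      using y(2) by (subst span_singleton_eq_iff) (auto simp: axis_eq_0_iff)
    with y show ?thesis by simp
  qed
  let ?x = "axis 1 1 :: qbar ^ 3" and ?y = "axis 2 1 :: qbar ^ 3"
  have nz: "?x \<noteq> 0" "?y \<noteq> 0" by (simp_all add: axis_eq_0_iff)
  have "?x $ 3 = 0" "?y $ 3 = 0" by (simp_all add: axis_def)
  then have "j (vec.span {?x}) = j (vec.span {?y})" using fixed nz by simp
  moreover have "vec.span {?x} \<in> proj_points" "vec.span {?y} \<in> proj_points"
    using nz by (auto simp: proj_points_eq)
  ultimately have "vec.span {?x} = vec.span {?y}" using g by metis
  then obtain c where "?y = c *s ?x" using span_singleton_eq_iff[OF nz] by blast
  then have "?y $ 2 = c * ?x $ 2" by simp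
  then show False by (simp add: axis_def)
qed

section \<open>The corresponding algebras\<close>

lemma mconst_simps:
  "mconst (a + b) = mconst a + mconst b" "mconst (a * b) = mconst a * mconst b"
  "mconst 0 = 0" "mconst 1 = 1"
  by (simp_all add: mconst_def single_add mult_single single_one)

lemma mvar_power: "mvar i ^ k = Poly_Mapping.single (Poly_Mapping.single i k) 1"
proof (induction k)
  case (Suc k)
  have "Poly_Mapping.single i (1::nat) + Poly_Mapping.single i k = Poly_Mapping.single i (Suc k)"
    by (simp flip: single_add)
  with Suc show ?case by (simp add: mvar_def mult_single)
qed (simp add: single_one)

lemma exponent_eq_iff:
  fixes m n :: "2 \<Rightarrow>\<^sub>0 nat"
  shows "m = n \<longleftrightarrow> Poly_Mapping.lookup m 1 = Poly_Mapping.lookup n 1 \<and>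
    Poly_Mapping.lookup m 2 = Poly_Mapping.lookup n 2"
  by (simp add: poly_mapping_eq_iff fun_eq_iff forall_2)

lemma single_eq_monomial:
  fixes m :: "2 \<Rightarrow>\<^sub>0 nat"
  shows "Poly_Mapping.single m a =
    mconst a * (mvar 1 ^ Poly_Mapping.lookup m 1 * mvar 2 ^ Poly_Mapping.lookup m 2)"
proof -
  have "m = Poly_Mapping.single 1 (Poly_Mapping.lookup m 1) + Poly_Mapping.single 2 (Poly_Mapping.lookup m 2)"
    by (simp add: exponent_eq_iff lookup_add lookup_single)
  then show ?thesis by (simp add: mvar_power mult_single mconst_def)
qed

text \<open>Both quotient algebras have the basis \<open>S\<^sub>2, S\<^sub>1, 1\<close>, with \<open>S\<^sub>1\<^sup>2 = c S\<^sub>2\<close> and \<open>S\<^sub>1 S\<^sub>2 = S\<^sub>2\<^sup>2 = 0\<close>,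
  where \<open>c = 0\<close> for \<open>I\<^sub>1\<close> and \<open>c = 1\<close> for \<open>I\<^sub>2\<close>. The coordinates of the class of a polynomial are
  read off its coefficients.\<close>

definition plane_coeffs :: "qbar \<Rightarrow> 2 mpoly \<Rightarrow> qbar ^ 3" where
  "plane_coeffs c p = vector
     [Poly_Mapping.lookup p (Poly_Mapping.single 2 1) + c * Poly_Mapping.lookup p (Poly_Mapping.single 1 2),
      Poly_Mapping.lookup p (Poly_Mapping.single 1 1), Poly_Mapping.lookup p 0]"

text \<open>With the basis ordered as S_2, S_1, 1, multiplication by an element with constant part 1
  is upper unitriangular, as are \<open>\<tau>\<^sub>2\<close> and \<open>\<rho>\<close>.\<close>

definition plane_mult :: "qbar \<Rightarrow> qbar ^ 3 \<Rightarrow> qbar ^ 3 \<Rightarrow> qbar ^ 3" where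
  "plane_mult c u v = vector [u $ 1 * v $ 3 + u $ 3 * v $ 1 + c * u $ 2 * v $ 2,
     u $ 2 * v $ 3 + u $ 3 * v $ 2, u $ 3 * v $ 3]"

definition plane_rep :: "qbar ^ 3 \<Rightarrow> 2 mpoly" where
  "plane_rep v = mconst (v $ 3) + mconst (v $ 2) * mvar 1 + mconst (v $ 1) * mvar 2"

lemma plane_coeffs_add: "plane_coeffs c (p + q) = plane_coeffs c p + plane_coeffs c q"
  by (simp add: vec_eq_iff forall_3 plane_coeffs_def lookup_add algebra_simps)

lemma plane_coeffs_0 [simp]: "plane_coeffs c 0 = 0"
  by (simp add: vec_eq_iff forall_3 plane_coeffs_def)

lemma plane_coeffs_sum: "plane_coeffs c (\<Sum>a\<in>A. f a) = (\<Sum>a\<in>A. plane_coeffs c (f a))"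
  by (induction A rule: infinite_finite_induct) (simp_all add: plane_coeffs_add)

lemma plane_coeffs_single:
  "plane_coeffs c (Poly_Mapping.single m a) = vector
    [(if Poly_Mapping.lookup m 1 = 0 \<and> Poly_Mapping.lookup m 2 = 1 then a else 0) +
       (if Poly_Mapping.lookup m 1 = 2 \<and> Poly_Mapping.lookup m 2 = 0 then c * a else 0),
     if Poly_Mapping.lookup m 1 = 1 \<and> Poly_Mapping.lookup m 2 = 0 then a else 0,
     if Poly_Mapping.lookup m 1 = 0 \<and> Poly_Mapping.lookup m 2 = 0 then a else 0]"
  by (simp add: vec_eq_iff forall_3 plane_coeffs_def lookup_single when_def exponent_eq_iff)

lemma plane_mult_add:
  "plane_mult c (u + v) w = plane_mult c u w + plane_mult c v w"
  "plane_mult c w (u + v) = plane_mult c w u + plane_mult c w v"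
  by (simp_all add: vec_eq_iff forall_3 plane_mult_def distrib_left distrib_right add_ac)

lemma plane_mult_0 [simp]: "plane_mult c 0 w = 0" "plane_mult c w 0 = 0"
  by (simp_all add: vec_eq_iff forall_3 plane_mult_def)

lemma plane_mult_sum:
  "plane_mult c (\<Sum>a\<in>A. f a) w = (\<Sum>a\<in>A. plane_mult c (f a) w)"
  "plane_mult c w (\<Sum>a\<in>A. f a) = (\<Sum>a\<in>A. plane_mult c w (f a))"
  by (induction A rule: infinite_finite_induct) (simp_all add: plane_mult_add)

lemma plane_coeffs_mult_single:
  "plane_coeffs c (Poly_Mapping.single (m + n) (a * b)) =
    plane_mult c (plane_coeffs c (Poly_Mapping.single m a)) (plane_coeffs c (Poly_Mapping.single n b))"
proof -
  let ?m = "Poly_Mapping.lookup m" and ?n = "Poly_Mapping.lookup n"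
  consider "?m 1 = 0" | "?m 1 = 1" | "?m 1 = 2" | "?m 1 > 2" by linarith
  then show ?thesis
    by cases
      (auto simp: vec_eq_iff forall_3 plane_coeffs_single plane_mult_def lookup_add mult_ac)
qed

text \<open>Makes \<open>plane_coeffs c\<close> a ring homomorphism to \<open>qbar ^ 3\<close> with
  the product \<open>plane_mult c\<close>; by bilinearity monomials suffice.\<close>

lemma plane_coeffs_mult: "plane_coeffs c (p * q) = plane_mult c (plane_coeffs c p) (plane_coeffs c q)"
proof -
  let ?s = "\<lambda>p m. Poly_Mapping.single m (Poly_Mapping.lookup p m)"
  have "p * q = (\<Sum>m\<in>Poly_Mapping.keys p. \<Sum>n\<in>Poly_Mapping.keys q.
      Poly_Mapping.single (m + n) (Poly_Mapping.lookup p m * Poly_Mapping.lookup q n))"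
    by (subst mpoly_expansion[of p], subst mpoly_expansion[of q]) (simp add: sum_product mult_single)
  then have "plane_coeffs c (p * q) =
      plane_mult c (\<Sum>m\<in>Poly_Mapping.keys p. plane_coeffs c (?s p m))
        (\<Sum>n\<in>Poly_Mapping.keys q. plane_coeffs c (?s q n))"
    by (simp only: plane_coeffs_sum plane_coeffs_mult_single plane_mult_sum) (rule sum.swap)
  then show ?thesis unfolding plane_coeffs_sum[symmetric] mpoly_expansion[symmetric] .
qed

lemma plane_coeffs_mconst: "plane_coeffs c (mconst a) = vector [0, 0, a]"
  by (simp add: mconst_def plane_coeffs_single)

lemma plane_coeffs_mvar:
  "plane_coeffs c (mvar 1) = vector [0, 1, 0]" "plane_coeffs c (mvar 2) = vector [1, 0, 0]"
  by (simp_all add: mvar_def plane_coeffs_single lookup_single)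

lemma plane_mult_scalar: "plane_mult c (vector [0, 0, a]) v = a *s v"
  by (simp add: vec_eq_iff forall_3 plane_mult_def)

lemma plane_mult_one: "plane_mult c v (vector [0, 0, 1]) = v"
  by (simp add: vec_eq_iff forall_3 plane_mult_def)

lemma plane_coeffs_rep [simp]: "plane_coeffs c (plane_rep v) = v"
  by (simp add: vec_eq_iff forall_3 plane_rep_def plane_coeffs_add plane_coeffs_mult
      plane_coeffs_mconst plane_coeffs_mvar plane_mult_scalar)

lemma plane_coeffs_scale: "plane_coeffs c (mconst a * p) = a *s plane_coeffs c p"
  by (simp add: plane_coeffs_mult plane_coeffs_mconst plane_mult_scalar)

lemma plane_coeffs_diff: "plane_coeffs c (p - q) = plane_coeffs c p - plane_coeffs c q"
  using plane_coeffs_add[of c "p - q" q] by simp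

lemma plane_rep_add: "plane_rep (u + v) = plane_rep u + plane_rep v"
  by (simp add: plane_rep_def mconst_simps algebra_simps)

lemma plane_rep_0: "plane_rep 0 = 0"
  by (simp add: plane_rep_def mconst_simps)

section \<open>The two ideals as kernels\<close>

lemma poly_ring_simps [simp]:
  "carrier poly_ring = UNIV" "mult poly_ring = (*)" "add poly_ring = (+)"
  "zero poly_ring = 0" "one poly_ring = 1"
  by (simp_all add: ring_of_type_algebra_def)

lemma cring_poly_ring: "cring (poly_ring :: ('i::finite) mpoly ring)"
  by (rule cring_from_type_algebra)

lemma ring_poly_ring: "ring (poly_ring :: ('i::finite) mpoly ring)"
  by (rule ring_from_type_algebra)

lemma ideal_if_closed:
  fixes R (structure)
  assumes R: "ring R" and subset: "I \<subseteq> carrier R" and zero_mem: "\<zero> \<in> I"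
    and add_mem: "\<And>x y. x \<in> I \<Longrightarrow> y \<in> I \<Longrightarrow> x \<oplus> y \<in> I"
    and mult_mem: "\<And>a x. a \<in> I \<Longrightarrow> x \<in> carrier R \<Longrightarrow> x \<otimes> a \<in> I"
      "\<And>a x. a \<in> I \<Longrightarrow> x \<in> carrier R \<Longrightarrow> a \<otimes> x \<in> I"
  shows "ideal I R"
proof (rule idealI[OF R _ mult_mem])
  interpret ring R by fact
  have "inv\<^bsub>add_monoid R\<^esub> x \<in> I" if "x \<in> I" for x
  proof -
    have "x \<in> carrier R" using that subset by blast
    then have "(\<ominus> \<one>) \<otimes> x = \<ominus> x" by (simp add: l_minus)
    then have "\<ominus> x \<in> I" using mult_mem(1)[OF that, of "\<ominus> \<one>"] by simp
    then show ?thesis by (simp add: a_inv_def)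
  qed
  then show "subgroup I (add_monoid R)"
    by (intro subgroup.intro) (use subset zero_mem add_mem in auto)
qed auto

definition plane_ideal :: "qbar \<Rightarrow> 2 mpoly set" where
  "plane_ideal c = {p. plane_coeffs c p = 0}"

lemma ideal_plane_ideal: "ideal (plane_ideal c) poly_ring"
  by (rule ideal_if_closed[OF ring_poly_ring])
    (simp_all add: plane_ideal_def plane_coeffs_add plane_coeffs_mult)

text \<open>Every monomial is congruent modulo \<open>J\<close> to its normal form, the
  \<open>plane_rep\<close> of its coordinates; the cases are the rewrite rules. By linearity the
  same holds for all polynomials, and a member of the kernel has normal form 0.\<close>

lemma plane_ideal_subset:
  assumes J: "ideal J poly_ring" and xy: "mvar 1 * mvar 2 \<in> J" and yy: "mvar 2 ^ 2 \<in> J"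
    and xx: "mvar 1 ^ 2 - mconst c * mvar 2 \<in> J"
  shows "plane_ideal c \<subseteq> J"
proof -
  have add: "p + q \<in> J" if "p \<in> J" "q \<in> J" for p q
    using additive_subgroup.a_closed[OF ideal.axioms(1)[OF J] that] by simp
  have mult: "r * p \<in> J" if "p \<in> J" for r p
    using ideal.I_l_closed[OF J that, of r] by simp
  have zero: "0 \<in> J"
    using additive_subgroup.zero_closed[OF ideal.axioms(1)[OF J]] by simp
  let ?D = "\<lambda>p. p - plane_rep (plane_coeffs c p)"
  have D_add: "?D (p + q) = ?D p + ?D q" for p q
    by (simp add: plane_coeffs_add plane_rep_add)
  have D_single: "?D (Poly_Mapping.single m a) \<in> J" for m a
  proof -
    let ?x = "mvar 1 :: 2 mpoly" and ?y = "mvar 2 :: 2 mpoly"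
    let ?i = "Poly_Mapping.lookup m 1" and ?j = "Poly_Mapping.lookup m 2"
    have mon: "Poly_Mapping.single m a = mconst a * (?x ^ ?i * ?y ^ ?j)"
      by (rule single_eq_monomial)
    consider "?i \<ge> 1" "?j \<ge> 1" | "?j = 0" "?i \<ge> 3" | "?j = 0" "?i = 2" | "?i = 0" "?j \<ge> 2"
      | "?i = 0" "?j = 0" | "?i = 1" "?j = 0" | "?i = 0" "?j = 1" by linarith
    then show ?thesis
    proof cases
      case 1
      then obtain k l where kl: "?i = Suc k" "?j = Suc l" by (metis Suc_le_D One_nat_def)
      have "plane_coeffs c (Poly_Mapping.single m a) = 0"
        using 1 by (simp add: vec_eq_iff forall_3 plane_coeffs_single)
      moreover have "Poly_Mapping.single m a = (mconst a * ?x ^ k * ?y ^ l) * (?x * ?y)"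
        unfolding mon kl by (simp add: mult_ac)
      ultimately show ?thesis using mult[OF xy] by (simp add: plane_rep_0)
    next
      case 2
      then have "?i = Suc (Suc (Suc (?i - 3)))" by simp
      then obtain k where k: "?i = Suc (Suc (Suc k))" by blast
      have "plane_coeffs c (Poly_Mapping.single m a) = 0"
        using 2 by (simp add: vec_eq_iff forall_3 plane_coeffs_single)
      \<comment> \<open>Two rewrites kill the cube of the first variable: its square becomes
        \<open>c\<close> times the second variable, and the mixed product is in
        \<open>J\<close>.\<close>
      moreover have "Poly_Mapping.single m a =
          (mconst a * ?x ^ Suc k) * (?x ^ 2 - mconst c * ?y) + (mconst a * mconst c * ?x ^ k) * (?x * ?y)"
        unfolding mon k 2 by (simp add: algebra_simps power2_eq_square)
      ultimately show ?thesis using add[OF mult[OF xx] mult[OF xy]] by (simp add: plane_rep_0)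
    next
      case 3
      have "plane_coeffs c (Poly_Mapping.single m a) = vector [c * a, 0, 0]"
        using 3 by (simp add: vec_eq_iff forall_3 plane_coeffs_single)
      then have "?D (Poly_Mapping.single m a) = mconst a * (?x ^ 2 - mconst c * ?y)"
        unfolding mon 3 by (simp add: plane_rep_def mconst_simps algebra_simps)
      then show ?thesis using mult[OF xx] by simp
    next
      case 4
      then have "?j = Suc (Suc (?j - 2))" by simp
      then obtain l where l: "?j = Suc (Suc l)" by blast
      have "plane_coeffs c (Poly_Mapping.single m a) = 0"
        using 4 by (simp add: vec_eq_iff forall_3 plane_coeffs_single)
      moreover have "Poly_Mapping.single m a = (mconst a * ?y ^ l) * ?y ^ 2"
        unfolding mon l 4 by (simp add: mult_ac power2_eq_square)
      ultimately show ?thesis using mult[OF yy] by (simp add: plane_rep_0)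
    next
      case 5
      then have "?D (Poly_Mapping.single m a) = 0"
        unfolding plane_coeffs_single unfolding mon by (simp add: plane_rep_def mconst_simps)
      with zero show ?thesis by simp
    next
      case 6
      then have "?D (Poly_Mapping.single m a) = 0"
        unfolding plane_coeffs_single unfolding mon by (simp add: plane_rep_def mconst_simps)
      with zero show ?thesis by simp
    next
      case 7
      then have "?D (Poly_Mapping.single m a) = 0"
        unfolding plane_coeffs_single unfolding mon by (simp add: plane_rep_def mconst_simps)
      with zero show ?thesis by simp
    qed
  qed
  have D_sum: "?D (\<Sum>m\<in>A. Poly_Mapping.single m (f m)) \<in> J" for A f
  proof (induction A rule: infinite_finite_induct)
    case (insert m A)
    then show ?case unfolding sum.insert[OF insert.hyps] D_add by (intro add D_single)
  qed (simp_all add: zero plane_rep_0)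
  show ?thesis
  proof
    fix p assume "p \<in> plane_ideal c"
    then have "?D p = p" by (simp add: plane_ideal_def plane_rep_0)
    moreover have "?D p \<in> J"
      using D_sum[of "Poly_Mapping.lookup p" "Poly_Mapping.keys p"] unfolding mpoly_expansion[symmetric] .
    ultimately show "p \<in> J" by simp
  qed
qed

lemma plane_coeffs_power2: "plane_coeffs c (p ^ 2) = plane_mult c (plane_coeffs c p) (plane_coeffs c p)"
  by (simp add: power2_eq_square plane_coeffs_mult)

lemma I\<^sub>1_eq: "I\<^sub>1 = plane_ideal 0"
proof
  let ?S = "{mvar 1 * mvar 2, mvar 2 ^ 2, mvar 1 ^ 2} :: 2 mpoly set"
  have "?S \<subseteq> plane_ideal 0"
    by (simp add: plane_ideal_def plane_coeffs_power2 plane_coeffs_mult plane_coeffs_mvar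
        plane_mult_def vec_eq_iff forall_3)
  then show "I\<^sub>1 \<subseteq> plane_ideal 0"
    unfolding I\<^sub>1_def by (rule ring.genideal_minimal[OF ring_poly_ring ideal_plane_ideal])
  have J: "ideal I\<^sub>1 poly_ring" and S: "?S \<subseteq> I\<^sub>1"
    unfolding I\<^sub>1_def
    by (rule ring.genideal_ideal[OF ring_poly_ring] ring.genideal_self[OF ring_poly_ring], simp)+
  show "plane_ideal 0 \<subseteq> I\<^sub>1"
    by (rule plane_ideal_subset[OF J]) (use S in \<open>simp_all add: mconst_simps\<close>)
qed

lemma I\<^sub>2_eq: "I\<^sub>2 = plane_ideal 1"
proof
  let ?S = "{mvar 1 * mvar 2, mvar 2 - mvar 1 ^ 2} :: 2 mpoly set"
  have "?S \<subseteq> plane_ideal 1"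
    by (simp add: plane_ideal_def plane_coeffs_power2 plane_coeffs_diff plane_coeffs_mult plane_coeffs_mvar
        plane_mult_def vec_eq_iff forall_3)
  then show "I\<^sub>2 \<subseteq> plane_ideal 1"
    unfolding I\<^sub>2_def by (rule ring.genideal_minimal[OF ring_poly_ring ideal_plane_ideal])
  have J: "ideal I\<^sub>2 poly_ring" and S: "?S \<subseteq> I\<^sub>2"
    unfolding I\<^sub>2_def
    by (rule ring.genideal_ideal[OF ring_poly_ring] ring.genideal_self[OF ring_poly_ring], simp)+
  have add: "p + q \<in> I\<^sub>2" if "p \<in> I\<^sub>2" "q \<in> I\<^sub>2" for p q
    using additive_subgroup.a_closed[OF ideal.axioms(1)[OF J] that] by simp
  have mult: "r * p \<in> I\<^sub>2" if "p \<in> I\<^sub>2" for r p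
    using ideal.I_l_closed[OF J that, of r] by simp
  have xy: "mvar 1 * mvar 2 \<in> I\<^sub>2" and yx: "mvar 2 - mvar 1 ^ 2 \<in> I\<^sub>2" using S by simp_all
  \<comment> \<open>The square of the second variable is not a generator of \<open>I\<^sub>2\<close>
    but a combination of the generators.\<close>
  have "(mvar 2 :: 2 mpoly) ^ 2 = mvar 2 * (mvar 2 - mvar 1 ^ 2) + mvar 1 * (mvar 1 * mvar 2)"
    by (simp add: algebra_simps power2_eq_square)
  then have yy: "mvar 2 ^ 2 \<in> I\<^sub>2" using add[OF mult[OF yx] mult[OF xy]] by simp
  have "mvar 1 ^ 2 - mconst 1 * mvar 2 = (- 1) * (mvar 2 - mvar 1 ^ 2 :: 2 mpoly)"
    by (simp add: mconst_simps)
  then have xx: "mvar 1 ^ 2 - mconst 1 * mvar 2 \<in> I\<^sub>2" using mult[OF yx] by metis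
  show "plane_ideal 1 \<subseteq> I\<^sub>2" by (rule plane_ideal_subset[OF J xy yy xx])
qed

text \<open>A residue class is a fibre of \<open>plane_coeffs c\<close>; naming it by its value
  makes the quotient computable.\<close>

definition plane_class :: "qbar \<Rightarrow> qbar ^ 3 \<Rightarrow> 2 mpoly set" where
  "plane_class c v = {p. plane_coeffs c p = v}"

lemma residue_class_eq: "residue_class (plane_ideal c) p = plane_class c (plane_coeffs c p)"
proof -
  have "q \<in> residue_class (plane_ideal c) p" if "plane_coeffs c q = plane_coeffs c p" for q
    using that unfolding a_r_coset_def'
    by (intro UN_I[of "q - p"]) (simp_all add: plane_ideal_def plane_coeffs_diff)
  moreover have "plane_coeffs c q = plane_coeffs c p" if "q \<in> residue_class (plane_ideal c) p" for q
    using that unfolding a_r_coset_def' by (auto simp: plane_ideal_def plane_coeffs_add)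
  ultimately show ?thesis unfolding plane_class_def by blast
qed

lemma plane_class_eq: "plane_class c v = residue_class (plane_ideal c) (plane_rep v)"
  by (simp add: residue_class_eq)

lemma inj_plane_class: "inj (plane_class c)"
proof (rule injI)
  fix u v assume "plane_class c u = plane_class c v"
  moreover have "plane_rep u \<in> plane_class c u" by (simp add: plane_class_def)
  ultimately show "u = v" by (simp add: plane_class_def)
qed

section \<open>The quotient ring in coordinates\<close>

lemma quot_carrier: "carrier (quot_alg (plane_ideal c)) = range (plane_class c)"
proof -
  have "carrier (quot_alg (plane_ideal c)) = range (residue_class (plane_ideal c))"
    by (auto simp: FactRing_def A_RCOSETS_def')
  also have "\<dots> = range (plane_class c)"
    by (auto simp: residue_class_eq image_iff) (metis plane_coeffs_rep)
  finally show ?thesis .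
qed

lemma quot_zero: "\<zero>\<^bsub>quot_alg (plane_ideal c)\<^esub> = plane_class c 0"
  by (simp add: FactRing_def plane_ideal_def plane_class_def)

lemma quot_add:
  "plane_class c u \<oplus>\<^bsub>quot_alg (plane_ideal c)\<^esub> plane_class c v = plane_class c (u + v)"
  using ideal.a_rcos_sum[OF ideal_plane_ideal, of "plane_rep u" "plane_rep v" c]
  by (simp add: plane_class_eq FactRing_def plane_rep_add)

lemma quot_mult:
  "plane_class c u \<otimes>\<^bsub>quot_alg (plane_ideal c)\<^esub> plane_class c v = plane_class c (plane_mult c u v)"
  using ideal.rcoset_mult_add[OF ideal_plane_ideal, of "plane_rep u" "plane_rep v" c]
  by (simp add: plane_class_eq[of c u] plane_class_eq[of c v] FactRing_def residue_class_eq[of c "_ * _"]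
      plane_coeffs_mult)

lemma cring_quot: "cring (quot_alg (plane_ideal c))"
  by (rule ideal.quotient_is_cring[OF ideal_plane_ideal cring_poly_ring])

lemma ring_quot: "ring (quot_alg (plane_ideal c))"
  using cring_quot by (simp add: cring_def)

text \<open>An ideal of the quotient, seen in coordinates. Closure under scalars is contained in the
  last clause, since \<open>vector [0, 0, a]\<close> multiplies by \<open>a\<close>; dimensions are
  therefore available.\<close>

definition plane_submodule :: "qbar \<Rightarrow> (qbar ^ 3) set \<Rightarrow> bool" where
  "plane_submodule c V \<longleftrightarrow> 0 \<in> V \<and> (\<forall>u\<in>V. \<forall>v\<in>V. u + v \<in> V) \<and> (\<forall>u. \<forall>v\<in>V. plane_mult c u v \<in> V)"

lemma plane_submodule_subspace: "plane_submodule c V \<Longrightarrow> vec.subspace V"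
  unfolding plane_submodule_def vec.subspace_def by (metis plane_mult_scalar)

lemma plane_mult_commute: "plane_mult c u v = plane_mult c v u"
  by (simp add: vec_eq_iff forall_3 plane_mult_def mult_ac add_ac)

lemma ideal_of_plane_submodule:
  assumes "plane_submodule c V"
  shows "ideal (plane_class c ` V) (quot_alg (plane_ideal c))"
proof -
  have V: "0 \<in> V" "u \<in> V \<Longrightarrow> v \<in> V \<Longrightarrow> u + v \<in> V" "v \<in> V \<Longrightarrow> plane_mult c u v \<in> V"
    "v \<in> V \<Longrightarrow> plane_mult c v u \<in> V" for u v
    using assms plane_mult_commute[of c v u] by (auto simp: plane_submodule_def)
  show ?thesis
    by (rule ideal_if_closed[OF ring_quot])
      (auto simp: quot_carrier quot_zero quot_add quot_mult intro!: imageI intro: V)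
qed

lemma plane_submodule_of_ideal:
  assumes "ideal J (quot_alg (plane_ideal c))"
  obtains V where "plane_submodule c V" "J = plane_class c ` V"
proof
  let ?V = "plane_class c -` J"
  show "plane_submodule c ?V"
    unfolding plane_submodule_def
    using additive_subgroup.zero_closed[OF ideal.axioms(1)[OF assms]]
      additive_subgroup.a_closed[OF ideal.axioms(1)[OF assms]] ideal.I_l_closed[OF assms]
    by (auto simp: quot_zero simp flip: quot_add quot_mult)
      (simp add: quot_carrier)
  have "J \<subseteq> range (plane_class c)"
    using additive_subgroup.a_subset[OF ideal.axioms(1)[OF assms]] by (simp add: quot_carrier)
  then show "J = plane_class c ` ?V" by auto
qed

lemma plane_submodule_dim_less:
  assumes "plane_submodule c V" "plane_submodule c W" "plane_class c ` V \<subset> plane_class c ` W"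
  shows "vec.dim V < vec.dim W"
proof -
  have "V \<subset> W"
    using assms(3)
    by (simp add: psubset_eq inj_image_subset_iff[OF inj_plane_class] inj_image_eq_iff[OF inj_plane_class])
  moreover have "vec.span V = V" "vec.span W = W"
    using plane_submodule_subspace[OF assms(1)] plane_submodule_subspace[OF assms(2)]
    by (simp_all only: vec.span_eq_iff)
  ultimately show ?thesis using vec.dim_psubset[of V W] by (simp only:)
qed

section \<open>Chain conditions, length and the maximal ideal\<close>

lemma strict_chain_length_le:
  fixes f :: "nat \<Rightarrow> nat"
  assumes "\<And>i. i < l \<Longrightarrow> f i < f (Suc i)"
  shows "l \<le> f l"
proof -
  have "i \<le> l \<Longrightarrow> i \<le> f i" for i
  proof (induction i)
    case (Suc i)
    then show ?case using assms[of i] by simp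
  qed simp
  then show ?thesis by simp
qed

text \<open>A strictly descending chain of ideals would have strictly descending dimensions.\<close>

lemma quot_artinian: "artinian_ring (quot_alg (plane_ideal c))"
  unfolding artinian_ring_def
proof (intro conjI cring_quot notI)
  assume "\<exists>J. \<forall>i::nat. ideal (J i) (quot_alg (plane_ideal c)) \<and> J (Suc i) \<subset> J i"
  then obtain J where J: "\<And>i::nat. ideal (J i) (quot_alg (plane_ideal c))" "\<And>i. J (Suc i) \<subset> J i"
    by blast
  have "\<exists>V. plane_submodule c V \<and> J i = plane_class c ` V" for i
    by (rule plane_submodule_of_ideal[OF J(1)[of i]]) blast
  then obtain V where V: "\<And>i. plane_submodule c (V i)" "\<And>i. J i = plane_class c ` V i" by metis
  have "vec.dim (V (Suc i)) < vec.dim (V i)" for i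
    using plane_submodule_dim_less[OF V(1) V(1)] J(2)[of i] V(2) by simp
  then show False using infinite_descent_measure[of "\<lambda>_. False" "\<lambda>i. vec.dim (V i)"] by blast
qed

lemma quot_length: "ring_length (quot_alg (plane_ideal c)) = 3"
  unfolding ring_length_def
proof (rule antisym)
  let ?L = "{l::nat. \<exists>J. (\<forall>i\<le>l. ideal (J i) (quot_alg (plane_ideal c))) \<and> (\<forall>i<l. J i \<subset> J (Suc i))}"
  show "(SUP l\<in>?L. enat l) \<le> 3"
  proof (rule SUP_least)
    fix l assume "l \<in> ?L"
    then obtain J where J: "\<And>i. i \<le> l \<Longrightarrow> ideal (J i) (quot_alg (plane_ideal c))"
      "\<And>i. i < l \<Longrightarrow> J i \<subset> J (Suc i)" by blast
    have "\<exists>V. i \<le> l \<longrightarrow> plane_submodule c V \<and> J i = plane_class c ` V" for i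
    proof (cases "i \<le> l")
      case True
      show ?thesis by (rule plane_submodule_of_ideal[OF J(1)[OF True]]) blast
    qed simp
    then obtain V where V: "\<And>i. i \<le> l \<Longrightarrow> plane_submodule c (V i) \<and> J i = plane_class c ` V i" by metis
    have "l \<le> vec.dim (V l)"
    proof (rule strict_chain_length_le)
      fix i assume "i < l"
      then show "vec.dim (V i) < vec.dim (V (Suc i))"
        using plane_submodule_dim_less[of c "V i" "V (Suc i)"] V[of i] V[of "Suc i"] J(2)[of i] by simp
    qed
    also have "\<dots> \<le> 3"
      using vec.dim_subset[of "V l" UNIV] by (simp add: card_cart_basis)
    finally show "enat l \<le> 3" by (simp add: numeral_eq_enat)
  qed
  \<comment> \<open>The flag spanned by the first \<open>i\<close> of S_2, S_1, 1. Its members are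
    ideals because products only move towards S_2, and it attains the bound given by the
    dimension.\<close>
  define V where
    "V i = {v :: qbar ^ 3. (i < 3 \<longrightarrow> v $ 3 = 0) \<and> (i < 2 \<longrightarrow> v $ 2 = 0) \<and> (i < 1 \<longrightarrow> v $ 1 = 0)}"
    for i :: nat
  have "plane_submodule c (V i)" for i
    by (auto simp: plane_submodule_def plane_mult_def V_def)
  then have 1: "ideal (plane_class c ` V i) (quot_alg (plane_ideal c))" for i
    by (rule ideal_of_plane_submodule)
  have 2: "plane_class c ` V i \<subset> plane_class c ` V (Suc i)" if "i < 3" for i
  proof -
    define e :: "qbar ^ 3"
      where "e = (\<chi> j. if j = (if i = 0 then 1 else if i = 1 then 2 else 3) then 1 else 0)"
    have "V i \<subseteq> V (Suc i)" by (auto simp: V_def)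
    moreover have "e \<in> V (Suc i)" "e \<notin> V i" using that by (auto simp: V_def e_def)
    ultimately have "V i \<subset> V (Suc i)" by blast
    then show ?thesis
      by (simp add: psubset_eq inj_image_subset_iff[OF inj_plane_class] inj_image_eq_iff[OF inj_plane_class])
  qed
  have "3 \<in> ?L"
  proof (intro CollectI exI[of _ "\<lambda>i. plane_class c ` V i"] conjI allI impI)
    show "ideal (plane_class c ` V i) (quot_alg (plane_ideal c))" for i by (rule 1)
    show "plane_class c ` V i \<subset> plane_class c ` V (Suc i)" if "i < 3" for i using that by (rule 2)
  qed
  then have "enat 3 \<le> (SUP l\<in>?L. enat l)" by (rule SUP_upper)
  then show "3 \<le> (SUP l\<in>?L. enat l)" by (simp add: numeral_eq_enat)
qed

text \<open>An element with nonzero constant part is a unit. The equations for its inverse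
  \<open>vector [a, b, 1 / v $ 3]\<close> are triangular and are solved from the last coordinate
  upwards.\<close>

lemma plane_submodule_unit:
  assumes V: "plane_submodule c V" and v: "v \<in> V" "v $ 3 \<noteq> 0"
  shows "V = UNIV"
proof -
  define b where "b = - (v $ 2 / (v $ 3)\<^sup>2)"
  define a where "a = - (v $ 1 / v $ 3 + c * b * v $ 2) / v $ 3"
  have "b * v $ 3 + v $ 2 / v $ 3 = 0" using v(2) by (simp add: b_def power2_eq_square)
  moreover have "a * v $ 3 + (v $ 1 / v $ 3 + c * b * v $ 2) = 0" using v(2) by (simp add: a_def)
  ultimately have "plane_mult c (vector [a, b, 1 / v $ 3]) v = vector [0, 0, 1]"
    using v(2) by (simp add: vec_eq_iff forall_3 plane_mult_def add_ac)
  then have "vector [0, 0, 1] \<in> V" using V v(1) unfolding plane_submodule_def by metis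
  then have "u \<in> V" for u using V unfolding plane_submodule_def by (metis plane_mult_one)
  then show ?thesis by blast
qed

abbreviation "plane_maximal c \<equiv> plane_class c ` {v. v $ 3 = 0}"

lemma plane_maximal: "maximalideal (plane_maximal c) (quot_alg (plane_ideal c))"
proof (intro maximalideal.intro maximalideal_axioms.intro)
  have "plane_submodule c {v. v $ 3 = 0}" by (simp add: plane_submodule_def plane_mult_def)
  then show "ideal (plane_maximal c) (quot_alg (plane_ideal c))" by (rule ideal_of_plane_submodule)
  have "plane_class c (vector [0, 0, 1]) \<notin> plane_maximal c"
    by (simp add: inj_image_mem_iff[OF inj_plane_class])
  then show "carrier (quot_alg (plane_ideal c)) \<noteq> plane_maximal c" unfolding quot_carrier by blast
  fix J assume J: "ideal J (quot_alg (plane_ideal c))" "plane_maximal c \<subseteq> J"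
  obtain V where V: "plane_submodule c V" "J = plane_class c ` V"
    by (rule plane_submodule_of_ideal[OF J(1)]) (rule that)
  show "J = plane_maximal c \<or> J = carrier (quot_alg (plane_ideal c))"
  proof (cases "\<exists>v\<in>V. v $ 3 \<noteq> 0")
    case True
    then have "V = UNIV" using plane_submodule_unit[OF V(1)] by blast
    then show ?thesis by (simp add: V(2) quot_carrier)
  next
    case False
    then have "J \<subseteq> plane_maximal c" by (auto simp: V(2))
    with J(2) show ?thesis by blast
  qed
qed

text \<open>A proper ideal contains no unit, so all its elements have constant part zero.\<close>

lemma plane_maximal_unique:
  assumes "maximalideal M (quot_alg (plane_ideal c))"
  shows "M = plane_maximal c"
proof -
  have I: "ideal M (quot_alg (plane_ideal c))" using assms by (rule maximalideal.axioms)
  obtain V where V: "plane_submodule c V" "M = plane_class c ` V"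
    by (rule plane_submodule_of_ideal[OF I]) (rule that)
  have "V \<noteq> UNIV" using maximalideal.I_notcarr[OF assms] by (auto simp: V(2) quot_carrier)
  then have "v $ 3 = 0" if "v \<in> V" for v using plane_submodule_unit[OF V(1) that] by blast
  then have "M \<subseteq> plane_maximal c" by (auto simp: V(2))
  moreover have "plane_maximal c \<subseteq> carrier (quot_alg (plane_ideal c))" by (auto simp: quot_carrier)
  moreover have "ideal (plane_maximal c) (quot_alg (plane_ideal c))"
    using plane_maximal by (rule maximalideal.axioms)
  ultimately have "plane_maximal c = M \<or> plane_maximal c = carrier (quot_alg (plane_ideal c))"
    using maximalideal.I_maximal[OF assms] by blast
  then show ?thesis using maximalideal.I_notcarr[OF plane_maximal[of c]] by blast
qed

section \<open>Exponentials and the correspondence\<close>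

lemma plane_coeffs_linear_form: "plane_coeffs c (linear_form a) = vector [a $ 2, a $ 1, 0]"
  by (simp add: linear_form_def sum_2 plane_coeffs_add plane_coeffs_scale plane_coeffs_mvar vec_eq_iff forall_3)

lemma admissible_plane_ideal: "admissible_ideal (plane_ideal c)"
proof -
  have bij: "bij_betw (\<lambda>a :: qbar ^ 2. residue_class (plane_ideal c) (linear_form a)) UNIV (plane_maximal c)"
    unfolding residue_class_eq plane_coeffs_linear_form
  proof (rule bij_betw_imageI)
    show "inj (\<lambda>a :: qbar ^ 2. plane_class c (vector [a $ 2, a $ 1, 0]))"
    proof (rule injI)
      fix a b :: "qbar ^ 2"
      assume "plane_class c (vector [a $ 2, a $ 1, 0]) = plane_class c (vector [b $ 2, b $ 1, 0])"
      then have "(vector [a $ 2, a $ 1, 0] :: qbar ^ 3) = vector [b $ 2, b $ 1, 0]"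
        by (rule injD[OF inj_plane_class])
      then show "a = b" by (simp add: vec_eq_iff forall_2 forall_3)
    qed
    have "v \<in> range (\<lambda>a :: qbar ^ 2. vector [a $ 2, a $ 1, 0])" if "v $ 3 = 0" for v :: "qbar ^ 3"
      by (rule range_eqI[of _ _ "vector [v $ 2, v $ 1]"]) (use that in \<open>simp add: vec_eq_iff forall_3\<close>)
    then have "{v :: qbar ^ 3. v $ 3 = 0} = range (\<lambda>a :: qbar ^ 2. vector [a $ 2, a $ 1, 0])" by auto
    then show "range (\<lambda>a :: qbar ^ 2. plane_class c (vector [a $ 2, a $ 1, 0])) = plane_maximal c"
      by (simp add: image_image)
  qed
  show ?thesis
    unfolding admissible_ideal_def
  proof (intro conjI allI impI ideal_plane_ideal quot_artinian ex1I[of _ "plane_maximal c"])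
    show "ring_length (quot_alg (plane_ideal c)) = enat (CARD(2) + 1)"
      by (simp add: quot_length numeral_eq_enat)
    show "maximalideal (plane_maximal c) (quot_alg (plane_ideal c))" by (rule plane_maximal)
    fix M assume "maximalideal M (quot_alg (plane_ideal c))"
    then show M: "M = plane_maximal c" by (rule plane_maximal_unique)
    show "bij_betw (\<lambda>a :: qbar ^ 2. residue_class (plane_ideal c) (linear_form a)) UNIV M"
      unfolding M by (rule bij)
  qed
qed

lemma exp_class_eq:
  "exp_class (plane_ideal c) a = plane_class c (vector [a $ 2 + c * (1 / 2 * (a $ 1)\<^sup>2), a $ 1, 1])"
proof -
  let ?l = "linear_form a" and ?K = "{k. linear_form a ^ k \<notin> plane_ideal c}"
  let ?f = "\<lambda>k. (1 / fact k) *s plane_coeffs c (?l ^ k)"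
  have l0: "plane_coeffs c (?l ^ 0) = vector [0, 0, 1]"
    using plane_coeffs_mconst[of c 1] by (simp add: mconst_simps)
  have l1: "plane_coeffs c (?l ^ 1) = vector [a $ 2, a $ 1, 0]" by (simp add: plane_coeffs_linear_form)
  have l2: "plane_coeffs c (?l ^ 2) = vector [c * (a $ 1)\<^sup>2, 0, 0]"
    unfolding plane_coeffs_power2 plane_coeffs_linear_form
    by (simp add: plane_mult_def power2_eq_square mult_ac)
  have l3: "plane_coeffs c (?l ^ (3 + k)) = 0" for k
  proof -
    have "?l ^ (3 + k) = (?l ^ 2 * ?l ^ 1) * ?l ^ k" by (simp add: power_add power2_eq_square power3_eq_cube)
    moreover have "plane_coeffs c (?l ^ 2 * ?l ^ 1) = 0"
      unfolding plane_coeffs_mult l1 l2 by (simp add: plane_mult_def vec_eq_iff forall_3)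
    ultimately show ?thesis by (simp add: plane_coeffs_mult)
  qed
  have sub: "?K \<subseteq> {0, 1, 2}"
  proof
    fix k assume "k \<in> ?K"
    then have "\<not> k \<ge> 3" using l3[of "k - 3"] by (auto simp: plane_ideal_def)
    then show "k \<in> {0, 1, 2}" by auto
  qed
  have "plane_coeffs c (\<Sum>k\<in>?K. mconst (1 / fact k) * ?l ^ k) = (\<Sum>k\<in>?K. ?f k)"
    by (simp add: plane_coeffs_sum plane_coeffs_scale)
  \<comment> \<open>\<open>exp_class\<close> omits the powers that lie in the ideal; their
    coordinates are zero, so the sum may always run over 0, 1, 2.\<close>
  also have "\<dots> = (\<Sum>k\<in>{0, 1, 2}. ?f k)"
    using sub by (intro sum.mono_neutral_left) (auto simp: plane_ideal_def)
  also have "\<dots> = ?f 0 + ?f 1 + ?f 2" by (simp add: add_ac)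
  also have "\<dots> = vector [a $ 2 + c * (1 / 2 * (a $ 1)\<^sup>2), a $ 1, 1]"
    unfolding l0 l1 l2 by (simp add: vec_eq_iff forall_3)
  finally show ?thesis unfolding exp_class_def residue_class_eq by simp
qed

text \<open>The assumption says that \<open>\<tau> a\<close> is the matrix of multiplication by the
  exponential in the basis S_2, S_1, 1; the linear identification is
  \<open>plane_class c\<close>.\<close>

lemma corresponds_plane_ideal:
  assumes "\<And>a v. \<tau> a *v v = plane_mult c (vector [a $ 2 + c * (1 / 2 * (a $ 1)\<^sup>2), a $ 1, 1]) v"
  shows "corresponds (proj_action \<tau>) (plane_ideal c)"
  unfolding corresponds_def
proof (intro conjI admissible_plane_ideal exI allI ballI)
  have scale: "residue_class (plane_ideal c) (mconst b) \<otimes>\<^bsub>quot_alg (plane_ideal c)\<^esub> plane_class c v =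
      plane_class c (b *s v)" for b v
    by (simp add: residue_class_eq quot_mult plane_coeffs_mconst plane_mult_scalar)
  show "linear_coordinates (plane_ideal c) (plane_class c)"
    unfolding linear_coordinates_def
    by (simp add: quot_carrier quot_add scale inj_plane_class bij_betw_def)
  have line: "quot_line (plane_ideal c) (plane_class c v) = plane_class c ` vec.span {v}" for v
    unfolding quot_line_def scale vec.span_singleton image_image ..
  have "range (plane_class c) - {plane_class c 0} = plane_class c ` {v. v \<noteq> 0}"
    by (auto simp: inj_eq[OF inj_plane_class])
  then have "quot_proj (plane_ideal c) = (`) (plane_class c) ` proj_points"
    unfolding quot_proj_def quot_carrier quot_zero proj_points_eq
    by (simp add: image_image line setcompr_eq_image)
  moreover have "inj_on ((`) (plane_class c)) proj_points"
    by (rule inj_onI) (simp add: inj_image_eq_iff[OF inj_plane_class])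
  ultimately show "bij_betw ((`) (plane_class c)) proj_points (quot_proj (plane_ideal c))"
    by (simp add: bij_betw_def)
  fix a and p :: "(qbar ^ 3) set"
  show "plane_class c ` proj_action \<tau> a p = exp_action (plane_ideal c) a (plane_class c ` p)"
    by (simp add: proj_action_def exp_action_def image_image exp_class_eq quot_mult assms)
qed

lemma corresponds_\<tau>\<^sub>2: "corresponds (proj_action \<tau>\<^sub>2) I\<^sub>1"
  unfolding I\<^sub>1_eq
  by (rule corresponds_plane_ideal)
    (simp add: \<tau>\<^sub>2_mult_vec plane_mult_def vec_eq_iff forall_3 add_ac)

lemma corresponds_\<rho>: "corresponds (proj_action \<rho>) I\<^sub>2"
  unfolding I\<^sub>2_eq
  by (rule corresponds_plane_ideal)
    (simp add: \<rho>_mult_vec plane_mult_def vec_eq_iff forall_3 add_ac)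

theorem proposition3p2:
  shows "ga_representation \<tau>\<^sub>2 \<and> ga_representation \<rho> \<and>
    ga_structure (proj_action \<tau>\<^sub>2) \<and> ga_structure (proj_action \<rho>) \<and>
    \<not> ga_equivalent (proj_action \<tau>\<^sub>2) (proj_action \<rho>) \<and>
    (\<forall>\<phi> :: qbar ^ 2 \<Rightarrow> (qbar ^ 3) set \<Rightarrow> (qbar ^ 3) set. ga_structure \<phi> \<longrightarrow>
       ga_equivalent \<phi> (proj_action \<tau>\<^sub>2) \<or> ga_equivalent \<phi> (proj_action \<rho>)) \<and>
    corresponds (proj_action \<tau>\<^sub>2) I\<^sub>1 \<and>
    corresponds (proj_action \<rho>) I\<^sub>2"
  by (intro conjI allI impI ga_representation_\<tau>\<^sub>2 ga_representation_\<rho> ga_structure_\<tau>\<^sub>2 ga_structure_\<rho>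
      not_ga_equivalent_\<tau>\<^sub>2_\<rho> ga_structure_plane_classification corresponds_\<tau>\<^sub>2 corresponds_\<rho>)

end
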